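(* Let $k \geq 4$ be an integer and let $I_k$ be the $k\times k$ identity matrix. Let $$E(I_k, s) = \sum_{\mathbf{x} \in \mathbb{Z}^k \setminus \{0\}} (x_1^2+\cdots+x_k^2)^{-ks/2} = \sum_{n\ge 1} r_k(n)\, n^{-ks/2},$$ where $r_k(n)=\#\{\mathbf{x}\in\mathbb{Z}^k : x_1^2+\cdots+x_k^2=n\}$, defined for $\Re s>1$ and continued meromorphically to $\mathbb{C}$. Then $$E(I_k, 1/2 + it) = \Omega\bigl((1+|t|)^{\frac{k}{4} - \frac{1}{2}}\bigr),$$ i.e. $\limsup_{|t|\to\infty} |E(I_k,1/2+it)|\,(1+|t|)^{-(k/4-1/2)} > 0$.
   Context: The series is the Epstein zeta-function of the quadratic form $x_1^2+\dots+x_k^2$, normalized so that its critical strip is $0\le\Re s\le 1$; its meromorphic continuation has only a simple pole at $s=1$. *)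

theory Defs
  imports "HOL-Complex_Analysis.Complex_Analysis"
begin

text \<open>
  The lattice \<open>\<int>\<^sup>k\<close> is the set of integer-valued functions on \<open>{1..k}\<close>, made extensional so that each
  point has exactly one representative.
\<close>

definition int_lattice :: "nat \<Rightarrow> (nat \<Rightarrow> int) set" where
  "int_lattice k = {1..k} \<rightarrow>\<^sub>E UNIV"

definition sum_of_squares :: "nat \<Rightarrow> (nat \<Rightarrow> int) \<Rightarrow> int" where
  "sum_of_squares k x = (\<Sum>i = 1..k. (x i)\<^sup>2)"

definition nonzero_lattice :: "nat \<Rightarrow> (nat \<Rightarrow> int) set" where
  "nonzero_lattice k = {x \<in> int_lattice k. \<exists>i\<in>{1..k}. x i \<noteq> 0}"

definition rep_count :: "nat \<Rightarrow> nat \<Rightarrow> nat" where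
  "rep_count k n = card {x \<in> int_lattice k. sum_of_squares k x = int n}"

definition epstein_series :: "nat \<Rightarrow> complex \<Rightarrow> complex" where
  "epstein_series k s =
     (\<Sum>\<^sub>\<infinity>x\<in>nonzero_lattice k. of_int (sum_of_squares k x) powr (- (of_nat k * s / 2)))"

text \<open>
  The meromorphic continuation to the whole plane. \<^const>\<open>nicely_meromorphic_on\<close> rather than
  \<^const>\<open>meromorphic_on\<close> fixes the values at the poles (as 0) and at removable singularities, so that
  the continuation is unique as a function. No choice of poles is built in.
\<close>

definition epstein_zeta :: "nat \<Rightarrow> complex \<Rightarrow> complex" where
  "epstein_zeta k =
     (THE f. f nicely_meromorphic_on UNIV \<and> (\<forall>s. Re s > 1 \<longrightarrow> f s = epstein_series k s))"

lemma summable_on_int_powr: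
  assumes "\<sigma> > (1 :: real)"
  shows "(\<lambda>m. (1 + (real_of_int m)\<^sup>2) powr (- \<sigma> / 2)) summable_on (UNIV :: int set)"
proof -
  let ?f = "\<lambda>m::int. (1 + (real_of_int m)\<^sup>2) powr (- \<sigma> / 2)"
  have le: "(1 + (real n)\<^sup>2) powr (- \<sigma> / 2) \<le> real n powr (- \<sigma>)" if "n \<ge> 1" for n :: nat
  proof -
    have "(1 + (real n)\<^sup>2) powr (- \<sigma> / 2) \<le> ((real n)\<^sup>2) powr (- \<sigma> / 2)"
      using that assms by (intro powr_mono2') auto
    also have "\<dots> = (real n powr 2) powr (- \<sigma> / 2)"
      using that by simp
    also have "\<dots> = real n powr (- \<sigma>)"
      by (simp only: powr_powr) simp
    finally show ?thesis .
  qed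
  have "summable (\<lambda>n. real n powr (- \<sigma>))"
    using assms by (simp add: summable_real_powr_iff)
  hence "summable (\<lambda>n. (1 + (real n)\<^sup>2) powr (- \<sigma> / 2))"
    by (rule summable_comparison_test'[where N = 1]) (use le in auto)
  hence "(\<lambda>n::nat. (1 + (real n)\<^sup>2) powr (- \<sigma> / 2)) summable_on UNIV"
    by (intro summable_nonneg_imp_summable_on) auto
  hence *: "(\<lambda>n. ?f (int n)) summable_on UNIV" "(\<lambda>n. ?f (- int n)) summable_on UNIV"
    by simp_all
  have "?f summable_on range int"
    using *(1) by (subst summable_on_reindex) (auto simp: o_def)
  moreover have "?f summable_on range (\<lambda>n. - int n)"
    using *(2) by (subst summable_on_reindex) (auto simp: o_def inj_on_def)
  ultimately have "?f summable_on (range int \<union> range (\<lambda>n. - int n))"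
    by (rule summable_on_union)
  moreover have "range int \<union> range (\<lambda>n. - int n) = UNIV"
    by (auto simp: image_iff) (metis int_cases2)
  ultimately show ?thesis by simp
qed

lemma sum_of_squares_pos:
  assumes "x \<in> nonzero_lattice k"
  shows "sum_of_squares k x \<ge> 1"
proof -
  obtain i where i: "i \<in> {1..k}" "x i \<noteq> 0"
    using assms by (auto simp: nonzero_lattice_def)
  have "0 < (x i)\<^sup>2" using i by simp
  also have "\<dots> \<le> sum_of_squares k x"
    unfolding sum_of_squares_def using i by (intro member_le_sum) auto
  finally show ?thesis by simp
qed

lemma epstein_series_abs_summable:
  assumes "Re s > 1"
  shows "(\<lambda>x. norm (of_int (sum_of_squares k x) powr (- (of_nat k * s / 2)) :: complex))
           summable_on nonzero_lattice k"
proof -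
  define \<sigma> where "\<sigma> = Re s"
  define g where "g = (\<lambda>m::int. (1 + (real_of_int m)\<^sup>2) powr (- \<sigma> / 2))"
  define C where "C = infsum g UNIV"
  define D where "D = 2 powr (real k * \<sigma> / 2)"
  have \<sigma>: "\<sigma> > 1" using assms by (simp add: \<sigma>_def)
  have g: "g summable_on UNIV"
    unfolding g_def using \<sigma> by (rule summable_on_int_powr)
  have g0: "g m \<ge> 0" for m by (simp add: g_def)
  have bound: "norm (of_int (sum_of_squares k x) powr (- (of_nat k * s / 2)) :: complex)
                 \<le> D * (\<Prod>i\<in>{1..k}. g (x i))" if x: "x \<in> nonzero_lattice k" for x
  proof -
    define q where "q = real_of_int (sum_of_squares k x)"
    have q1: "q \<ge> 1" using sum_of_squares_pos[OF x] by (simp add: q_def)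
    have "(\<Prod>i\<in>{1..k}. 1 + (real_of_int (x i))\<^sup>2) \<le> (\<Prod>i\<in>{1..k}. 1 + q)"
    proof (intro prod_mono conjI)
      fix i assume i: "i \<in> {1..k}"
      have "(x i)\<^sup>2 \<le> sum_of_squares k x"
        unfolding sum_of_squares_def using i by (intro member_le_sum) auto
      hence "real_of_int ((x i)\<^sup>2) \<le> q" unfolding q_def by linarith
      thus "1 + (real_of_int (x i))\<^sup>2 \<le> 1 + q" by simp
    qed auto
    hence le: "(\<Prod>i\<in>{1..k}. 1 + (real_of_int (x i))\<^sup>2) \<le> (1 + q) powr real k"
      using q1 by (simp add: powr_realpow)
    have pos: "(\<Prod>i\<in>{1..k}. 1 + (real_of_int (x i))\<^sup>2) > 0"
      by (intro prod_pos) (auto intro: add_pos_nonneg)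
    have "(1 + q) powr (- (real k * \<sigma> / 2)) = ((1 + q) powr real k) powr (- \<sigma> / 2)"
      by (simp only: powr_powr) simp
    also have "\<dots> \<le> (\<Prod>i\<in>{1..k}. 1 + (real_of_int (x i))\<^sup>2) powr (- \<sigma> / 2)"
      using le pos \<sigma> by (intro powr_mono2') auto
    also have "\<dots> = (\<Prod>i\<in>{1..k}. g (x i))"
      unfolding g_def by (rule prod_powr_distrib)
    finally have prod: "(1 + q) powr (- (real k * \<sigma> / 2)) \<le> (\<Prod>i\<in>{1..k}. g (x i))" .
    have "norm (of_int (sum_of_squares k x) powr (- (of_nat k * s / 2)) :: complex)
            = norm (of_real q powr (- (of_nat k * s / 2)) :: complex)"
      by (simp add: q_def)
    also have "\<dots> = q powr (- (real k * \<sigma> / 2))"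
      using q1 by (subst norm_powr_real_powr) (auto simp: \<sigma>_def)
    also have "\<dots> \<le> ((1 + q) / 2) powr (- (real k * \<sigma> / 2))"
      using q1 \<sigma> by (intro powr_mono2') auto
    also have "\<dots> = D * (1 + q) powr (- (real k * \<sigma> / 2))"
      using q1 by (simp add: D_def powr_divide powr_minus field_simps)
    also have "\<dots> \<le> D * (\<Prod>i\<in>{1..k}. g (x i))"
      using prod by (intro mult_left_mono) (auto simp: D_def)
    finally show ?thesis .
  qed
  have "(\<lambda>x. D * (\<Prod>i\<in>{1..k}. g (x i))) summable_on nonzero_lattice k"
  proof (intro nonneg_bounded_partial_sums_imp_summable_on)
    show "\<forall>\<^sub>F F in finite_subsets_at_top (nonzero_lattice k).
            (\<Sum>x\<in>F. D * (\<Prod>i\<in>{1..k}. g (x i))) \<le> D * C ^ k"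
    proof (rule eventually_finite_subsets_at_top_weakI)
      fix F assume F: "finite F" "F \<subseteq> nonzero_lattice k"
      define B where "B = (\<Union>x\<in>F. x ` {1..k})"
      have "finite B" using F by (auto simp: B_def)
      have sub: "F \<subseteq> {1..k} \<rightarrow>\<^sub>E B"
      proof (rule subsetI)
        fix x assume x: "x \<in> F"
        hence "x \<in> {1..k} \<rightarrow>\<^sub>E UNIV"
          using F(2) by (auto simp: nonzero_lattice_def int_lattice_def)
        moreover have "x i \<in> B" if "i \<in> {1..k}" for i
          unfolding B_def using x that by blast
        ultimately show "x \<in> {1..k} \<rightarrow>\<^sub>E B" by (simp add: PiE_iff)
      qed
      have "(\<Sum>x\<in>F. \<Prod>i\<in>{1..k}. g (x i)) \<le> (\<Sum>x\<in>{1..k} \<rightarrow>\<^sub>E B. \<Prod>i\<in>{1..k}. g (x i))"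
        using sub \<open>finite B\<close> g0 by (intro sum_mono2 finite_PiE prod_nonneg) auto
      also have "\<dots> = (\<Prod>i\<in>{1..k}. \<Sum>m\<in>B. g m)"
        using \<open>finite B\<close> by (intro prod_sum_PiE [symmetric]) auto
      also have "\<dots> \<le> (\<Prod>i\<in>{1..k}. C)"
        unfolding C_def using g g0 \<open>finite B\<close>
        by (intro prod_mono conjI sum_nonneg finite_sum_le_infsum) auto
      finally have "(\<Sum>x\<in>F. \<Prod>i\<in>{1..k}. g (x i)) \<le> C ^ k" by simp
      thus "(\<Sum>x\<in>F. D * (\<Prod>i\<in>{1..k}. g (x i))) \<le> D * C ^ k"
        by (simp add: D_def flip: sum_distrib_left)
    qed
  qed (auto simp: D_def g0 intro!: mult_nonneg_nonneg prod_nonneg)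
  thus ?thesis
    by (rule summable_on_comparison_test) (use bound in auto)
qed

lemma finite_rep: "finite {x \<in> int_lattice k. sum_of_squares k x = int n}"
proof (rule finite_subset)
  show "{x \<in> int_lattice k. sum_of_squares k x = int n} \<subseteq> {1..k} \<rightarrow>\<^sub>E {- int n..int n}"
  proof (rule subsetI)
    fix x assume "x \<in> {x \<in> int_lattice k. sum_of_squares k x = int n}"
    hence x: "x \<in> int_lattice k" "sum_of_squares k x = int n" by auto
    have "x i \<in> {- int n..int n}" if i: "i \<in> {1..k}" for i
    proof -
      have "(x i)\<^sup>2 \<le> int n"
        unfolding x(2)[symmetric] sum_of_squares_def using i by (intro member_le_sum) auto
      moreover have "\<bar>x i\<bar> \<le> (x i)\<^sup>2"
        using self_le_power[of "\<bar>x i\<bar>" 2] by (cases "x i = 0") auto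
      ultimately show ?thesis by auto
    qed
    thus "x \<in> {1..k} \<rightarrow>\<^sub>E {- int n..int n}"
      using x(1) by (auto simp: int_lattice_def PiE_iff)
  qed
qed (auto intro: finite_PiE)

lemma epstein_series_has_sum_rep_count:
  assumes "Re s > 1"
  shows "((\<lambda>n. of_nat (rep_count k n) * of_nat n powr (- (of_nat k * s / 2)))
            has_sum epstein_series k s) {1..}"
proof -
  let ?h = "\<lambda>n. of_int n powr (- (of_nat k * s / 2)) :: complex"
  define B where "B = (\<lambda>n::nat. {x \<in> int_lattice k. sum_of_squares k x = int n})"
  have "((\<lambda>x. ?h (sum_of_squares k x)) has_sum epstein_series k s) (nonzero_lattice k)"
    unfolding epstein_series_def
    by (rule has_sum_infsum[OF abs_summable_summable[OF epstein_series_abs_summable[OF assms]]])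
  moreover have "bij_betw snd (Sigma {1..} B) (nonzero_lattice k)"
  proof (rule bij_betwI[where g = "\<lambda>x. (nat (sum_of_squares k x), x)"])
    have "x \<in> nonzero_lattice k" if "n \<ge> 1" "x \<in> B n" for n x
    proof (rule ccontr)
      assume "x \<notin> nonzero_lattice k"
      hence "\<forall>i\<in>{1..k}. x i = 0" using that(2) by (auto simp: B_def nonzero_lattice_def)
      hence "sum_of_squares k x = 0" by (simp add: sum_of_squares_def)
      thus False using that by (simp add: B_def)
    qed
    thus "snd \<in> Sigma {1..} B \<rightarrow> nonzero_lattice k" by auto
    show "(\<lambda>x. (nat (sum_of_squares k x), x)) \<in> nonzero_lattice k \<rightarrow> Sigma {1..} B"
    proof (rule funcsetI)
      fix x assume x: "x \<in> nonzero_lattice k"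
      have "x \<in> int_lattice k" using x by (simp add: nonzero_lattice_def)
      thus "(nat (sum_of_squares k x), x) \<in> Sigma {1..} B"
        using sum_of_squares_pos[OF x] by (simp add: B_def)
    qed
  qed (auto simp: B_def)
  ultimately have sum: "((\<lambda>p. ?h (sum_of_squares k (snd p))) has_sum epstein_series k s) (Sigma {1..} B)"
    using has_sum_reindex_bij_betw[of snd "Sigma {1..} B" "nonzero_lattice k"
            "\<lambda>x. ?h (sum_of_squares k x)"] by blast
  have inner: "((\<lambda>x. ?h (sum_of_squares k (snd (n, x)))) has_sum
                  (of_nat (rep_count k n) * of_nat n powr (- (of_nat k * s / 2)))) (B n)" for n
    using finite_rep[of k n]
    by (intro has_sum_finiteI) (auto simp: B_def rep_count_def)
  show ?thesis
    by (rule has_sum_SigmaD[OF sum inner])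
qed

end

theory Submission
  imports Defs "HOL-Probability.Probability"
begin

text \<open>
  Put \<open>w = k s / 2\<close> and let \<open>T(z) = \<Sum>n. r\<^sub>k(n) exp (- n z)\<close>, so that \<open>T(x) = theta x ^ k\<close> for real \<open>x > 0\<close>. The estimate
  \<open>theta x = sqrt (pi / x) + O(x^N)\<close> for \<open>x \<rightarrow> 0\<close> gives the continuation of the zeta function, and on the
  critical line \<open>Gamma w * E(s)\<close> is the Mellin transform of \<open>R(z) = T(z) - 1 - (pi / z) powr (k / 2)\<close>.
  If \<open>E\<close> were \<open>o((1 + \<bar>t\<bar>) powr (k / 4 - 1 / 2))\<close>, then Mellin inversion, which by the decay of \<open>Gamma\<close> extends from the
  positive reals to the right half-plane, would give \<open>R(\<delta> + 2 * pi * \<i>) = o(\<delta> powr (- k / 2))\<close> as \<open>\<delta> \<rightarrow> 0\<close>. But \<open>T\<close> has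
  period \<open>2 * pi * \<i>\<close>, so \<open>T(\<delta> + 2 * pi * \<i>) = T(\<delta>)\<close> grows like \<open>(pi / \<delta>) powr (k / 2)\<close>, while the subtracted term
  stays bounded there.
\<close>

section \<open>Laplace and Fourier integrals\<close>

text \<open>The exponent is the one at which three powers balance. On the critical line
  \<open>w = k / 4 + i u\<close> with \<open>u = k t / 2\<close>, and there Gamma has size
  \<open>|u| powr (k / 4 - 1 / 2) * exp (- pi |u| / 2)\<close>. A zeta value that is little-o of
  \<open>|u| powr (k / 4 - 1 / 2)\<close> makes the product little-o of
  \<open>|u| powr (k / 2 - 1) * exp (- pi |u| / 2)\<close>. The argument of
  \<open>delta + 2 pi i\<close> stays below \<open>pi / 2\<close> by at least
  \<open>delta / 9\<close>, so inversion at that point loses a factor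
  \<open>exp (|u| (pi / 2 - delta / 9))\<close> and leaves the integral of
  \<open>|u| powr (k / 2 - 1) * exp (- |u| delta / 9)\<close>, of order
  \<open>delta powr (- k / 2)\<close>. This is exactly the growth of \<open>T\<close> there, so only
  the smallness of the implied constant yields the contradiction. Substituting
  \<open>x = exp y\<close> turns the Mellin transform into a Fourier transform and the right
  half-plane into the strip of height \<open>pi / 2\<close> on both sides of the real line; all
  complex arguments take place in that strip. The line \<open>Re w = k / 4\<close> becomes a weight
  \<open>exp (k y / 4)\<close>.\<close>

lemma laplace_integral_holomorphic:
  fixes c :: "real \<Rightarrow> complex"
  assumes meas [measurable]: "c \<in> borel_measurable borel" and U: "open U"
    and int: "\<And>w. w \<in> U \<Longrightarrow> integrable lborel (\<lambda>y. c y * exp (w * of_real y))"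
  shows "(\<lambda>w. \<integral>y. c y * exp (w * of_real y) \<partial>lborel) holomorphic_on U"
proof -
  have "\<exists>D. ((\<lambda>w. \<integral>y. c y * exp (w * of_real y) \<partial>lborel) has_field_derivative D) (at w)"
    if w: "w \<in> U" for w
  proof -
    obtain r where r: "r > 0" "cball w r \<subseteq> U"
      using U w open_contains_cball by blast
    \<comment> \<open>The dominating function comes from integrability at two further points of
      \<open>U\<close>: near \<open>w\<close> the factor \<open>exp (h y)\<close> is controlled by
      \<open>exp (r |y|)\<close>, hence by \<open>exp (r y) + exp (- r y)\<close>, which shifts
      \<open>w\<close> by \<open>r\<close> and by \<open>- r\<close>.\<close>
    define g where "g = (\<lambda>y. norm (c y * exp ((w + of_real r) * of_real y))
                           + norm (c y * exp ((w - of_real r) * of_real y)))"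
    have gint: "integrable lborel g"
      unfolding g_def using r
      by (intro Bochner_Integration.integrable_add integrable_norm int subsetD[OF r(2)]) (auto simp: dist_norm)
    define q where "q = (\<lambda>h y. c y * exp (w * of_real y) * ((exp (h * of_real y) - 1) / h))"
    have q_bound: "norm (q h y) \<le> 2 / r * g y" if h: "h \<noteq> 0" "norm h < r / 2" for h y
    proof -
      have "norm (exp (h * of_real y) - 1) \<le> exp \<bar>Re (h * of_real y)\<bar> * norm (h * of_real y)"
        using Taylor_exp[of "h * of_real y" 0] by simp
      also have "\<dots> \<le> exp (r / 2 * \<bar>y\<bar>) * norm (h * of_real y)"
      proof (rule mult_right_mono)
        have "\<bar>Re h\<bar> \<le> r / 2" using abs_Re_le_cmod[of h] h by linarith
        hence "\<bar>Re h\<bar> * \<bar>y\<bar> \<le> r / 2 * \<bar>y\<bar>" by (intro mult_right_mono) auto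
        thus "exp \<bar>Re (h * of_real y)\<bar> \<le> exp (r / 2 * \<bar>y\<bar>)" by (simp add: abs_mult)
      qed auto
      also have "\<dots> = norm h * (\<bar>y\<bar> * exp (r / 2 * \<bar>y\<bar>))" by (simp add: norm_mult)
      finally have "norm ((exp (h * of_real y) - 1) / h) \<le> \<bar>y\<bar> * exp (r / 2 * \<bar>y\<bar>)"
        using h by (simp add: norm_divide field_simps)
      \<comment> \<open>Half of the available exponent \<open>r |y|\<close> absorbs the factor
        \<open>|y|\<close> through \<open>v <= exp v\<close>; this is why \<open>h\<close> is kept
        below \<open>r / 2\<close>.\<close>
      also have "\<dots> = 2 / r * ((r / 2 * \<bar>y\<bar>) * exp (r / 2 * \<bar>y\<bar>))" using r by simp
      also have "\<dots> \<le> 2 / r * (exp (r / 2 * \<bar>y\<bar>) * exp (r / 2 * \<bar>y\<bar>))"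
      proof (intro mult_left_mono mult_right_mono)
        show "r / 2 * \<bar>y\<bar> \<le> exp (r / 2 * \<bar>y\<bar>)"
          using exp_ge_add_one_self[of "r / 2 * \<bar>y\<bar>"] by linarith
      qed (use r in auto)
      also have "exp (r / 2 * \<bar>y\<bar>) * exp (r / 2 * \<bar>y\<bar>) = exp (r * \<bar>y\<bar>)"
        by (simp flip: exp_add)
      also have "2 / r * exp (r * \<bar>y\<bar>) \<le> 2 / r * (exp (r * y) + exp (- r * y))"
        using r by (intro mult_left_mono) (cases "y \<ge> 0"; simp)+
      finally have *: "norm ((exp (h * of_real y) - 1) / h) \<le> 2 / r * (exp (r * y) + exp (- r * y))"
        by simp
      have "norm (q h y) \<le> norm (c y * exp (w * of_real y)) * (2 / r * (exp (r * y) + exp (- r * y)))"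
        unfolding q_def norm_mult[of _ "(exp _ - 1) / _"] by (intro mult_left_mono * norm_ge_zero)
      also have "\<dots> = 2 / r * g y"
      proof -
        have "Re ((w + of_real r) * of_real y) = Re (w * of_real y) + r * y"
             "Re ((w - of_real r) * of_real y) = Re (w * of_real y) + - r * y"
          by (simp_all add: algebra_simps)
        hence "g y = norm (c y * exp (w * of_real y)) * (exp (r * y) + exp (- r * y))"
          unfolding g_def norm_mult norm_exp_eq_Re
          by (simp only: exp_add distrib_left mult.assoc)
        thus ?thesis by simp
      qed
      finally show ?thesis .
    qed
    have q_lim: "((\<lambda>h. q h y) \<longlongrightarrow> c y * exp (w * of_real y) * of_real y) (at 0)" for y
    proof -
      have "((\<lambda>h. exp (h * of_real y)) has_field_derivative of_real y) (at 0)"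
        by (auto intro!: derivative_eq_intros)
      hence "((\<lambda>h. (exp (h * of_real y) - 1) / h) \<longlongrightarrow> complex_of_real y) (at 0)"
        by (simp add: DERIV_def)
      thus ?thesis unfolding q_def by (intro tendsto_intros)
    qed
    have "((\<lambda>h. \<integral>y. q h y \<partial>lborel) \<longlongrightarrow> (\<integral>y. c y * exp (w * of_real y) * of_real y \<partial>lborel)) (at 0)"
      unfolding tendsto_at_iff_sequentially comp_def
    proof (intro allI impI)
      fix X :: "nat \<Rightarrow> complex"
      assume X: "\<forall>i. X i \<in> UNIV - {0}" "X \<longlonglongrightarrow> 0"
      have "r / 2 > 0" using r(1) by simp
      from LIMSEQ_D[OF X(2) this] obtain N where N': "\<forall>n\<ge>N. norm (X n - 0) < r / 2" ..
      have N: "norm (X n) < r / 2" if "n \<ge> N" for n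
        using N'[rule_format, OF that] by simp
      show "(\<lambda>i. \<integral>y. q (X i) y \<partial>lborel) \<longlonglongrightarrow> (\<integral>y. c y * exp (w * of_real y) * of_real y \<partial>lborel)"
      proof (rule LIMSEQ_offset[where k = N], rule integral_dominated_convergence)
        show "AE x in lborel. norm (q (X (n + N)) x) \<le> 2 / r * g x" for n
          using q_bound[of "X (n + N)"] X(1) N[of "n + N"] by auto
        show "AE x in lborel. (\<lambda>i. q (X (i + N)) x) \<longlonglongrightarrow> c x * exp (w * of_real x) * of_real x"
        proof (rule AE_I2)
          fix y
          have "filterlim X (at 0) sequentially"
            using X by (auto simp: filterlim_at)
          hence "(\<lambda>i. q (X i) y) \<longlonglongrightarrow> c y * exp (w * of_real y) * of_real y"
            by (rule filterlim_compose[OF q_lim])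
          thus "(\<lambda>i. q (X (i + N)) y) \<longlonglongrightarrow> c y * exp (w * of_real y) * of_real y"
            by (rule LIMSEQ_ignore_initial_segment)
        qed
      qed (use gint in \<open>auto simp: q_def\<close>)
    qed
    moreover have "\<forall>\<^sub>F h in at 0. (\<integral>y. q h y \<partial>lborel) =
       ((\<integral>y. c y * exp ((w + h) * of_real y) \<partial>lborel) - (\<integral>y. c y * exp (w * of_real y) \<partial>lborel)) / h"
      unfolding eventually_at
    proof (intro exI[of _ r] conjI ballI impI)
      fix h :: complex assume h: "h \<noteq> 0 \<and> dist h 0 < r"
      have "w + h \<in> U" using h r by (intro subsetD[OF r(2)]) (auto simp: dist_norm)
      hence "((\<integral>y. c y * exp ((w + h) * of_real y) \<partial>lborel) - (\<integral>y. c y * exp (w * of_real y) \<partial>lborel)) / h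
           = (\<integral>y. (c y * exp ((w + h) * of_real y) - c y * exp (w * of_real y)) / h \<partial>lborel)"
        using int w by (simp add: Bochner_Integration.integral_diff)
      also have "\<dots> = (\<integral>y. q h y \<partial>lborel)"
        by (intro Bochner_Integration.integral_cong) (auto simp: q_def exp_add algebra_simps diff_divide_distrib)
      finally show "(\<integral>y. q h y \<partial>lborel) =
       ((\<integral>y. c y * exp ((w + h) * of_real y) \<partial>lborel) - (\<integral>y. c y * exp (w * of_real y) \<partial>lborel)) / h" ..
    qed (use r in auto)
    ultimately have "((\<lambda>h. ((\<integral>y. c y * exp ((w + h) * of_real y) \<partial>lborel)
        - (\<integral>y. c y * exp (w * of_real y) \<partial>lborel)) / h)
        \<longlongrightarrow> (\<integral>y. c y * exp (w * of_real y) * of_real y \<partial>lborel)) (at 0)"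
      by (rule Lim_transform_eventually)
    thus ?thesis unfolding DERIV_def by (rule exI)
  qed
  thus ?thesis using U by (auto simp: holomorphic_on_open)
qed

text \<open>This is the characteristic function of the standard normal law, rescaled. The normalized
  density is kept because it serves as approximate identity in the inversion formula.\<close>

lemma gaussian_fourier_integral:
  assumes "a > 0"
  shows "integrable lborel (\<lambda>u. complex_of_real (std_normal_density (a * u)) * exp (\<i> * of_real (u * t)))"
    and "(\<integral>u. complex_of_real (std_normal_density (a * u)) * exp (\<i> * of_real (u * t)) \<partial>lborel)
           = of_real (exp (- (t / a)\<^sup>2 / 2) / a)"
proof -
  define f where "f = (\<lambda>v. complex_of_real (std_normal_density v) * exp (\<i> * of_real (v * (t / a))))"
  have f: "integrable lborel f"
    by (rule Bochner_Integration.integrable_bound[OF integrable_normal_density[of 1 0]])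
       (auto simp: f_def norm_mult)
  have "complex_of_real (exp (- (t / a)\<^sup>2 / 2)) = char std_normal_distribution (t / a)"
    by (simp add: char_std_normal_distribution)
  also have "\<dots> = (\<integral>v. f v \<partial>lborel)"
    unfolding char_def f_def
    by (subst integral_density) (auto simp: scaleR_conv_of_real mult_ac normal_density_nonneg)
  finally have I: "(\<integral>v. f v \<partial>lborel) = of_real (exp (- (t / a)\<^sup>2 / 2))" ..
  have eq: "f (0 + a * u) = complex_of_real (std_normal_density (a * u)) * exp (\<i> * of_real (u * t))" for u
    using assms by (simp add: f_def)
  show "integrable lborel (\<lambda>u. complex_of_real (std_normal_density (a * u)) * exp (\<i> * of_real (u * t)))"
    using lborel_integrable_real_affine[OF f, of a 0] assms unfolding eq by simp
  show "(\<integral>u. complex_of_real (std_normal_density (a * u)) * exp (\<i> * of_real (u * t)) \<partial>lborel)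
           = of_real (exp (- (t / a)\<^sup>2 / 2) / a)"
    using lborel_integral_real_affine[of a f 0] assms unfolding eq I
    by (simp add: scaleR_conv_of_real field_simps)
qed

text \<open>Gaussian regularization: with the damping \<open>N (a u)\<close> the double integral
  converges absolutely, Fubini turns it into an average of \<open>g\<close> around \<open>x\<close>
  at scale \<open>a\<close>, and \<open>a\<close> tends to 0. Boundedness and continuity of
  \<open>g\<close> give the limit on one side, integrability of \<open>gh\<close> on the
  other.\<close>

lemma fourier_inversion:
  fixes g :: "real \<Rightarrow> complex"
  assumes cont: "continuous_on UNIV g" and bound: "\<And>y. norm (g y) \<le> B"
    and int: "integrable lborel g"
  defines "gh \<equiv> (\<lambda>u. \<integral>y. g y * exp (\<i> * of_real (u * y)) \<partial>lborel)"
  assumes inth: "integrable lborel gh"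
  shows "(\<integral>u. gh u * exp (- (\<i> * of_real (u * x))) \<partial>lborel) = 2 * of_real pi * g x"
proof -
  have [measurable]: "g \<in> borel_measurable borel" using cont by (rule borel_measurable_continuous_onI)
  have [measurable]: "gh \<in> borel_measurable borel" using inth by simp
  define N where "N = (\<lambda>v. complex_of_real (std_normal_density v))"
  have [measurable]: "N \<in> borel_measurable borel" by (simp add: N_def)
  have N_bound: "norm (N v) \<le> 1 / sqrt (2 * pi)" for v
  proof -
    have "norm (N v) = std_normal_density v" by (simp add: N_def normal_density_nonneg)
    also have "\<dots> \<le> 1 / sqrt (2 * pi) * 1"
      unfolding std_normal_density_def by (intro mult_left_mono) auto
    finally show ?thesis by simp
  qed
  have N0: "N 0 = of_real (1 / sqrt (2 * pi))" by (simp add: N_def std_normal_density_def)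
  have intN: "integrable lborel N"
    unfolding N_def by (intro integrable_of_real integrable_normal_density) simp
  have intN1: "(\<integral>v. N v \<partial>lborel) = 1"
    using gaussian_fourier_integral(2)[of 1 0] by (simp add: N_def)
  have eq: "(\<integral>u. gh u * exp (- (\<i> * of_real (u * x))) * N (a * u) \<partial>lborel)
          = of_real (sqrt (2 * pi)) * (\<integral>v. g (x + a * v) * N v \<partial>lborel)" if a: "a > 0" for a
  proof -
    have Na: "integrable lborel (\<lambda>u. N (a * u))"
      using lborel_integrable_real_affine[OF intN, of a 0] a by simp
    have pint: "integrable (lborel \<Otimes>\<^sub>M lborel)
        (\<lambda>(y,u). g y * exp (\<i> * of_real (u * (y - x))) * N (a * u))"
    proof (rule lborel_pair.Fubini_integrable)
      have "(\<lambda>y. \<integral>u. norm (case (y, u) of (y, u) \<Rightarrow> g y * exp (\<i> * of_real (u * (y - x))) * N (a * u)) \<partial>lborel)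
          = (\<lambda>y. norm (g y) * (\<integral>u. norm (N (a * u)) \<partial>lborel))"
        by (simp add: norm_mult)
      thus "integrable lborel (\<lambda>y. \<integral>u. norm (case (y, u) of (y, u) \<Rightarrow>
               g y * exp (\<i> * of_real (u * (y - x))) * N (a * u)) \<partial>lborel)"
        using integrable_norm[OF int] by simp
      show "AE y in lborel. integrable lborel (\<lambda>u. case (y, u) of (y, u) \<Rightarrow>
               g y * exp (\<i> * of_real (u * (y - x))) * N (a * u))"
      proof (rule AE_I2)
        fix y
        show "integrable lborel (\<lambda>u. case (y, u) of (y, u) \<Rightarrow>
               g y * exp (\<i> * of_real (u * (y - x))) * N (a * u))"
          by (rule Bochner_Integration.integrable_bound[OF integrable_mult_right[OF Na, of "g y"]])
             (auto simp: norm_mult)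
      qed
    qed auto
    have "(\<integral>u. gh u * exp (- (\<i> * of_real (u * x))) * N (a * u) \<partial>lborel)
        = (\<integral>u. (\<integral>y. g y * exp (\<i> * of_real (u * (y - x))) * N (a * u) \<partial>lborel) \<partial>lborel)"
    proof (rule Bochner_Integration.integral_cong)
      fix u
      have "gh u * exp (- (\<i> * of_real (u * x))) * N (a * u)
          = (\<integral>y. g y * exp (\<i> * of_real (u * y)) * (exp (- (\<i> * of_real (u * x))) * N (a * u)) \<partial>lborel)"
        unfolding gh_def by simp
      also have "\<dots> = (\<integral>y. g y * exp (\<i> * of_real (u * (y - x))) * N (a * u) \<partial>lborel)"
        by (intro Bochner_Integration.integral_cong)
           (auto simp: algebra_simps exp_diff exp_minus field_simps)
      finally show "gh u * exp (- (\<i> * of_real (u * x))) * N (a * u)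
          = (\<integral>y. g y * exp (\<i> * of_real (u * (y - x))) * N (a * u) \<partial>lborel)" .
    qed auto
    also have "\<dots> = (\<integral>y. (\<integral>u. g y * exp (\<i> * of_real (u * (y - x))) * N (a * u) \<partial>lborel) \<partial>lborel)"
      using lborel_pair.Fubini_integral[OF pint] .
    also have "\<dots> = (\<integral>y. g y * of_real (exp (- ((y - x) / a)\<^sup>2 / 2) / a) \<partial>lborel)"
    proof (rule Bochner_Integration.integral_cong)
      fix y
      have "(\<integral>u. g y * exp (\<i> * of_real (u * (y - x))) * N (a * u) \<partial>lborel)
          = (\<integral>u. g y * (N (a * u) * exp (\<i> * of_real (u * (y - x)))) \<partial>lborel)"
        by (simp add: mult_ac)
      also have "\<dots> = g y * (\<integral>u. N (a * u) * exp (\<i> * of_real (u * (y - x))) \<partial>lborel)"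
        by (rule integral_mult_right_zero)
      also have "(\<integral>u. N (a * u) * exp (\<i> * of_real (u * (y - x))) \<partial>lborel)
                   = of_real (exp (- ((y - x) / a)\<^sup>2 / 2) / a)"
        using gaussian_fourier_integral(2)[OF a, of "y - x"] unfolding N_def .
      finally show "(\<integral>u. g y * exp (\<i> * of_real (u * (y - x))) * N (a * u) \<partial>lborel)
         = g y * of_real (exp (- ((y - x) / a)\<^sup>2 / 2) / a)" .
    qed auto
    \<comment> \<open>The substitution \<open>y = x + a v\<close> changes the narrowing Gaussian
      into the fixed weight \<open>N\<close>, so that the limit in \<open>a\<close> concerns
      \<open>g\<close> alone.\<close>
    also have "\<dots> = of_real a * (\<integral>v. g (x + a * v) * of_real (exp (- ((x + a * v - x) / a)\<^sup>2 / 2) / a) \<partial>lborel)"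
      using a by (subst lborel_integral_real_affine[where c = a and t = x])
                 (auto simp: scaleR_conv_of_real)
    also have "\<dots> = (\<integral>v. of_real (sqrt (2 * pi)) * (g (x + a * v) * N v) \<partial>lborel)"
      using a by (subst integral_mult_right_zero [symmetric], intro Bochner_Integration.integral_cong)
                 (auto simp: N_def std_normal_density_def field_simps)
    finally show ?thesis by simp
  qed
  define a where "a = (\<lambda>n. 1 / real (Suc n))"
  have a: "a n > 0" "a \<longlonglongrightarrow> 0" for n
    unfolding a_def using LIMSEQ_inverse_real_of_nat by (auto simp: inverse_eq_divide)
  have "(\<lambda>n. \<integral>u. gh u * exp (- (\<i> * of_real (u * x))) * N (a n * u) \<partial>lborel)
          \<longlonglongrightarrow> (\<integral>u. gh u * exp (- (\<i> * of_real (u * x))) * N 0 \<partial>lborel)"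
  proof (rule integral_dominated_convergence)
    show "integrable lborel (\<lambda>u. norm (gh u) * (1 / sqrt (2 * pi)))"
      using integrable_norm[OF inth] by simp
    show "AE u in lborel. (\<lambda>n. gh u * exp (- (\<i> * of_real (u * x))) * N (a n * u))
             \<longlonglongrightarrow> gh u * exp (- (\<i> * of_real (u * x))) * N 0"
    proof (rule AE_I2)
      fix u
      have "(\<lambda>n. N (a n * u)) \<longlonglongrightarrow> N (0 * u)"
        unfolding N_def std_normal_density_def by (intro tendsto_intros a) auto
      thus "(\<lambda>n. gh u * exp (- (\<i> * of_real (u * x))) * N (a n * u))
             \<longlonglongrightarrow> gh u * exp (- (\<i> * of_real (u * x))) * N 0" by (intro tendsto_intros) simp
    qed
    show "AE u in lborel. norm (gh u * exp (- (\<i> * of_real (u * x))) * N (a n * u))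
             \<le> norm (gh u) * (1 / sqrt (2 * pi))" for n
    proof (rule AE_I2)
      fix u
      have "norm (gh u * exp (- (\<i> * of_real (u * x))) * N (a n * u)) = norm (gh u) * norm (N (a n * u))"
        by (simp add: norm_mult)
      also have "\<dots> \<le> norm (gh u) * (1 / sqrt (2 * pi))"
        by (intro mult_left_mono N_bound norm_ge_zero)
      finally show "norm (gh u * exp (- (\<i> * of_real (u * x))) * N (a n * u))
             \<le> norm (gh u) * (1 / sqrt (2 * pi))" .
    qed
  qed auto
  moreover have "(\<lambda>n. \<integral>u. gh u * exp (- (\<i> * of_real (u * x))) * N (a n * u) \<partial>lborel)
          \<longlonglongrightarrow> of_real (sqrt (2 * pi)) * g x"
  proof -
    have "(\<lambda>n. \<integral>v. g (x + a n * v) * N v \<partial>lborel) \<longlonglongrightarrow> (\<integral>v. g x * N v \<partial>lborel)"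
    proof (rule integral_dominated_convergence)
      show "integrable lborel (\<lambda>v. B * norm (N v))" using integrable_norm[OF intN] by simp
      show "AE v in lborel. (\<lambda>n. g (x + a n * v) * N v) \<longlonglongrightarrow> g x * N v"
      proof (rule AE_I2)
        fix v
        have "(\<lambda>n. x + a n * v) \<longlonglongrightarrow> x + 0 * v" by (intro tendsto_intros a)
        hence "(\<lambda>n. g (x + a n * v)) \<longlonglongrightarrow> g x"
          using cont by (intro isCont_tendsto_compose[of x g]) (auto simp: continuous_on_eq_continuous_at)
        thus "(\<lambda>n. g (x + a n * v) * N v) \<longlonglongrightarrow> g x * N v" by (intro tendsto_intros)
      qed
      show "AE v in lborel. norm (g (x + a n * v) * N v) \<le> B * norm (N v)" for n
        using bound by (auto simp: norm_mult intro!: mult_right_mono)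
    qed auto
    hence "(\<lambda>n. \<integral>v. g (x + a n * v) * N v \<partial>lborel) \<longlonglongrightarrow> g x"
      using intN1 by simp
    thus ?thesis unfolding eq[OF a(1)] by (intro tendsto_intros)
  qed
  ultimately have "(\<integral>u. gh u * exp (- (\<i> * of_real (u * x))) * N 0 \<partial>lborel) = of_real (sqrt (2 * pi)) * g x"
    by (rule LIMSEQ_unique)
  hence "(\<integral>u. gh u * exp (- (\<i> * of_real (u * x))) \<partial>lborel) * N 0 = of_real (sqrt (2 * pi)) * g x"
    by simp
  \<comment> \<open>Both sides carry a root: \<open>N 0 = 1 / sqrt (2 pi)\<close> on the left and
    \<open>sqrt (2 pi)\<close> on the right; together they give \<open>2 pi\<close>.\<close>
  moreover have "A = 2 * of_real pi * b" if "A * N 0 = of_real (sqrt (2 * pi)) * b" for A b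
  proof -
    define r where "r = sqrt (2 * pi)"
    have r: "r \<noteq> 0" "r * r = 2 * pi" by (simp_all add: r_def)
    have "A = of_real r * (A * N 0)" using r(1) by (simp add: N0 flip: r_def)
    also have "\<dots> = of_real (r * r) * b" unfolding that r_def [symmetric] by simp
    finally show ?thesis by (simp add: r)
  qed
  ultimately show ?thesis by blast
qed

section \<open>The Gamma function on vertical lines\<close>

text \<open>As a difference \<open>ln (a^2 + u^2) - 2 ln a\<close> the function has second
  derivative \<open>2 u^2 / (a^2 + u^2)^2\<close> plus
  \<open>2 / a^2 - 2 a^2 / (a^2 + u^2)^2\<close>, and both parts are nonnegative.\<close>

lemma convex_on_ln_one_plus_inverse_square:
  "convex_on {0<..} (\<lambda>a::real. ln (1 + u\<^sup>2 / a\<^sup>2))"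
proof -
  have "convex_on {0<..} (\<lambda>a::real. ln (a\<^sup>2 + u\<^sup>2) - 2 * ln a)"
  proof (rule f''_ge0_imp_convex[where f' = "\<lambda>a. 2 * a / (a\<^sup>2 + u\<^sup>2) - 2 / a"
        and f'' = "\<lambda>a. 2 * (u\<^sup>2 - a\<^sup>2) / (a\<^sup>2 + u\<^sup>2)\<^sup>2 + 2 / a\<^sup>2"])
    fix a :: real assume "a \<in> {0<..}"
    hence a: "a > 0" "a\<^sup>2 + u\<^sup>2 > 0" by (auto intro: add_pos_nonneg)
    show "((\<lambda>a. ln (a\<^sup>2 + u\<^sup>2) - 2 * ln a) has_real_derivative 2 * a / (a\<^sup>2 + u\<^sup>2) - 2 / a) (at a)"
      using a by (auto intro!: derivative_eq_intros)
    show "((\<lambda>a. 2 * a / (a\<^sup>2 + u\<^sup>2) - 2 / a) has_real_derivative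
             2 * (u\<^sup>2 - a\<^sup>2) / (a\<^sup>2 + u\<^sup>2)\<^sup>2 + 2 / a\<^sup>2) (at a)"
      using a by (auto intro!: derivative_eq_intros simp: power2_eq_square field_simps)
    have "2 * a\<^sup>2 / (a\<^sup>2 + u\<^sup>2)\<^sup>2 \<le> 2 * a\<^sup>2 / (a\<^sup>2)\<^sup>2"
      using a by (intro divide_left_mono power_mono mult_pos_pos zero_less_power) auto
    also have "\<dots> = 2 / a\<^sup>2" using a by (simp add: power2_eq_square)
    finally have "2 * a\<^sup>2 / (a\<^sup>2 + u\<^sup>2)\<^sup>2 \<le> 2 / a\<^sup>2" .
    moreover have "2 * u\<^sup>2 / (a\<^sup>2 + u\<^sup>2)\<^sup>2 \<ge> 0" by simp
    moreover have "2 * (u\<^sup>2 - a\<^sup>2) / (a\<^sup>2 + u\<^sup>2)\<^sup>2 = 2 * u\<^sup>2 / (a\<^sup>2 + u\<^sup>2)\<^sup>2 - 2 * a\<^sup>2 / (a\<^sup>2 + u\<^sup>2)\<^sup>2"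
      by (simp add: diff_divide_distrib right_diff_distrib)
    ultimately show "2 * (u\<^sup>2 - a\<^sup>2) / (a\<^sup>2 + u\<^sup>2)\<^sup>2 + 2 / a\<^sup>2 \<ge> 0"
      by linarith
  qed auto
  moreover have "ln (1 + u\<^sup>2 / a\<^sup>2) = ln (a\<^sup>2 + u\<^sup>2) - 2 * ln a" if "a > 0" for a :: real
  proof -
    have "a\<^sup>2 + u\<^sup>2 > 0" using that by (auto intro: add_pos_nonneg)
    hence "ln (a\<^sup>2 + u\<^sup>2) - ln (a\<^sup>2) = ln ((a\<^sup>2 + u\<^sup>2) / a\<^sup>2)" using that by (simp add: ln_div)
    also have "(a\<^sup>2 + u\<^sup>2) / a\<^sup>2 = 1 + u\<^sup>2 / a\<^sup>2" using that by (simp add: field_simps)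
    finally show ?thesis using that by (simp add: ln_realpow)
  qed
  moreover have "0 < (1 - t) * a + t * b" if "0 < t" "t < 1" "0 < a" "0 < b" for t a b :: real
    using that by (intro add_pos_pos) auto
  ultimately show ?thesis
    by (intro convex_onI) (auto simp: convex_on_def)
qed

text \<open>The factorial and the power of \<open>n\<close> in the Euler product have the same
  modulus at \<open>x + i u\<close> as at \<open>x\<close>, so only the Pochhammer factors survive
  in the quotient. Its logarithm is then a sum of convex functions of \<open>x\<close> with a minus
  sign.\<close>

lemma norm_Gamma_series:
  assumes "x > 0"
  shows "norm (Gamma_series (Complex x u) n) / Gamma_series x n
           = exp (- (\<Sum>j\<le>n. ln (1 + u\<^sup>2 / (x + real j)\<^sup>2)) / 2)"
proof -
  have *: "norm (Complex x u + of_nat j) = (x + real j) * exp (ln (1 + u\<^sup>2 / (x + real j)\<^sup>2) / 2)" for j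
  proof -
    have p: "x + real j > 0" using assms by simp
    have "exp (ln (1 + u\<^sup>2 / (x + real j)\<^sup>2) / 2) = sqrt (1 + u\<^sup>2 / (x + real j)\<^sup>2)"
      by (subst ln_sqrt [symmetric]) (auto intro: add_pos_nonneg)
    also have "(x + real j) * \<dots> = sqrt ((x + real j)\<^sup>2 * (1 + u\<^sup>2 / (x + real j)\<^sup>2))"
      using p by (simp add: real_sqrt_mult)
    also have "(x + real j)\<^sup>2 * (1 + u\<^sup>2 / (x + real j)\<^sup>2) = (x + real j)\<^sup>2 + u\<^sup>2"
      using p by (simp add: field_simps)
    finally show ?thesis by (simp add: cmod_def)
  qed
  have "norm (pochhammer (Complex x u) (n+1)) = (\<Prod>j\<le>n. norm (Complex x u + of_nat j))"
    by (simp add: pochhammer_Suc_prod prod_norm atLeast0AtMost del: pochhammer_Suc)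
  also have "\<dots> = (\<Prod>j\<le>n. x + real j) * exp (\<Sum>j\<le>n. ln (1 + u\<^sup>2 / (x + real j)\<^sup>2) / 2)"
    by (simp add: * prod.distrib exp_sum)
  also have "(\<Prod>j\<le>n. x + real j) = pochhammer x (n+1)"
    by (simp add: pochhammer_Suc_prod atLeast0AtMost del: pochhammer_Suc)
  finally have "norm (pochhammer (Complex x u) (n+1))
      = pochhammer x (n+1) * exp ((\<Sum>j\<le>n. ln (1 + u\<^sup>2 / (x + real j)\<^sup>2)) / 2)"
    by (simp add: sum_divide_distrib)
  moreover have "pochhammer x (n+1) > 0" using assms by (rule pochhammer_pos)
  ultimately show ?thesis
    unfolding Gamma_series_def norm_divide norm_mult norm_exp_eq_Re
    by (simp add: exp_minus field_simps del: pochhammer_Suc)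
qed

text \<open>The functions \<open>a \<mapsto> ln (1 + u\<^sup>2 / (a + j)\<^sup>2)\<close> are convex, so \<open>x \<mapsto> ln (norm (Gamma (x + iu)) / Gamma x)\<close> is
  concave and for \<open>x \<ge> 1\<close> lies below its chord through \<open>1/2\<close> and \<open>1\<close>, where its values are elementary.\<close>

lemma norm_Gamma_extrapolation:
  assumes x: "x \<ge> 1"
  shows "norm (Gamma (Complex x u)) / Gamma x * (norm (Gamma (Complex (1/2) u)) / Gamma (1/2)) powr (2 * x - 2)
           \<le> norm (Gamma (Complex 1 u)) powr (2 * x - 1)"
proof -
  define q where "q = (\<lambda>n x. norm (Gamma_series (Complex x u) n) / Gamma_series x n)"
  define S where "S = (\<lambda>n x. \<Sum>j\<le>n. ln (1 + u\<^sup>2 / (x + real j)\<^sup>2))"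
  have q: "q n x = exp (- S n x / 2)" if "x > 0" for n x
    unfolding q_def S_def by (rule norm_Gamma_series) fact
  have le: "q n x * q n (1/2) powr (2 * x - 2) \<le> q n 1 powr (2 * x - 1)" for n
  proof -
    have "(2 * x - 1) * ln (1 + u\<^sup>2 / (1 + real j)\<^sup>2)
        \<le> (2 * x - 2) * ln (1 + u\<^sup>2 / (1/2 + real j)\<^sup>2) + ln (1 + u\<^sup>2 / (x + real j)\<^sup>2)" for j
    proof -
      \<comment> \<open>The weight for which 1 is the convex combination of \<open>1 / 2\<close> and
        \<open>x\<close>, namely \<open>(1 - t) / 2 + t x = 1\<close>. Multiplying the convexity
        inequality by \<open>2 x - 1\<close> clears the denominator.\<close>
      define t where "t = 1 / (2 * x - 1)"
      have t: "t \<ge> 0" "t \<le> 1" "t * (2 * x - 1) = 1" using x by (auto simp: t_def field_simps)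
      have e: "(1 - t) * (1/2 + real j) + t * (x + real j) = 1 + real j"
      proof -
        have "(1 - t) * (1/2 + real j) + t * (x + real j) = 1/2 + real j + t * (2 * x - 1) / 2"
          by (simp add: field_simps)
        thus ?thesis using t(3) by simp
      qed
      have "ln (1 + u\<^sup>2 / ((1 - t) *\<^sub>R (1/2 + real j) + t *\<^sub>R (x + real j))\<^sup>2)
          \<le> (1 - t) * ln (1 + u\<^sup>2 / (1/2 + real j)\<^sup>2) + t * ln (1 + u\<^sup>2 / (x + real j)\<^sup>2)"
        using x t by (intro convex_onD[OF convex_on_ln_one_plus_inverse_square]) auto
      hence "(2 * x - 1) * ln (1 + u\<^sup>2 / (1 + real j)\<^sup>2) \<le> (2 * x - 1) *
         ((1 - t) * ln (1 + u\<^sup>2 / (1/2 + real j)\<^sup>2) + t * ln (1 + u\<^sup>2 / (x + real j)\<^sup>2))"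
        using x by (intro mult_left_mono) (simp_all add: e)
      also have "\<dots> = ((2 * x - 1) - t * (2 * x - 1)) * ln (1 + u\<^sup>2 / (1/2 + real j)\<^sup>2)
                        + (t * (2 * x - 1)) * ln (1 + u\<^sup>2 / (x + real j)\<^sup>2)"
        by (simp add: algebra_simps)
      finally show ?thesis unfolding t(3) by simp
    qed
    hence "(\<Sum>j\<le>n. (2 * x - 1) * ln (1 + u\<^sup>2 / (1 + real j)\<^sup>2))
        \<le> (\<Sum>j\<le>n. (2 * x - 2) * ln (1 + u\<^sup>2 / (1/2 + real j)\<^sup>2) + ln (1 + u\<^sup>2 / (x + real j)\<^sup>2))"
      by (intro sum_mono)
    hence "(2 * x - 1) * S n 1 \<le> (2 * x - 2) * S n (1/2) + S n x"
      unfolding S_def by (simp add: sum.distrib sum_distrib_left)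
    thus ?thesis
      using x by (simp add: q powr_def field_simps flip: exp_add)
  qed
  have lim: "(\<lambda>n. q n x) \<longlonglongrightarrow> norm (Gamma (Complex x u)) / Gamma x" if "x > 0" for x
    unfolding q_def using Gamma_real_pos[OF that] by (intro tendsto_intros) auto
  \<comment> \<open>A nonzero limit of the base is required for \<open>powr\<close> to pass to the
    limit.\<close>
  have pos: "norm (Gamma (Complex x u)) / Gamma x > 0" if "x > 0" for x
    using that Gamma_real_pos[of x] Gamma_eq_zero_iff[of "Complex x u"]
    by (auto simp: nonpos_Ints_def complex_eq_iff)
  have "norm (Gamma (Complex x u)) / Gamma x * (norm (Gamma (Complex (1/2) u)) / Gamma (1/2)) powr (2 * x - 2)
           \<le> (norm (Gamma (Complex 1 u)) / Gamma 1) powr (2 * x - 1)"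
  proof (rule LIMSEQ_le)
    show "(\<lambda>n. q n x * q n (1/2) powr (2 * x - 2)) \<longlonglongrightarrow>
      norm (Gamma (Complex x u)) / Gamma x * (norm (Gamma (Complex (1/2) u)) / Gamma (1/2)) powr (2 * x - 2)"
      using x pos[of "1/2"] by (intro tendsto_mult lim tendsto_powr tendsto_const) auto
    show "(\<lambda>n. q n 1 powr (2 * x - 1)) \<longlonglongrightarrow> (norm (Gamma (Complex 1 u)) / Gamma 1) powr (2 * x - 1)"
      using pos[of 1] by (intro lim tendsto_powr tendsto_const) auto
  qed (use le in auto)
  thus ?thesis by simp
qed

lemma cosh_complex_of_real: "cosh (complex_of_real x) = of_real (cosh x)"
  and sinh_complex_of_real: "sinh (complex_of_real x) = of_real (sinh x)"
  by (simp_all add: cosh_field_def sinh_field_def flip: exp_of_real)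

text \<open>On this line conjugation is \<open>z \<mapsto> 1 - z\<close>, so the squared modulus is
  the left side of the reflection formula.\<close>

lemma norm_Gamma_half: "(norm (Gamma (Complex (1/2) u)))\<^sup>2 = pi / cosh (pi * u)"
proof -
  define z where "z = Complex (1/2) u"
  have "cnj z = 1 - z" by (simp add: z_def complex_eq_iff)
  hence "(norm (Gamma z))\<^sup>2 = norm (Gamma z * Gamma (1 - z))"
    by (metis cnj_Gamma complex_mod_cnj norm_mult power2_eq_square)
  also have "\<dots> = pi / norm (sin (of_real pi * z))"
    by (simp add: Gamma_reflection_complex norm_divide)
  also have "of_real pi * z = of_real (pi / 2) + \<i> * of_real (pi * u)"
    by (simp add: z_def complex_eq_iff)
  also have "sin \<dots> = cosh (of_real (pi * u))"
    by (simp add: sin_add cosh_conv_cos flip: of_real_mult sin_of_real cos_of_real)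
  also have "norm \<dots> = cosh (pi * u)"
    by (simp add: cosh_complex_of_real cosh_real_pos less_imp_le del: of_real_mult)
  finally show ?thesis by (simp add: z_def)
qed

text \<open>On the imaginary axis conjugation is negation, so reflection gives the modulus at
  \<open>i u\<close>; the recurrence then moves it to \<open>1 + i u\<close>.\<close>

lemma norm_Gamma_one:
  assumes "u > 0"
  shows "(norm (Gamma (Complex 1 u)))\<^sup>2 = pi * u / sinh (pi * u)"
proof -
  define z where "z = \<i> * complex_of_real u"
  have z0: "z \<noteq> 0" using assms by (simp add: z_def)
  have z1: "Complex 1 u = z + 1" by (simp add: z_def complex_eq_iff)
  have "cnj z = - z" by (simp add: z_def)
  hence "(norm (Gamma z))\<^sup>2 = norm (Gamma z * Gamma (- z))"
    by (metis cnj_Gamma complex_mod_cnj norm_mult power2_eq_square)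
  also have "\<dots> = pi / (u * norm (sin (of_real pi * z)))"
    using assms by (simp add: Gamma_reflection_complex' norm_divide norm_mult z_def)
  also have "sin (of_real pi * z) = \<i> * sinh (of_real (pi * u))"
    by (simp add: z_def sinh_conv_sin mult_ac)
  also have "norm (\<i> * sinh (complex_of_real (pi * u))) = sinh (pi * u)"
    using assms by (simp add: sinh_complex_of_real norm_mult del: of_real_mult)
  finally have "(norm (Gamma z))\<^sup>2 = pi / (u * sinh (pi * u))" .
  moreover have "Gamma (z + 1) = z * Gamma z"
    by (rule Gamma_plus1) (auto simp: z_def nonpos_Ints_def complex_eq_iff less_imp_neq[OF assms, symmetric])
  ultimately have "(norm (Gamma (Complex 1 u)))\<^sup>2 = (norm z)\<^sup>2 * (pi / (u * sinh (pi * u)))"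
    unfolding z1 by (simp only: norm_mult power_mult_distrib)
  thus ?thesis using assms by (simp add: z_def norm_mult power2_eq_square)
qed

text \<open>The upper half of Stirling's formula. With \<open>A\<close>, \<open>B\<close> the moduli
  at abscissas \<open>1 / 2\<close> and 1, extrapolation divides
  \<open>B^2 <= 4 pi u exp (- pi u)\<close>, raised to \<open>x - 1 / 2\<close>, by
  \<open>A^2 >= pi exp (- pi u)\<close>, raised to \<open>x - 1\<close>. The exponentials leave
  \<open>exp (- pi u / 2)\<close>.\<close>

lemma norm_Gamma_vertical_bound:
  assumes x: "x \<ge> 1"
  obtains C where "C > 0"
    "\<And>u. \<bar>u\<bar> \<ge> 1 \<Longrightarrow> norm (Gamma (Complex x u)) \<le> C * \<bar>u\<bar> powr (x - 1/2) * exp (- (pi * \<bar>u\<bar> / 2))"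
proof
  define C where "C = Gamma x * Gamma (1/2) powr (2 * x - 2) * (4 * pi) powr (x - 1/2) / pi powr (x - 1)"
  show "C > 0" using x Gamma_real_pos[of x] by (simp add: C_def Gamma_one_half_real)
  have pos: "norm (Gamma (Complex x u)) \<le> C * u powr (x - 1/2) * exp (- (pi * u / 2))" if u: "u \<ge> 1" for u
  proof -
    define A where "A = norm (Gamma (Complex (1/2) u))"
    define B where "B = norm (Gamma (Complex 1 u))"
    have [simp]: "A \<ge> 0" "B \<ge> 0" by (auto simp: A_def B_def)
    have pu: "0 \<le> pi * u" using u by (intro mult_nonneg_nonneg) auto
    have "cosh (pi * u) \<le> exp (pi * u)"
      using u by (simp add: cosh_field_def)
    hence "pi / exp (pi * u) \<le> A\<^sup>2"
      unfolding A_def norm_Gamma_half by (intro divide_left_mono) (auto simp: cosh_real_pos)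
    hence A: "pi * exp (- (pi * u)) \<le> A\<^sup>2" by (simp add: exp_minus field_simps)
    \<comment> \<open>Since \<open>u >= 1\<close>, the exponential is at least 4, so its inverse is
      at most a quarter of it and \<open>sinh\<close> is at least a quarter of it too.\<close>
    have "exp (pi * u) \<ge> 1 + pi * u" by (rule exp_ge_add_one_self)
    moreover have "pi * u \<ge> 3 * 1" using u pi_gt3 by (intro mult_mono) auto
    ultimately have "exp (pi * u) \<ge> 4" by linarith
    hence "exp (pi * u) * exp (pi * u) \<ge> 4 * 1" using pu by (intro mult_mono) auto
    hence "exp (- (pi * u)) \<le> exp (pi * u) / 4" by (simp add: exp_minus field_simps)
    moreover have "E / 4 \<le> (E - e) / 2" if "e \<le> E / 4" "0 < e" for e E :: real using that by simp
    ultimately have "sinh (pi * u) \<ge> exp (pi * u) / 4"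
      unfolding sinh_field_def using exp_gt_zero by blast
    hence "pi * u / sinh (pi * u) \<le> pi * u / (exp (pi * u) / 4)"
      using u pu \<open>exp (pi * u) \<ge> 4\<close> by (intro divide_left_mono mult_pos_pos) auto
    moreover have "B\<^sup>2 = pi * u / sinh (pi * u)"
      unfolding B_def using u by (intro norm_Gamma_one) auto
    ultimately have "B\<^sup>2 \<le> pi * u / (exp (pi * u) / 4)" by simp
    hence B: "B\<^sup>2 \<le> 4 * pi * u * exp (- (pi * u))" by (simp add: exp_minus field_simps)
    have sq: "(A\<^sup>2) powr (x - 1) = A powr (2 * x - 2)" "(B\<^sup>2) powr (x - 1/2) = B powr (2 * x - 1)"
      by (simp_all add: powr_powr algebra_simps flip: powr_numeral)
    have "norm (Gamma (Complex x u)) / Gamma x * (A / Gamma (1/2)) powr (2 * x - 2) \<le> (B\<^sup>2) powr (x - 1/2)"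
      using norm_Gamma_extrapolation[OF x, of u] unfolding sq by (simp add: A_def B_def)
    also have "\<dots> \<le> (4 * pi * u * exp (- (pi * u))) powr (x - 1/2)"
      using B x by (intro powr_mono2) auto
    also have "\<dots> = (4 * pi) powr (x - 1/2) * u powr (x - 1/2) * exp (- (pi * u) * (x - 1/2))"
      using u by (simp add: powr_mult exp_powr_real)
    finally have 1: "norm (Gamma (Complex x u)) / Gamma x * (A / Gamma (1/2)) powr (2 * x - 2)
        \<le> (4 * pi) powr (x - 1/2) * u powr (x - 1/2) * exp (- (pi * u) * (x - 1/2))" .
    have "(pi * exp (- (pi * u))) powr (x - 1) \<le> A powr (2 * x - 2)"
      unfolding sq(1) [symmetric] using A x by (intro powr_mono2) auto
    hence 2: "pi powr (x - 1) * exp (- (pi * u) * (x - 1)) / Gamma (1/2) powr (2 * x - 2)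
        \<le> (A / Gamma (1/2)) powr (2 * x - 2)"
      by (simp add: powr_divide Gamma_one_half_real powr_mult divide_right_mono)
         (simp add: powr_def algebra_simps divide_right_mono)
    have g: "Gamma x > 0" "Gamma (1/2 :: real) > 0" using x by (auto intro: Gamma_real_pos)
    have "norm (Gamma (Complex x u)) / Gamma x *
            (pi powr (x - 1) * exp (- (pi * u) * (x - 1)) / Gamma (1/2) powr (2 * x - 2))
        \<le> (4 * pi) powr (x - 1/2) * u powr (x - 1/2) * exp (- (pi * u) * (x - 1/2))"
      using g by (intro order.trans[OF mult_left_mono[OF 2] 1]) auto
    moreover have "exp (- (pi * u) * (x - 1/2)) = exp (- (pi * u) * (x - 1)) * exp (- (pi * u / 2))"
      by (simp add: algebra_simps flip: exp_add)
    ultimately show ?thesis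
      using g by (simp add: C_def field_simps)
  qed
  fix u :: real assume u: "\<bar>u\<bar> \<ge> 1"
  have "norm (Gamma (Complex x u)) = norm (Gamma (Complex x \<bar>u\<bar>))"
  proof (cases "u \<ge> 0")
    case False
    hence "Complex x u = cnj (Complex x \<bar>u\<bar>)" by (simp add: complex_eq_iff)
    thus ?thesis by (simp only: complex_mod_cnj flip: cnj_Gamma)
  qed simp
  thus "norm (Gamma (Complex x u)) \<le> C * \<bar>u\<bar> powr (x - 1/2) * exp (- (pi * \<bar>u\<bar> / 2))"
    using pos[OF u] by simp
qed

section \<open>The theta function near 0\<close>

text \<open>The mean value inequality compares \<open>f t\<close> with every
  \<open>f \<tau>\<close>; averaging over \<tau> keeps the constant \<open>M\<close> because the
  interval has length 1.\<close>

lemma norm_minus_unit_mean_le: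
  fixes f :: "real \<Rightarrow> complex"
  assumes "\<And>t. t \<in> {0..1} \<Longrightarrow> (f has_vector_derivative f' t) (at t within {0..1})"
    and "\<And>t. t \<in> {0..1} \<Longrightarrow> norm (f' t) \<le> M" and t: "t \<in> {0..1}"
  shows "norm (f t - integral {0..1} f) \<le> M"
proof -
  have M: "M \<ge> 0" using assms(2)[OF t] norm_ge_zero order_trans by blast
  have cont: "continuous_on {0..1} f"
    unfolding continuous_on_eq_continuous_within
    using assms(1) by (blast intro: has_vector_derivative_continuous)
  have onorm: "onorm (\<lambda>h. h *\<^sub>R f' u) \<le> M" if "u \<in> {0..1}" for u
    using assms(2)[OF that] by (intro onorm_le) (simp add: mult.commute [of M] mult_left_mono)
  have "norm (f t - f \<tau>) \<le> M" if \<tau>: "\<tau> \<in> {0..1}" for \<tau>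
  proof -
    have "norm (f t - f \<tau>) \<le> M * norm (t - \<tau>)"
      by (rule differentiable_bound[where S = "{0..1}" and f' = "\<lambda>u h. h *\<^sub>R f' u"])
         (use assms \<tau> onorm in \<open>auto simp: has_vector_derivative_def\<close>)
    also have "\<dots> \<le> M * 1" using t \<tau> M by (intro mult_left_mono) auto
    finally show ?thesis by simp
  qed
  moreover have "integral {0..1} (\<lambda>\<tau>. f t - f \<tau>) = f t - integral {0..1} f"
    using cont by (subst Henstock_Kurzweil_Integration.integral_diff)
                  (auto intro: integrable_continuous_real)
  ultimately show ?thesis
    using integral_bound[of 0 1 "\<lambda>\<tau>. f t - f \<tau>" M] continuous_on_diff[OF continuous_on_const cont, of "f t"]
    by simp
qed

text \<open>A derivative of a 1-periodic function has mean 0 over a period, so bounds pass from it to the function.\<close>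

lemma norm_periodic_minus_mean_le:
  fixes F :: "complex \<Rightarrow> complex"
  assumes holo: "F holomorphic_on UNIV" and per: "\<And>z. F (z + 1) = F z"
    and bound: "\<And>t. t \<in> {0..1} \<Longrightarrow> norm ((deriv ^^ Suc n) F (of_real t)) \<le> M"
    and t: "t \<in> {0..1}"
  shows "norm (F (of_real t) - integral {0..1} (\<lambda>t. F (of_real t))) \<le> M"
  using bound t
proof (induction n arbitrary: t)
  have deriv: "((\<lambda>t. (deriv ^^ n) F (of_real t)) has_vector_derivative (deriv ^^ Suc n) F (of_real t)) (at t within S)"
    for n t S
  proof -
    have "(deriv ^^ n) F holomorphic_on UNIV" using holo by (intro holomorphic_higher_deriv) auto
    hence "((deriv ^^ n) F has_field_derivative (deriv ^^ Suc n) F (of_real t)) (at (of_real t))"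
      by (auto intro: holomorphic_derivI)
    thus ?thesis
      by (rule has_vector_derivative_real_field[THEN has_vector_derivative_at_within])
  qed
  {
    case 0
    thus ?case
      using deriv[of 0] by (intro norm_minus_unit_mean_le[where f' = "\<lambda>t. (deriv ^^ Suc 0) F (of_real t)"]) auto
  next
    case (Suc n)
    have "(deriv ^^ n) F (0 + 1) = (deriv ^^ n) F 0"
    proof -
      have "(deriv ^^ n) (\<lambda>w. F (1 * w + 1)) 0 = 1 ^ n * (deriv ^^ n) F (1 * 0 + 1)"
        by (rule higher_deriv_compose_linear'[where S = UNIV and T = UNIV]) (use holo in auto)
      thus ?thesis by (simp add: per)
    qed
    moreover have "((\<lambda>t. (deriv ^^ Suc n) F (of_real t)) has_integral
        ((deriv ^^ n) F (of_real 1) - (deriv ^^ n) F (of_real 0))) {0..1}"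
      using deriv by (intro fundamental_theorem_of_calculus) auto
    ultimately have "integral {0..1} (\<lambda>t. (deriv ^^ Suc n) F (of_real t)) = 0"
      by (auto intro!: integral_unique)
    hence "norm ((deriv ^^ Suc n) F (of_real t)) \<le> M" if "t \<in> {0..1}" for t
      using norm_minus_unit_mean_le[where f = "\<lambda>t. (deriv ^^ Suc n) F (of_real t)"
         and f' = "\<lambda>t. (deriv ^^ Suc (Suc n)) F (of_real t)", OF deriv Suc.prems(1) that] by simp
    thus ?case using Suc.IH Suc.prems by blast
  }
qed

text \<open>The inequality \<open>v^2 >= 2 |v| - 1\<close> for \<open>v = s (Re z + n)\<close> makes
  the exponent linear in \<open>n\<close> and separates \<open>n\<close> from \<open>z\<close>, as a
  majorant for the series requires.\<close>

lemma norm_gaussian_translate_le: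
  assumes "s > 0"
  shows "norm (exp (- ((of_real s)\<^sup>2 * (z + of_int n)\<^sup>2)))
           \<le> exp (1 + (s * Im z)\<^sup>2 + 2 * s * \<bar>Re z\<bar>) * exp (- (2 * s * \<bar>real_of_int n\<bar>))"
proof -
  have "Re (- ((of_real s)\<^sup>2 * (z + of_int n)\<^sup>2)) = (s * Im z)\<^sup>2 - (s * (Re z + of_int n))\<^sup>2"
    by (simp add: power2_eq_square algebra_simps)
  also have "\<dots> \<le> (s * Im z)\<^sup>2 + (1 - 2 * \<bar>s * (Re z + of_int n)\<bar>)"
    using zero_le_power2[of "\<bar>s * (Re z + of_int n)\<bar> - 1"]
    by (simp add: power2_eq_square algebra_simps)
  also have "\<bar>s * (Re z + of_int n)\<bar> = s * \<bar>Re z + of_int n\<bar>" using assms by (simp add: abs_mult)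
  also have "(s * Im z)\<^sup>2 + (1 - 2 * (s * \<bar>Re z + of_int n\<bar>))
      \<le> (s * Im z)\<^sup>2 + (1 - 2 * (s * (\<bar>real_of_int n\<bar> - \<bar>Re z\<bar>)))"
    using assms by (intro add_left_mono diff_left_mono mult_left_mono) auto
  finally show ?thesis
    by (simp add: norm_exp_eq_Re algebra_simps flip: exp_add)
qed

text \<open>With \<open>v = s |n|\<close> and \<open>s <= 1\<close>,
  \<open>s^2 (1 + n^2) <= 1 + v^2 <= (1 + v)^2 <= exp (2 v)\<close>. The sum over \<open>n\<close>
  is thereby bounded by \<open>s^(-2)\<close> times a constant; the exponent \<open>- 2 / 2\<close>
  is the case \<sigma> = 2 of \<open>summable_on_int_powr\<close>.\<close>

lemma exp_abs_int_le:
  assumes s: "0 < s" "s \<le> 1"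
  shows "exp (- (2 * s * \<bar>real_of_int n\<bar>)) \<le> (1 + (real_of_int n)\<^sup>2) powr (- 2 / 2) / s\<^sup>2"
proof -
  define v where "v = s * \<bar>real_of_int n\<bar>"
  have v: "v \<ge> 0" using s by (simp add: v_def)
  have "s\<^sup>2 * (1 + (real_of_int n)\<^sup>2) = s\<^sup>2 + v\<^sup>2" by (simp add: v_def power_mult_distrib algebra_simps)
  also have "\<dots> \<le> 1 + v\<^sup>2" using s by (simp add: power_le_one)
  also have "\<dots> \<le> (1 + v) * (1 + v)" using v by (simp add: power2_eq_square algebra_simps)
  also have "\<dots> \<le> exp v * exp v" using v by (intro mult_mono exp_ge_add_one_self) auto
  also have "\<dots> = exp (2 * v)" by (simp flip: exp_add)
  finally have "s\<^sup>2 * (1 + (real_of_int n)\<^sup>2) \<le> exp (2 * v)" .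
  moreover have n: "0 < 1 + (real_of_int n)\<^sup>2" by (intro add_pos_nonneg) auto
  ultimately have "inverse (exp (2 * v)) \<le> inverse (s\<^sup>2 * (1 + (real_of_int n)\<^sup>2))"
    using s by (intro le_imp_inverse_le mult_pos_pos) auto
  also have "inverse (exp (2 * v)) = exp (- (2 * s * \<bar>real_of_int n\<bar>))"
    by (simp add: exp_minus v_def mult_ac)
  also have "inverse (s\<^sup>2 * (1 + (real_of_int n)\<^sup>2)) = (1 + (real_of_int n)\<^sup>2) powr (- 2 / 2) / s\<^sup>2"
    using n by (simp add: powr_minus field_simps)
  finally show ?thesis .
qed

text \<open>Jacobi's theta constant at nome \<open>exp (- x)\<close>. Without the customary
  \<open>pi\<close> in the exponent, its powers are series in \<open>exp (- n x)\<close> with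
  integer \<open>n\<close>, which have period \<open>2 pi i\<close>.\<close>

definition theta :: "real \<Rightarrow> real" where
  "theta x = (\<Sum>\<^sub>\<infinity>n\<in>(UNIV :: int set). exp (- (x * (real_of_int n)\<^sup>2)))"

lemma summable_exp_abs_int:
  assumes "s > 0"
  shows "(\<lambda>n. exp (- (2 * s * \<bar>real_of_int n\<bar>))) summable_on UNIV"
proof -
  define r where "r = min s 1"
  have r: "0 < r" "r \<le> 1" "r \<le> s" using assms by (auto simp: r_def)
  have "(\<lambda>n. (1 + (real_of_int n)\<^sup>2) powr (- 2 / 2) * (1 / r\<^sup>2)) summable_on UNIV"
    by (intro summable_on_cmult_left summable_on_int_powr) simp
  hence "(\<lambda>n. (1 + (real_of_int n)\<^sup>2) powr (- 2 / 2) / r\<^sup>2) summable_on UNIV" by simp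
  thus ?thesis
  proof (rule summable_on_comparison_test)
    fix n
    have "exp (- (2 * s * \<bar>real_of_int n\<bar>)) \<le> exp (- (2 * r * \<bar>real_of_int n\<bar>))"
      using r by (simp add: mult_right_mono)
    also have "\<dots> \<le> (1 + (real_of_int n)\<^sup>2) powr (- 2 / 2) / r\<^sup>2" using r by (intro exp_abs_int_le) auto
    finally show "exp (- (2 * s * \<bar>real_of_int n\<bar>)) \<le> (1 + (real_of_int n)\<^sup>2) powr (- 2 / 2) / r\<^sup>2" .
  qed auto
qed

lemma summable_gaussian_int:
  assumes "x > 0"
  shows "(\<lambda>n. exp (- (x * (real_of_int n)\<^sup>2))) summable_on UNIV"
proof -
  have "(\<lambda>n. exp 1 * exp (- (2 * sqrt x * \<bar>real_of_int n\<bar>))) summable_on UNIV"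
    using assms by (intro summable_on_cmult_right summable_exp_abs_int) auto
  thus ?thesis
    by (rule summable_on_comparison_test)
       (use norm_gaussian_translate_le[of "sqrt x" 0] assms in \<open>auto simp: norm_exp_eq_Re simp flip: of_real_power\<close>)
qed

lemma integral_gaussian:
  assumes "s > 0"
  shows "integrable lborel (\<lambda>u. complex_of_real (exp (- (s\<^sup>2 * u\<^sup>2))))"
    and "(\<integral>u. complex_of_real (exp (- (s\<^sup>2 * u\<^sup>2))) \<partial>lborel) = of_real (sqrt pi / s)"
proof -
  define a where "a = s * sqrt 2"
  have a: "a > 0" using assms by (simp add: a_def)
  have eq: "complex_of_real (exp (- (s\<^sup>2 * u\<^sup>2)))
      = of_real (sqrt (2 * pi)) * (complex_of_real (std_normal_density (a * u)) * exp (\<i> * of_real (u * 0)))" for u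
  proof -
    have "exp (- (s\<^sup>2 * u\<^sup>2)) = sqrt (2 * pi) * std_normal_density (a * u)"
      by (simp add: std_normal_density_def a_def power_mult_distrib)
    thus ?thesis by (simp only: of_real_mult) simp
  qed
  show "integrable lborel (\<lambda>u. complex_of_real (exp (- (s\<^sup>2 * u\<^sup>2))))"
    unfolding eq by (intro integrable_mult_right gaussian_fourier_integral a)
  have "(\<integral>u. complex_of_real (exp (- (s\<^sup>2 * u\<^sup>2))) \<partial>lborel)
      = of_real (sqrt (2 * pi)) * of_real (exp (- (0 / a)\<^sup>2 / 2) / a)"
    unfolding eq integral_mult_right_zero gaussian_fourier_integral(2)[OF a] ..
  also have "\<dots> = of_real (sqrt (2 * pi) / a)" by simp
  also have "sqrt (2 * pi) / a = sqrt pi / s" by (simp add: a_def real_sqrt_mult)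
  finally show "(\<integral>u. complex_of_real (exp (- (s\<^sup>2 * u\<^sup>2))) \<partial>lborel) = of_real (sqrt pi / s)" .
qed

text \<open>Theta is viewed as the value at 0 of an entire function \<open>F\<close> of period 1.
  Its mean over a period is the full Gaussian integral \<open>sqrt pi / s\<close>, the main term;
  the error is the deviation of \<open>F\<close> from its mean, controlled by derivatives of
  arbitrarily high order.\<close>

context
  fixes s :: real and F :: "complex \<Rightarrow> complex"
  assumes s: "s > 0"
  defines "F \<equiv> (\<lambda>z. \<Sum>\<^sub>\<infinity>n\<in>(UNIV :: int set). exp (- ((of_real s)\<^sup>2 * (z + of_int n)\<^sup>2)))"
begin

lemma gaussian_periodization_uniform_limit:
  "uniform_limit (cball 0 R) (\<lambda>X z. \<Sum>n\<in>X. exp (- ((of_real s)\<^sup>2 * (z + of_int n)\<^sup>2))) F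
     (finite_subsets_at_top UNIV)"
  unfolding F_def
proof (rule Weierstrass_m_test_general)
  show "norm (exp (- ((of_real s)\<^sup>2 * (z + of_int n)\<^sup>2)))
      \<le> exp (1 + (s * R)\<^sup>2 + 2 * s * R) * exp (- (2 * s * \<bar>real_of_int n\<bar>))"
    if z: "z \<in> cball 0 R" for n :: int and z :: complex
  proof -
    have n: "norm z \<le> R" using z by simp
    have "\<bar>Re z\<bar> \<le> R" "\<bar>Im z\<bar> \<le> R"
      using abs_Re_le_cmod[of z] abs_Im_le_cmod[of z] n by linarith+
    hence "(s * Im z)\<^sup>2 \<le> (s * R)\<^sup>2" "2 * s * \<bar>Re z\<bar> \<le> 2 * s * R"
      using s by (auto simp: power_mult_distrib intro!: mult_left_mono power2_le_iff_abs_le[THEN iffD2])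
    hence "exp (1 + (s * Im z)\<^sup>2 + 2 * s * \<bar>Re z\<bar>) \<le> exp (1 + (s * R)\<^sup>2 + 2 * s * R)" by simp
    from mult_right_mono[OF this exp_ge_zero] show ?thesis
      by (rule order.trans[OF norm_gaussian_translate_le[OF s]])
  qed
  show "(\<lambda>n. exp (1 + (s * R)\<^sup>2 + 2 * s * R) * exp (- (2 * s * \<bar>real_of_int n\<bar>))) summable_on UNIV"
    using s by (intro summable_on_cmult_right summable_exp_abs_int)
qed

lemma gaussian_periodization_holomorphic: "F holomorphic_on UNIV"
proof -
  have "F holomorphic_on ball 0 R" for R
    by (rule holomorphic_uniform_limit[OF _ gaussian_periodization_uniform_limit[of R]])
       (auto intro!: always_eventually continuous_intros holomorphic_intros)
  hence "F field_differentiable at z" for z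
    by (rule holomorphic_on_imp_differentiable_at[of _ "ball 0 (norm z + 1)"]) auto
  thus ?thesis by (auto simp: holomorphic_on_def intro: field_differentiable_at_within)
qed

lemma gaussian_periodization_periodic: "F (z + 1) = F z"
proof -
  have "bij_betw (\<lambda>n::int. n + 1) UNIV UNIV"
    by (rule bij_betwI[where g = "\<lambda>n. n - 1"]) auto
  from infsum_reindex_bij_betw[OF this, of "\<lambda>n. exp (- ((of_real s)\<^sup>2 * (z + of_int n)\<^sup>2))"]
  show ?thesis unfolding F_def by (simp add: add_ac)
qed

text \<open>The rectangle contains all circles of radius \<open>1 / s\<close> centred in
  \<open>[0, 1]\<close>. On it \<open>s |Im z| <= 1\<close> and \<open>s |Re z| <= 2\<close>, so the
  exponent in front is at most \<open>1 + 1 + 4 = 6\<close>.\<close>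

lemma norm_gaussian_periodization_le:
  assumes "s \<le> 1" "\<bar>Im z\<bar> \<le> 1 / s" "\<bar>Re z\<bar> \<le> 1 + 1 / s"
  shows "norm (F z) \<le> exp 6 * (\<Sum>\<^sub>\<infinity>n\<in>(UNIV :: int set). (1 + (real_of_int n)\<^sup>2) powr (- 2 / 2)) / s\<^sup>2"
proof -
  let ?g = "\<lambda>n::int. (1 + (real_of_int n)\<^sup>2) powr (- 2 / 2)"
  have g: "?g summable_on UNIV" by (rule summable_on_int_powr) simp
  have le: "norm (exp (- ((of_real s)\<^sup>2 * (z + of_int n)\<^sup>2))) \<le> exp 6 / s\<^sup>2 * ?g n" for n
  proof -
    have "\<bar>s * Im z\<bar> \<le> 1" using assms s by (simp add: abs_mult field_simps)
    hence "(s * Im z)\<^sup>2 \<le> 1" by (simp add: abs_square_le_1)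
    moreover have "s * \<bar>Re z\<bar> \<le> s * (1 + 1 / s)" using assms s by (intro mult_left_mono) auto
    moreover have "s * (1 + 1 / s) \<le> 2" using assms s by (simp add: field_simps)
    ultimately have "1 + (s * Im z)\<^sup>2 + 2 * s * \<bar>Re z\<bar> \<le> 6" by linarith
    hence "exp (1 + (s * Im z)\<^sup>2 + 2 * s * \<bar>Re z\<bar>) * exp (- (2 * s * \<bar>real_of_int n\<bar>))
        \<le> exp 6 * (?g n / s\<^sup>2)"
      using assms s by (intro mult_mono exp_abs_int_le) auto
    also have "exp 6 * (?g n / s\<^sup>2) = exp 6 / s\<^sup>2 * ?g n" by simp
    finally show ?thesis by (rule order.trans[OF norm_gaussian_translate_le[OF s]])
  qed
  have "norm (F z) \<le> (\<Sum>\<^sub>\<infinity>n\<in>UNIV. exp 6 / s\<^sup>2 * ?g n)"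
    unfolding F_def
  proof (rule norm_infsum_le)
    have *: "(\<lambda>n. exp 6 / s\<^sup>2 * ?g n) summable_on UNIV" using g by (rule summable_on_cmult_right)
    thus "((\<lambda>n. exp 6 / s\<^sup>2 * ?g n) has_sum (\<Sum>\<^sub>\<infinity>n. exp 6 / s\<^sup>2 * ?g n)) UNIV" by (rule has_sum_infsum)
    have "(\<lambda>n. norm (exp (- ((of_real s)\<^sup>2 * (z + of_int n)\<^sup>2)))) summable_on UNIV"
      by (rule summable_on_comparison_test[OF * le norm_ge_zero])
    thus "((\<lambda>n. exp (- ((of_real s)\<^sup>2 * (z + of_int n)\<^sup>2))) has_sum
        (\<Sum>\<^sub>\<infinity>n. exp (- ((of_real s)\<^sup>2 * (z + of_int n)\<^sup>2)))) UNIV"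
      by (rule has_sum_infsum[OF abs_summable_summable])
  qed (rule le)
  also have "\<dots> = exp 6 / s\<^sup>2 * (\<Sum>\<^sub>\<infinity>n\<in>UNIV. ?g n)" by (rule infsum_cmult_right')
  finally show ?thesis by (simp only: times_divide_eq_left)
qed

text \<open>Unfolding: integrating the translates over \<open>[0, 1]\<close> is integrating one
  Gaussian over consecutive unit intervals. With a primitive \<open>P\<close> the finite sums
  telescope.\<close>

lemma integral_gaussian_periodization:
  "integral {0..1} (\<lambda>t. F (of_real t)) = of_real (sqrt pi / s)"
proof -
  define e where "e = (\<lambda>z::complex. exp (- ((of_real s)\<^sup>2 * z\<^sup>2)))"
  have "e holomorphic_on UNIV" unfolding e_def by (intro holomorphic_intros)
  then obtain P where P: "\<And>z. (P has_field_derivative e z) (at z)"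
    using holomorphic_convex_primitive'[of UNIV e] by auto
  have FTC: "((\<lambda>t. e (of_real t + c)) has_integral (P (of_real b + c) - P (of_real a + c))) {a..b}"
    if "a \<le> b" for a b c
  proof (rule fundamental_theorem_of_calculus[OF that])
    fix t
    have "((\<lambda>z. P (z + c)) has_field_derivative e (of_real t + c)) (at (of_real t))"
      using P[of "of_real t + c"] by (simp add: DERIV_shift)
    thus "((\<lambda>t. P (of_real t + c)) has_vector_derivative e (of_real t + c)) (at t within {a..b})"
      by (rule has_vector_derivative_real_field[THEN has_vector_derivative_at_within])
  qed
  have "uniform_limit (cbox 0 1) (\<lambda>X t. \<Sum>n\<in>X. e (of_real t + of_int n)) (\<lambda>t. F (of_real t))
          (finite_subsets_at_top UNIV)"
    unfolding uniform_limit_iff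
  proof (intro allI impI)
    fix \<epsilon> :: real assume "\<epsilon> > 0"
    from uniform_limitD[OF gaussian_periodization_uniform_limit[of 1] this]
    show "\<forall>\<^sub>F X in finite_subsets_at_top UNIV. \<forall>t\<in>cbox 0 1.
            dist (\<Sum>n\<in>X. e (of_real t + of_int n)) (F (of_real t)) < \<epsilon>"
    proof eventually_elim
      case (elim X)
      show ?case
      proof
        fix t :: real assume "t \<in> cbox 0 1"
        hence "complex_of_real t \<in> cball 0 1" by simp
        from bspec[OF elim this] show "dist (\<Sum>n\<in>X. e (of_real t + of_int n)) (F (of_real t)) < \<epsilon>"
          by (simp add: e_def)
      qed
    qed
  qed
  then obtain I J where IJ:
    "\<And>X. ((\<lambda>t. \<Sum>n\<in>X. e (of_real t + of_int n)) has_integral I X) (cbox 0 1)"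
    "((\<lambda>t. F (of_real t)) has_integral J) (cbox 0 1)" "(I \<longlongrightarrow> J) (finite_subsets_at_top UNIV)"
    by (rule uniform_limit_integral_cbox) (auto simp: e_def intro!: continuous_intros)
  \<comment> \<open>Half-open index sets, because the intervals \<open>[n, n + 1]\<close> with
    \<open>- M <= n < M\<close> tile exactly \<open>[- M, M]\<close>.\<close>
  define X where "X = (\<lambda>M::nat. {- int M..<int M})"
  have IX: "I (X M) = P (of_nat M) - P (- of_nat M)" for M
  proof -
    have "((\<lambda>t. \<Sum>n\<in>X M. e (of_real t + of_int n)) has_integral
       (\<Sum>n\<in>X M. P (of_real 1 + of_int n) - P (of_real 0 + of_int n))) (cbox 0 1)"
      unfolding cbox_interval by (intro has_integral_sum FTC) (auto simp: X_def)
    hence "I (X M) = (\<Sum>n\<in>X M. P (of_real 1 + of_int n) - P (of_real 0 + of_int n))"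
      using IJ(1) has_integral_unique by blast
    also have "\<dots> = P (of_nat M) - P (- of_nat M)"
    proof (induction M)
      case (Suc M)
      have "X (Suc M) = insert (int M) (insert (- 1 - int M) (X M))" by (auto simp: X_def)
      thus ?case using Suc by (subst \<open>X (Suc M) = _\<close>) (auto simp: X_def algebra_simps)
    qed (simp add: X_def)
    finally show ?thesis .
  qed
  have "filterlim X (finite_subsets_at_top UNIV) sequentially"
    unfolding filterlim_finite_subsets_at_top
  proof (intro allI impI)
    fix Y :: "int set" assume "finite Y \<and> Y \<subseteq> UNIV"
    define b where "b = Max (abs ` Y)"
    have b: "\<bar>y\<bar> \<le> b" if "y \<in> Y" for y
      unfolding b_def using that \<open>finite Y \<and> Y \<subseteq> UNIV\<close> by (intro Max_ge) auto
    show "\<forall>\<^sub>F M in sequentially. finite (X M) \<and> Y \<subseteq> X M \<and> X M \<subseteq> UNIV"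
      using eventually_gt_at_top[of "nat b"]
    proof eventually_elim
      case (elim M)
      thus ?case using b by (fastforce simp: X_def)
    qed
  qed
  from filterlim_compose[OF IJ(3) this]
  have "(\<lambda>M. P (of_nat M) - P (- of_nat M)) \<longlonglongrightarrow> J" by (simp add: IX)
  moreover have "(\<lambda>M. P (of_nat M) - P (- of_nat M)) \<longlonglongrightarrow> of_real (sqrt pi / s)"
  proof -
    have e: "e (of_real u) = complex_of_real (exp (- (s\<^sup>2 * u\<^sup>2)))" for u
      by (simp add: e_def flip: exp_of_real)
    have "(\<lambda>M. \<integral>u. indicator {- real M..real M} u *\<^sub>R e (of_real u) \<partial>lborel) \<longlonglongrightarrow> (\<integral>u. e (of_real u) \<partial>lborel)"
    proof (rule integral_dominated_convergence)
      show "integrable lborel (\<lambda>u. norm (e (of_real u)))"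
        unfolding e by (intro integrable_norm integral_gaussian s)
      show "AE u in lborel. (\<lambda>M. indicator {- real M..real M} u *\<^sub>R e (of_real u)) \<longlonglongrightarrow> e (of_real u)"
      proof (rule AE_I2)
        fix u :: real
        have "\<forall>\<^sub>F M in sequentially. indicator {- real M..real M} u *\<^sub>R e (of_real u) = e (of_real u)"
          using eventually_ge_at_top[of "nat \<lceil>\<bar>u\<bar>\<rceil>"]
        proof eventually_elim
          case (elim M)
          hence "u \<in> {- real M..real M}" by (auto simp: nat_le_iff ceiling_le_iff abs_le_iff)
          thus ?case by simp
        qed
        thus "(\<lambda>M. indicator {- real M..real M} u *\<^sub>R e (of_real u)) \<longlonglongrightarrow> e (of_real u)"
          by (rule tendsto_eventually)
      qed
    qed (auto simp: e_def indicator_def)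
    moreover have "(\<integral>u. indicator {- real M..real M} u *\<^sub>R e (of_real u) \<partial>lborel)
        = P (of_nat M) - P (- of_nat M)" for M
    proof -
      have "integrable lborel (\<lambda>u. indicator {- real M..real M} u *\<^sub>R e (of_real u))"
        unfolding e by (intro integrable_mult_indicator integral_gaussian s) auto
      from has_integral_integral_lborel[OF this]
      have "((\<lambda>u. if u \<in> {- real M..real M} then e (of_real u) else 0) has_integral
          (\<integral>u. indicator {- real M..real M} u *\<^sub>R e (of_real u) \<partial>lborel)) UNIV"
        by (simp add: indicator_def of_bool_def if_distrib[of "\<lambda>c. c *\<^sub>R _"] cong: if_cong)
      hence "((\<lambda>u. e (of_real u)) has_integral
          (\<integral>u. indicator {- real M..real M} u *\<^sub>R e (of_real u) \<partial>lborel)) {- real M..real M}"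
        by (simp only: has_integral_restrict_UNIV)
      moreover have "((\<lambda>u. e (of_real u)) has_integral (P (of_nat M) - P (- of_nat M))) {- real M..real M}"
        using FTC[of "- real M" "real M" 0] by simp
      ultimately show ?thesis by (rule has_integral_unique)
    qed
    ultimately show ?thesis unfolding e integral_gaussian(2)[OF s] by simp
  qed
  ultimately have "J = of_real (sqrt pi / s)" by (rule LIMSEQ_unique)
  with IJ(2) show ?thesis by (simp add: integral_unique)
qed

lemma theta_eq_gaussian_periodization: "F 0 = of_real (theta (s\<^sup>2))"
proof -
  have "F 0 = (\<Sum>\<^sub>\<infinity>n\<in>(UNIV :: int set). complex_of_real (exp (- (s\<^sup>2 * (real_of_int n)\<^sup>2))))"
    unfolding F_def by (simp flip: exp_of_real)
  also have "\<dots> = of_real (theta (s\<^sup>2))"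
    unfolding theta_def using s
    by (intro infsumI has_sum_of_real has_sum_infsum summable_gaussian_int) auto
  finally show ?thesis .
qed

text \<open>Cauchy's inequality on circles of radius \<open>1 / s\<close> gains a factor
  \<open>s\<close> with each derivative, while the bound for \<open>F\<close> itself only loses
  \<open>s^2\<close>.\<close>

lemma theta_square_estimate:
  assumes "s \<le> 1" "n > 0"
  shows "\<bar>theta (s\<^sup>2) - sqrt pi / s\<bar> \<le> fact n *
    (exp 6 * (\<Sum>\<^sub>\<infinity>n\<in>(UNIV :: int set). (1 + (real_of_int n)\<^sup>2) powr (- 2 / 2)) / s\<^sup>2) / (1 / s) ^ n"
    (is "_ \<le> fact n * ?B / _")
proof -
  obtain m where n: "n = Suc m" using assms(2) by (cases n) auto
  have "norm (F (of_real 0) - integral {0..1} (\<lambda>t. F (of_real t))) \<le> fact n * ?B / (1 / s) ^ n"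
  proof (rule norm_periodic_minus_mean_le[where n = m])
    fix t :: real assume t: "t \<in> {0..1}"
    have "norm ((deriv ^^ n) F (of_real t)) \<le> fact n * ?B / (1 / s) ^ n"
    proof (rule Cauchy_inequality)
      show "norm (F x) \<le> ?B" if x: "norm (of_real t - x) = 1 / s" for x
      proof (rule norm_gaussian_periodization_le)
        show "\<bar>Im x\<bar> \<le> 1 / s" using abs_Im_le_cmod[of "of_real t - x"] x by simp
        have "\<bar>t - Re x\<bar> \<le> 1 / s" using abs_Re_le_cmod[of "of_real t - x"] x by simp
        moreover have "0 \<le> t" "t \<le> 1" using t by auto
        ultimately show "\<bar>Re x\<bar> \<le> 1 + 1 / s" by linarith
      qed (use assms in auto)
    qed (use s gaussian_periodization_holomorphic in
          \<open>auto intro: holomorphic_on_subset holomorphic_on_imp_continuous_on continuous_on_subset\<close>)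
    thus "norm ((deriv ^^ Suc m) F (of_real t)) \<le> fact n * ?B / (1 / s) ^ n" by (simp only: n)
  qed (use gaussian_periodization_holomorphic gaussian_periodization_periodic in auto)
  also have "F (of_real 0) - integral {0..1} (\<lambda>t. F (of_real t)) = of_real (theta (s\<^sup>2) - sqrt pi / s)"
    by (simp add: theta_eq_gaussian_periodization integral_gaussian_periodization)
  finally show ?thesis by (simp only: norm_of_real)
qed

end

lemma theta_asymptotics:
  obtains C where "C > 0" "\<And>x. 0 < x \<Longrightarrow> x \<le> 1 \<Longrightarrow> \<bar>theta x - sqrt (pi / x)\<bar> \<le> C * x ^ N"
proof -
  define K where "K = (\<Sum>\<^sub>\<infinity>n\<in>(UNIV :: int set). (1 + (real_of_int n)\<^sup>2) powr (- 2 / 2))"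
  have K: "K \<ge> 0" unfolding K_def by (intro infsum_nonneg) auto
  \<comment> \<open>Two derivatives pay for the loss of \<open>s^2\<close>; the other
    \<open>2 N\<close> give \<open>s^(2 N) = x^N\<close>.\<close>
  define n where "n = 2 * N + 2"
  have "\<bar>theta x - sqrt (pi / x)\<bar> \<le> (fact n * exp 6 * K + 1) * x ^ N" if x: "0 < x" "x \<le> 1" for x
  proof -
    define s where "s = sqrt x"
    have s: "0 < s" "s \<le> 1" "x = s\<^sup>2" using x by (auto simp: s_def)
    have "\<bar>theta x - sqrt (pi / x)\<bar> = \<bar>theta (s\<^sup>2) - sqrt pi / s\<bar>"
      using s by (simp add: real_sqrt_divide)
    also have "\<dots> \<le> fact n * (exp 6 * K / s\<^sup>2) / (1 / s) ^ n"
      unfolding K_def by (rule theta_square_estimate) (use s in \<open>auto simp: n_def\<close>)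
    also have "\<dots> = fact n * exp 6 * K * x ^ N"
      using s by (simp add: n_def power_divide power_mult power_add power2_eq_square field_simps flip: power_mult_distrib)
    also have "\<dots> \<le> (fact n * exp 6 * K + 1) * x ^ N"
      using x by (simp add: algebra_simps)
    finally show ?thesis .
  qed
  moreover have "fact n * exp 6 * K + 1 > 0" using K by (intro add_nonneg_pos) auto
  ultimately show ?thesis using that by blast
qed

section \<open>Theta series of the integer lattice\<close>

lemma theta_ge_1:
  assumes "x > 0"
  shows "theta x \<ge> 1"
proof -
  have "(\<Sum>n\<in>{0::int}. exp (- (x * (real_of_int n)\<^sup>2))) \<le> theta x"
    unfolding theta_def using assms by (intro finite_sum_le_infsum summable_gaussian_int) auto
  thus ?thesis by simp
qed

text \<open>The \<open>k\<close>-th power expands into a sum over the lattice, which is then grouped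
  by the value of the quadratic form.\<close>

lemma has_sum_rep_count_theta:
  assumes x: "x > 0"
  shows "((\<lambda>n. real (rep_count k n) * exp (- (real n * x))) has_sum theta x ^ k) UNIV"
proof -
  define h where "h = (\<lambda>g. \<Prod>i\<in>{1..k}. exp (- (x * (real_of_int (g i))\<^sup>2)))"
  define B where "B = (\<lambda>n::nat. {g \<in> int_lattice k. sum_of_squares k g = int n})"
  have h: "h g = exp (- (real n * x))" if "g \<in> B n" for g n
  proof -
    have "h g = exp (- (x * real_of_int (sum_of_squares k g)))"
      by (simp add: h_def sum_of_squares_def exp_sum sum_distrib_left flip: sum_negf)
    thus ?thesis using that by (simp add: B_def mult_ac)
  qed
  have inf: "infsum h (int_lattice k) = theta x ^ k"
    unfolding h_def int_lattice_def
    by (subst infsum_prod_PiE_abs[where f = "\<lambda>_ m. exp (- (x * (real_of_int m)\<^sup>2))"])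
       (use x in \<open>auto simp: theta_def summable_gaussian_int\<close>)
  \<comment> \<open>\<open>infsum\<close> of a family that is not summable is 0 by convention, so a
    nonzero value certifies summability.\<close>
  have "theta x ^ k \<noteq> 0" using theta_ge_1[OF x] by simp
  hence "h summable_on int_lattice k" using inf infsum_not_exists by fastforce
  hence "(h has_sum theta x ^ k) (int_lattice k)" using inf by (metis has_sum_infsum)
  moreover have "bij_betw snd (Sigma UNIV B) (int_lattice k)"
    by (rule bij_betwI[where g = "\<lambda>g. (nat (sum_of_squares k g), g)"])
       (auto simp: B_def sum_of_squares_def sum_nonneg)
  ultimately have sum: "((\<lambda>p. h (snd p)) has_sum theta x ^ k) (Sigma UNIV B)"
    using has_sum_reindex_bij_betw[of snd "Sigma UNIV B" "int_lattice k" h] by blast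
  have inner: "((\<lambda>g. h (snd (n, g))) has_sum (real (rep_count k n) * exp (- (real n * x)))) (B n)" for n
    using finite_rep[of k n] h[of _ n]
    by (intro has_sum_finiteI) (auto simp: B_def rep_count_def)
  show ?thesis by (rule has_sum_SigmaD[OF sum inner])
qed

text \<open>This is \<open>T(z)\<close> of the overview, a power series in \<open>exp (- z)\<close>;
  holomorphy and period both follow from that.\<close>

definition lattice_theta :: "nat \<Rightarrow> complex \<Rightarrow> complex" where
  "lattice_theta k z = (\<Sum>n. of_nat (rep_count k n) * exp (- (of_nat n * z)))"

lemma rep_count_0 [simp]: "rep_count k 0 = 1"
proof -
  have "{g \<in> int_lattice k. sum_of_squares k g = 0} = {\<lambda>i. if i \<in> {1..k} then 0 else undefined}"
    by (auto simp: int_lattice_def sum_of_squares_def sum_nonneg_eq_0_iff PiE_iff extensional_def fun_eq_iff)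
  thus ?thesis by (simp add: rep_count_def)
qed

lemma lattice_theta_sums:
  assumes "Re z > 0"
  shows "summable (\<lambda>n. norm (of_nat (rep_count k n) * exp (- (of_nat n * z))))"
    and "(\<lambda>n. of_nat (rep_count k n) * exp (- (of_nat n * z))) sums lattice_theta k z"
proof -
  show *: "summable (\<lambda>n. norm (of_nat (rep_count k n) * exp (- (of_nat n * z))))"
    using has_sum_imp_sums[OF has_sum_rep_count_theta[OF assms, of k]]
    by (simp add: norm_mult sums_iff)
  show "(\<lambda>n. of_nat (rep_count k n) * exp (- (of_nat n * z))) sums lattice_theta k z"
    unfolding lattice_theta_def using summable_norm_cancel[OF *] by (rule summable_sums)
qed

lemma lattice_theta_of_real:
  assumes "x > 0"
  shows "lattice_theta k (of_real x) = of_real (theta x ^ k)"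
proof -
  have "(\<lambda>n. complex_of_real (real (rep_count k n) * exp (- (real n * x)))) sums of_real (theta x ^ k)"
    using has_sum_imp_sums[OF has_sum_rep_count_theta[OF assms, of k]] by (rule sums_of_real)
  thus ?thesis
    unfolding lattice_theta_def by (simp add: sums_iff flip: exp_of_real)
qed

lemma lattice_theta_holomorphic: "lattice_theta k holomorphic_on {z. Re z > 0}"
proof -
  define p where "p = (\<lambda>q::complex. \<Sum>n. of_nat (rep_count k n) * q ^ n)"
  have "p holomorphic_on ball 0 1"
  proof (rule power_series_holomorphic[where a = "\<lambda>n. of_nat (rep_count k n)"])
    fix q :: complex assume q: "q \<in> ball 0 1"
    show "(\<lambda>n. of_nat (rep_count k n) * (q - 0) ^ n) sums p q"
    proof (cases "q = 0")
      case True
      have "(\<lambda>n. of_nat (rep_count k n) * (0::complex) ^ n) sums of_nat (rep_count k 0)"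
        by (rule powser_sums_zero)
      thus ?thesis using True by (simp add: p_def sums_iff)
    next
      case False
      \<comment> \<open>Every \<open>q\<close> in the punctured unit disc is
        \<open>exp (- z)\<close> for \<open>z = - Ln q\<close>, so convergence there is convergence
        of the theta series.\<close>
      have "Re (- Ln q) > 0" using False q by simp
      from lattice_theta_sums(2)[OF this, of k] False show ?thesis
        by (simp add: p_def sums_iff exp_of_nat_mult)
    qed
  qed
  hence "(p \<circ> (\<lambda>z. exp (- z))) holomorphic_on {z. Re z > 0}"
    by (intro holomorphic_on_compose_gen[where t = "ball 0 1"]) (auto intro!: holomorphic_intros)
  moreover have "lattice_theta k = p \<circ> (\<lambda>z. exp (- z))"
    by (simp add: fun_eq_iff lattice_theta_def p_def flip: exp_of_nat_mult)
  ultimately show ?thesis by simp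
qed

lemma lattice_theta_periodic: "lattice_theta k (z + 2 * of_real pi * \<i>) = lattice_theta k z"
proof -
  have "exp (- (of_nat n * (z + 2 * of_real pi * \<i>))) = exp (- (of_nat n * z))" for n
  proof -
    have "exp (z + 2 * of_real pi * \<i>) ^ n = exp z ^ n" by (simp add: exp_add)
    thus ?thesis by (simp only: exp_minus exp_of_nat_mult)
  qed
  thus ?thesis by (simp add: lattice_theta_def)
qed

text \<open>For \<open>n >= 1\<close> and \<open>x >= 1\<close>, \<open>n x >= n + (x - 1)\<close>:
  each term other than the constant one is at most \<open>exp (1 - x)\<close> times the term at
  \<open>x = 1\<close>.\<close>

lemma theta_power_minus_1_le:
  assumes "x \<ge> 1"
  shows "\<bar>theta x ^ k - 1\<bar> \<le> theta 1 ^ k * exp (1 - x)"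
proof -
  have "(\<lambda>n. real (rep_count k n) * exp (- (real n * x))) sums theta x ^ k"
    using assms by (intro has_sum_imp_sums has_sum_rep_count_theta) auto
  from sums_split_initial_segment[OF this, of 1]
  have "(\<lambda>n. real (rep_count k (Suc n)) * exp (- (real (Suc n) * x))) sums (theta x ^ k - 1)" by simp
  moreover have "(\<lambda>n. real (rep_count k n) * exp (- (real n * 1)) * exp (1 - x)) sums (theta 1 ^ k * exp (1 - x))"
    by (intro sums_mult2 has_sum_imp_sums has_sum_rep_count_theta) auto
  from sums_split_initial_segment[OF this, of 1]
  have "(\<lambda>n. real (rep_count k (Suc n)) * exp (- (real (Suc n) * 1)) * exp (1 - x)) sums
           (theta 1 ^ k * exp (1 - x) - exp (1 - x))" by simp
  ultimately have "theta x ^ k - 1 \<le> theta 1 ^ k * exp (1 - x) - exp (1 - x)"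
  proof (rule sums_le[rotated])
    fix n
    have "real (Suc n) * 1 + (x - 1) \<le> real (Suc n) * x"
      using assms mult_nonneg_nonneg[of "real n" "x - 1"] by (simp add: algebra_simps)
    hence "exp (- (real (Suc n) * x)) \<le> exp (- (real (Suc n) * 1)) * exp (1 - x)"
      by (simp flip: exp_add)
    thus "real (rep_count k (Suc n)) * exp (- (real (Suc n) * x))
        \<le> real (rep_count k (Suc n)) * exp (- (real (Suc n) * 1)) * exp (1 - x)"
      unfolding mult.assoc by (intro mult_left_mono) auto
  qed
  moreover have "theta x ^ k - 1 \<ge> 0" using assms theta_ge_1[of x] by simp
  ultimately show ?thesis using exp_ge_zero[of "1 - x"] by linarith
qed

text \<open>Both bases are at most \<open>M = D / x\<close>. Divided by \<open>M\<close> they lie in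
  the unit interval, where \<open>k\<close>-th powers differ by at most \<open>k\<close> times the
  difference of the bases. Restoring \<open>M^k\<close> costs \<open>x^(- k)\<close>, which is why
  the estimate for \<open>theta\<close> is taken with exponent \<open>N + k\<close>.\<close>

lemma theta_power_asymptotics:
  obtains C where "C > 0"
    "\<And>x. 0 < x \<Longrightarrow> x \<le> 1 \<Longrightarrow> \<bar>theta x ^ k - (pi / x) powr (real k / 2)\<bar> \<le> C * x ^ N"
proof -
  obtain C where C: "C > 0" "\<And>x. 0 < x \<Longrightarrow> x \<le> 1 \<Longrightarrow> \<bar>theta x - sqrt (pi / x)\<bar> \<le> C * x ^ (N + k)"
    by (rule theta_asymptotics[of "N + k"]) blast
  define D where "D = 4 + C"
  have "\<bar>theta x ^ k - (pi / x) powr (real k / 2)\<bar> \<le> (real k * D ^ k * C + 1) * x ^ N" if x: "0 < x" "x \<le> 1" for x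
  proof -
    define b where "b = sqrt (pi / x)"
    define M where "M = D / x"
    have M: "M \<ge> 1" using x C(1) by (simp add: M_def D_def field_simps)
    have "b\<^sup>2 \<le> (4 / x)\<^sup>2"
    proof -
      have "b\<^sup>2 = pi / x" using x by (simp add: b_def)
      also have "\<dots> \<le> 16 / x" using x pi_less_4 by (intro divide_right_mono) auto
      also have "\<dots> \<le> 16 / x / x" using x by (simp add: field_simps)
      also have "\<dots> = (4 / x)\<^sup>2" by (simp add: power2_eq_square)
      finally show ?thesis .
    qed
    hence b: "0 \<le> b" "b \<le> 4 / x" using x power2_le_imp_le[of b "4 / x"] by (auto simp: b_def)
    have d: "\<bar>theta x - b\<bar> \<le> C * x ^ (N + k)" unfolding b_def using C(2) x by blast
    also have "\<dots> \<le> C * 1" using x C(1) by (intro mult_left_mono power_le_one) auto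
    also have "\<dots> \<le> C / x" using x C(1) by (simp add: field_simps)
    finally have "\<bar>theta x - b\<bar> \<le> C / x" .
    hence a: "0 \<le> theta x" "theta x \<le> M" "b \<le> M"
      using b theta_ge_1[of x] x C(1) by (auto simp: M_def D_def add_divide_distrib abs_le_iff)
    have "\<bar>theta x ^ k - b ^ k\<bar> = M ^ k * \<bar>(theta x / M) ^ k - (b / M) ^ k\<bar>"
      using M by (simp add: power_divide abs_mult flip: diff_divide_distrib)
    also have "\<bar>(theta x / M) ^ k - (b / M) ^ k\<bar> \<le> real k * \<bar>theta x / M - b / M\<bar>"
      using norm_power_diff[of "theta x / M" "b / M" k] a b M by simp
    also have "\<bar>theta x / M - b / M\<bar> = \<bar>theta x - b\<bar> / M"
      using M by (simp flip: diff_divide_distrib)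
    also have "\<dots> \<le> \<bar>theta x - b\<bar> / 1" using M by (intro divide_left_mono) auto
    also have "\<dots> \<le> C * x ^ (N + k)" using d by simp
    finally have "\<bar>theta x ^ k - b ^ k\<bar> \<le> M ^ k * (real k * (C * x ^ (N + k)))"
      using M by (auto simp: mult_left_mono)
    also have "\<dots> = real k * D ^ k * C * x ^ N"
      using x by (simp add: M_def power_divide power_add field_simps)
    also have "\<dots> \<le> (real k * D ^ k * C + 1) * x ^ N" using x by (simp add: algebra_simps)
    also have "b ^ k = (pi / x) powr (real k / 2)"
    proof -
      have "b = (pi / x) powr (1 / 2)" using x by (simp add: b_def powr_half_sqrt)
      hence "b powr real k = (pi / x) powr (real k / 2)" by (simp add: powr_powr)
      moreover have "b > 0" using x by (simp add: b_def)
      ultimately show ?thesis by (simp add: powr_realpow)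
    qed
    finally show ?thesis .
  qed
  moreover have "real k * D ^ k * C + 1 > 0"
    using C(1) by (intro add_nonneg_pos mult_nonneg_nonneg) (auto simp: D_def)
  ultimately show ?thesis using that by blast
qed

section \<open>Mellin transforms in the variable \<open>y = ln x\<close>\<close>

lemma Gamma_integral_exp:
  assumes w: "Re w > 0"
  shows "integrable lborel (\<lambda>y. complex_of_real (exp (- exp y)) * exp (w * of_real y))"
    and "(\<integral>y. complex_of_real (exp (- exp y)) * exp (w * of_real y) \<partial>lborel) = Gamma w"
proof -
  define f where "f = (\<lambda>t. complex_of_real t powr (w - 1) / of_real (exp t))"
  have eq: "\<bar>exp y\<bar> *\<^sub>R f (exp y) = complex_of_real (exp (- exp y)) * exp (w * of_real y)" for y
  proof -
    have "of_real (exp y) powr (w - 1) = exp ((w - 1) * of_real y)"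
      by (simp add: powr_def flip: exp_of_real Ln_of_real)
    thus ?thesis
      by (simp add: f_def scaleR_conv_of_real exp_minus field_simps exp_diff flip: exp_of_real)
  qed
  have range: "range exp = {0 :: real <..}" by (auto simp: image_iff intro: exp_ln [symmetric])
  have "f absolutely_integrable_on (exp ` UNIV) \<and> integral (exp ` UNIV) f = Gamma w"
    unfolding range f_def using absolutely_integrable_Gamma_integral'[OF w] Gamma_integral_complex'[OF w]
    by (auto intro: integral_unique)
  hence *: "(\<lambda>y. \<bar>exp y\<bar> *\<^sub>R f (exp y)) absolutely_integrable_on UNIV \<and>
          integral UNIV (\<lambda>y. \<bar>exp y\<bar> *\<^sub>R f (exp y)) = Gamma w"
    by (subst has_absolute_integral_change_of_variables_real) (auto intro!: derivative_eq_intros simp: inj_on_def)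
  thus int: "integrable lborel (\<lambda>y. complex_of_real (exp (- exp y)) * exp (w * of_real y))"
    unfolding eq by (simp add: set_integrable_def integrable_completion)
  show "(\<integral>y. complex_of_real (exp (- exp y)) * exp (w * of_real y) \<partial>lborel) = Gamma w"
    using * integral_lborel[OF int] unfolding eq by simp
qed

text \<open>In the logarithmic variable the scaling by \<open>n\<close> is a translation by
  \<open>ln n\<close>, which produces the factor \<open>n powr (- w)\<close>.\<close>

lemma Gamma_integral_exp_scaled:
  assumes w: "Re w > 0" and n: "n > 0"
  shows "integrable lborel (\<lambda>y. complex_of_real (exp (- (n * exp y))) * exp (w * of_real y))"
    and "(\<integral>y. complex_of_real (exp (- (n * exp y))) * exp (w * of_real y) \<partial>lborel) = Gamma w * of_real n powr (- w)"
proof -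
  define f where "f = (\<lambda>y. complex_of_real (exp (- exp y)) * exp (w * of_real y))"
  have f: "integrable lborel f" "(\<integral>y. f y \<partial>lborel) = Gamma w"
    unfolding f_def by (rule Gamma_integral_exp[OF w])+
  have eq: "complex_of_real (exp (- (n * exp y))) * exp (w * of_real y) = of_real n powr (- w) * f (ln n + 1 * y)" for y
    using n by (simp add: f_def exp_add powr_def Ln_of_real distrib_left exp_minus)
  show "integrable lborel (\<lambda>y. complex_of_real (exp (- (n * exp y))) * exp (w * of_real y))"
    unfolding eq by (intro integrable_mult_right lborel_integrable_real_affine f) auto
  show "(\<integral>y. complex_of_real (exp (- (n * exp y))) * exp (w * of_real y) \<partial>lborel) = Gamma w * of_real n powr (- w)"
    unfolding eq using lborel_integral_real_affine[of 1 f "ln n"] f(2) by simp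
qed

lemma epstein_series_sums:
  assumes "Re s > 1"
  shows "(\<lambda>n. of_nat (rep_count k (Suc n)) * of_nat (Suc n) powr (- (of_nat k * s / 2))) sums epstein_series k s"
proof -
  have "bij_betw Suc UNIV {1..}"
    by (rule bij_betwI[where g = "\<lambda>n. n - 1"]) auto
  from has_sum_reindex_bij_betw[OF this, THEN iffD2, OF epstein_series_has_sum_rep_count[OF assms, of k]]
  show ?thesis by (rule has_sum_imp_sums)
qed

text \<open>Termwise integration. Subtracting 1 removes the term \<open>n = 0\<close>, whose
  transform diverges, hence the index shift by \<open>Suc\<close> throughout.\<close>

lemma epstein_series_mellin:
  assumes k: "k > 0" and s: "Re s > 1"
  defines "w \<equiv> of_nat k * s / 2"
  shows "integrable lborel (\<lambda>y. (of_real (theta (exp y) ^ k) - 1) * exp (w * of_real y))"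
    and "(\<integral>y. (of_real (theta (exp y) ^ k) - 1) * exp (w * of_real y) \<partial>lborel) = Gamma w * epstein_series k s"
proof -
  define f where "f = (\<lambda>n y. of_nat (rep_count k (Suc n)) *
     (complex_of_real (exp (- (real (Suc n) * exp y))) * exp (w * of_real y)))"
  have w: "Re w > 0" using k s by (simp add: w_def)
  have int: "integrable lborel (f n)" for n
    unfolding f_def using w by (intro integrable_mult_right Gamma_integral_exp_scaled) auto
  have val: "(\<integral>y. f n y \<partial>lborel) = Gamma w * (of_nat (rep_count k (Suc n)) * of_nat (Suc n) powr (- w))" for n
    unfolding f_def integral_mult_right_zero
    by (subst Gamma_integral_exp_scaled(2)) (use w in \<open>auto simp: mult_ac\<close>)
  have sums: "(\<lambda>n. f n y) sums ((of_real (theta (exp y) ^ k) - 1) * exp (w * of_real y))"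
    and summ: "summable (\<lambda>n. norm (f n y))" for y
  proof -
    have T: "(\<lambda>n. real (rep_count k n) * exp (- (real n * exp y))) sums theta (exp y) ^ k"
      by (intro has_sum_imp_sums has_sum_rep_count_theta) auto
    from sums_split_initial_segment[OF this, of 1]
    have T': "(\<lambda>n. real (rep_count k (Suc n)) * exp (- (real (Suc n) * exp y))) sums (theta (exp y) ^ k - 1)"
      by simp
    from sums_mult2[OF sums_of_real[OF this], of "exp (w * of_real y)"]
    show "(\<lambda>n. f n y) sums ((of_real (theta (exp y) ^ k) - 1) * exp (w * of_real y))"
      by (simp add: f_def mult.assoc)
    have "summable (\<lambda>n. real (rep_count k (Suc n)) * exp (- (real (Suc n) * exp y)) * norm (exp (w * of_real y)))"
      using sums_summable[OF T'] by (rule summable_mult2)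
    thus "summable (\<lambda>n. norm (f n y))" by (simp add: f_def norm_mult mult.assoc)
  qed
  \<comment> \<open>The integrals of the norms are, up to a Gamma factor, the terms of the same
    Dirichlet series at the real point \<open>Re s\<close>; its convergence there justifies the
    interchange.\<close>
  have norm_int: "(\<integral>y. norm (f n y) \<partial>lborel)
      = Gamma (Re w) * (real (rep_count k (Suc n)) * real (Suc n) powr (- Re w))" for n
  proof -
    define r where "r = complex_of_real (Re w)"
    have "complex_of_real (\<integral>y. norm (f n y) \<partial>lborel) = (\<integral>y. of_nat (rep_count k (Suc n)) *
       (complex_of_real (exp (- (real (Suc n) * exp y))) * exp (r * of_real y)) \<partial>lborel)"
      unfolding integral_complex_of_real [symmetric] f_def r_def
      by (intro Bochner_Integration.integral_cong) (simp_all add: norm_mult flip: exp_of_real)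
    also have "\<dots> = of_nat (rep_count k (Suc n)) * (Gamma r * of_real (real (Suc n)) powr (- r))"
      unfolding integral_mult_right_zero using w by (subst Gamma_integral_exp_scaled(2)) (auto simp: r_def)
    also have "of_real (real (Suc n)) powr (- r) = complex_of_real (real (Suc n) powr (- Re w))"
      unfolding r_def of_real_minus [symmetric] by (rule powr_of_real) simp
    also have "Gamma r = of_real (Gamma (Re w))" using w by (simp add: r_def Gamma_complex_of_real)
    finally have "complex_of_real (\<integral>y. norm (f n y) \<partial>lborel)
      = of_real (Gamma (Re w) * (real (rep_count k (Suc n)) * real (Suc n) powr (- Re w)))" by simp
    thus ?thesis by (simp only: of_real_eq_iff)
  qed
  have "summable (\<lambda>n. real (rep_count k (Suc n)) * real (Suc n) powr (- Re w))"
  proof -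
    have "summable (\<lambda>n. of_nat (rep_count k (Suc n)) * of_nat (Suc n) powr (- (of_nat k * of_real (Re s) / 2)) :: complex)"
      using s by (intro sums_summable[OF epstein_series_sums]) simp
    moreover have "of_nat (rep_count k (Suc n)) * of_nat (Suc n) powr (- (of_nat k * of_real (Re s) / 2))
       = complex_of_real (real (rep_count k (Suc n)) * real (Suc n) powr (- Re w))" for n
    proof -
      have "- (of_nat k * of_real (Re s) / 2) = complex_of_real (- Re w)" by (simp add: w_def)
      moreover have "of_nat (Suc n) powr complex_of_real (- Re w) = of_real (real (Suc n) powr (- Re w))"
        using powr_of_real[of "real (Suc n)" "- Re w"] by simp
      ultimately show ?thesis by simp
    qed
    ultimately show ?thesis by (simp only: summable_of_real_iff)
  qed
  hence summ_int: "summable (\<lambda>n. \<integral>y. norm (f n y) \<partial>lborel)"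
    unfolding norm_int by (rule summable_mult)
  have eq: "(\<lambda>y. \<Sum>n. f n y) = (\<lambda>y. (of_real (theta (exp y) ^ k) - 1) * exp (w * of_real y))"
    using sums by (simp add: sums_iff fun_eq_iff)
  show "integrable lborel (\<lambda>y. (of_real (theta (exp y) ^ k) - 1) * exp (w * of_real y))"
    using integrable_suminf[OF int AE_I2[OF summ] summ_int] unfolding eq .
  have "(\<lambda>n. \<integral>y. f n y \<partial>lborel) sums (\<integral>y. (of_real (theta (exp y) ^ k) - 1) * exp (w * of_real y) \<partial>lborel)"
    using sums_integral[OF int AE_I2[OF summ] summ_int] unfolding eq .
  moreover have "(\<lambda>n. \<integral>y. f n y \<partial>lborel) sums (Gamma w * epstein_series k s)"
    unfolding val w_def by (intro sums_mult epstein_series_sums s)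
  ultimately show "(\<integral>y. (of_real (theta (exp y) ^ k) - 1) * exp (w * of_real y) \<partial>lborel) = Gamma w * epstein_series k s"
    by (rule sums_unique2)
qed

section \<open>Meromorphic continuation\<close>

text \<open>This makes the definite description in \<open>epstein_zeta\<close> refer to one
  function. The identity theorem applies to the difference after its singularities are removed; the
  values of \<open>f\<close> and \<open>g\<close> themselves are recovered from their
  normalization.\<close>

lemma nicely_meromorphic_unique:
  assumes f: "f nicely_meromorphic_on UNIV" and g: "g nicely_meromorphic_on UNIV"
    and U: "open U" "u \<in> U" "\<And>z. z \<in> U \<Longrightarrow> f z = g z"
  shows "f = g"
proof
  fix z
  define h where "h = remove_sings (\<lambda>z. f z - g z)"
  have mero: "(\<lambda>z. f z - g z) meromorphic_on UNIV"
    using f g by (intro meromorphic_intros) (auto simp: nicely_meromorphic_on_def)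
  have nice: "h nicely_meromorphic_on UNIV"
    unfolding h_def using mero by (rule remove_sings_nicely_meromorphic)
  have h0: "h v = 0" if "v \<in> U" for v
    unfolding h_def
  proof (rule remove_sings_eqI)
    have "eventually (\<lambda>z. z \<in> U) (at v)" using U(1) that by (rule eventually_at_in_open')
    hence "eventually (\<lambda>z. f z - g z = 0) (at v)" by eventually_elim (simp add: U(3))
    thus "(\<lambda>z. f z - g z) \<midarrow>v\<rightarrow> 0" by (rule tendsto_eventually)
  qed
  have "eventually (\<lambda>z. h z = 0) (at u)"
    using eventually_at_in_open'[OF U(1,2)] by eventually_elim (rule h0)
  hence "frequently (\<lambda>z. h z = 0) (at u)" by (intro eventually_frequently) auto
  hence h: "h w = 0" for w
    by (rule frequently_eq_meromorphic_imp_constant[OF _ nice]) auto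
  have "isolated_singularity_at (\<lambda>z. f z - g z) z"
    using mero by (meson UNIV_I meromorphic_on_isolated_singularity meromorphic_on_meromorphic_at)
  hence "eventually (\<lambda>w. h w = f w - g w) (at z)"
    unfolding h_def by (rule eventually_remove_sings_eq_at)
  hence ev: "eventually (\<lambda>w. f w = g w) (at z)" by (simp add: h)
  \<comment> \<open>Agreement on a punctured neighbourhood gives the same poles. At a pole both
    values are 0 by normalization, elsewhere both are the common limit.\<close>
  have pole: "is_pole f z \<longleftrightarrow> is_pole g z" by (rule is_pole_cong[OF ev refl])
  have cf: "(is_pole f z \<and> f z = 0) \<or> f \<midarrow>z\<rightarrow> f z" and cg: "(is_pole g z \<and> g z = 0) \<or> g \<midarrow>z\<rightarrow> g z"
    using f g by (auto simp: nicely_meromorphic_on_def)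
  show "f z = g z"
  proof (cases "is_pole f z")
    case True
    hence "\<not> f \<midarrow>z\<rightarrow> f z" "\<not> g \<midarrow>z\<rightarrow> g z"
      using pole not_tendsto_and_filterlim_at_infinity[OF at_neq_bot] by (auto simp: is_pole_def)
    thus ?thesis using cf cg by simp
  next
    case False
    hence "f \<midarrow>z\<rightarrow> f z" "g \<midarrow>z\<rightarrow> g z" using cf cg pole by auto
    moreover from this(1) have "g \<midarrow>z\<rightarrow> f z" by (rule Lim_transform_eventually[OF _ ev])
    ultimately show ?thesis using LIM_unique by blast
  qed
qed

text \<open>Up to the factor \<open>exp 1\<close>, the integrand of \<open>Gamma 1\<close> dominates
  \<open>exp y\<close> on the negative half-line; adding its reflection covers the positive
  one.\<close>

lemma integrable_exp_minus_abs: "integrable lborel (\<lambda>y::real. exp (- \<bar>y\<bar>))"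
proof -
  have "complex_of_real (exp (- exp y)) * exp (1 * of_real y) = of_real (exp (- exp y) * exp y)" for y
    by (simp flip: exp_of_real)
  hence f: "integrable lborel (\<lambda>y::real. exp (- exp y) * exp y)"
    using Gamma_integral_exp(1)[of 1] by (simp only: complex_of_real_integrable_eq) simp
  have g: "integrable lborel (\<lambda>y::real. exp (- exp (- y)) * exp (- y))"
    using lborel_integrable_real_affine[OF f, of "-1" 0] by simp
  have "integrable lborel (\<lambda>y::real. exp 1 * (exp (- exp y) * exp y + exp (- exp (- y)) * exp (- y)))"
    by (intro integrable_mult_right Bochner_Integration.integrable_add f g)
  thus ?thesis
  proof (rule Bochner_Integration.integrable_bound)
    have *: "exp y \<le> exp 1 * (exp (- exp y) * exp y)" if "y \<le> 0" for y :: real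
      using that by (simp flip: exp_add)
    have "exp (- \<bar>y\<bar>) \<le> exp 1 * (exp (- exp y) * exp y + exp (- exp (- y)) * exp (- y))" for y :: real
    proof (cases "y \<le> 0")
      case True
      have "exp 1 * (exp (- exp (- y)) * exp (- y)) \<ge> 0" by simp
      moreover have "exp (- \<bar>y\<bar>) = exp y" using True by simp
      ultimately show ?thesis using *[OF True] unfolding distrib_left by linarith
    next
      case False
      have "exp 1 * (exp (- exp y) * exp y) \<ge> 0" by simp
      moreover have "exp (- \<bar>y\<bar>) = exp (- y)" using False by simp
      ultimately show ?thesis using *[of "- y"] False unfolding distrib_left by linarith
    qed
    hence "norm (exp (- \<bar>y\<bar>)) \<le> norm (exp 1 * (exp (- exp y) * exp y + exp (- exp (- y)) * exp (- y)))" for y :: real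
      unfolding real_norm_def abs_exp_cancel by (rule order.trans[OF _ abs_ge_self])
    thus "AE y in (lborel :: real measure). norm (exp (- \<bar>y\<bar>))
        \<le> norm (exp 1 * (exp (- exp y) * exp y + exp (- exp (- y)) * exp (- y)))"
      by (intro AE_I2)
  qed auto
qed

lemma integrable_exp_minus_mult_abs:
  assumes "a > 0"
  shows "integrable lborel (\<lambda>y::real. exp (- (a * \<bar>y\<bar>)))"
  using lborel_integrable_real_affine[OF integrable_exp_minus_abs, of a 0] assms by (simp add: abs_mult)

text \<open>Both half-lines are allowed because \<open>H\<close>, defined below, splits at 0 with 0
  itself on the left: the right part is open, and the left part is the reflection of a closed
  one.\<close>

lemma half_line_exp_integral:
  assumes a: "Re a > 0" and S: "S = {0..} \<or> S = {0<..}"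
  shows "integrable lborel (\<lambda>y. indicator S y *\<^sub>R exp (- (a * of_real y)))"
    and "(\<integral>y. indicator S y *\<^sub>R exp (- (a * of_real y)) \<partial>lborel) = 1 / a"
proof -
  define e where "e = (\<lambda>y::real. exp (- (a * of_real y)))"
  have [measurable]: "e \<in> borel_measurable borel" "S \<in> sets borel" using S by (auto simp: e_def)
  have a0: "a \<noteq> 0" using a by auto
  have bound: "norm (indicator T y *\<^sub>R e y) \<le> exp (- (Re a * \<bar>y\<bar>))" if "T \<subseteq> {0..}" for T y
    using that by (cases "y \<ge> 0") (auto simp: e_def indicator_def norm_exp_eq_Re)
  have bound': "norm (indicator T y *\<^sub>R e y) \<le> norm (exp (- (Re a * \<bar>y\<bar>)))" if "T \<subseteq> {0..}" for T y
    using bound[OF that] by (simp only: real_norm_def abs_exp_cancel)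
  have dom: "integrable lborel (\<lambda>y::real. exp (- (Re a * \<bar>y\<bar>)))"
    by (rule integrable_exp_minus_mult_abs[OF a])
  have "integrable lborel (\<lambda>y. indicator S y *\<^sub>R e y)"
  proof (rule Bochner_Integration.integrable_bound[OF dom])
    show "AE y in lborel. norm (indicator S y *\<^sub>R e y) \<le> norm (exp (- (Re a * \<bar>y\<bar>)))"
      using S by (intro AE_I2 bound') auto
  qed auto
  thus "integrable lborel (\<lambda>y. indicator S y *\<^sub>R exp (- (a * of_real y)))"
    by (simp only: e_def)
  have fin: "integrable lborel (\<lambda>y. indicator {0..real n} y *\<^sub>R e y)" for n
  proof (rule Bochner_Integration.integrable_bound[OF dom])
    show "AE y in lborel. norm (indicator {0..real n} y *\<^sub>R e y) \<le> norm (exp (- (Re a * \<bar>y\<bar>)))"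
      by (intro AE_I2 bound') auto
  qed auto
  have val: "(\<integral>y. indicator {0..real n} y *\<^sub>R e y \<partial>lborel) = (1 - e (real n)) / a" for n
  proof -
    have "((\<lambda>u. if u \<in> {0..real n} then e u else 0) has_integral
        (\<integral>y. indicator {0..real n} y *\<^sub>R e y \<partial>lborel)) UNIV"
      using has_integral_integral_lborel[OF fin[of n]]
      by (simp add: indicator_def of_bool_def if_distrib[of "\<lambda>c. c *\<^sub>R _"] cong: if_cong)
    hence "(e has_integral (\<integral>y. indicator {0..real n} y *\<^sub>R e y \<partial>lborel)) {0..real n}"
      by (simp only: has_integral_restrict_UNIV)
    moreover have "(e has_integral (- (e (real n) / a) - (- (e 0 / a)))) {0..real n}"
    proof (rule fundamental_theorem_of_calculus[where f = "\<lambda>y. - (e y / a)"])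
      fix y
      have "((\<lambda>z. - (exp (- (a * z)) / a)) has_field_derivative exp (- (a * of_real y))) (at (of_real y))"
        using a0 by (auto intro!: derivative_eq_intros)
      thus "((\<lambda>y. - (e y / a)) has_vector_derivative e y) (at y within {0..real n})"
        unfolding e_def by (rule has_vector_derivative_real_field[THEN has_vector_derivative_at_within])
    qed auto
    ultimately show ?thesis
      by (auto dest: has_integral_unique simp: e_def diff_divide_distrib)
  qed
  have "(\<lambda>n. \<integral>y. indicator {0..real n} y *\<^sub>R e y \<partial>lborel) \<longlonglongrightarrow> (\<integral>y. indicator {0..} y *\<^sub>R e y \<partial>lborel)"
  proof (rule integral_dominated_convergence[OF _ _ dom])
    show "AE y in lborel. (\<lambda>n. indicator {0..real n} y *\<^sub>R e y) \<longlonglongrightarrow> indicator {0..} y *\<^sub>R e y"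
    proof (rule AE_I2)
      fix y :: real
      have "\<forall>\<^sub>F n in sequentially. indicator {0..real n} y *\<^sub>R e y = indicator {0..} y *\<^sub>R e y"
        using eventually_ge_at_top[of "nat \<lceil>y\<rceil>"]
      proof eventually_elim
        case (elim n)
        hence "y \<le> real n" by (simp add: nat_le_iff ceiling_le_iff)
        thus ?case by (simp add: indicator_def)
      qed
      thus "(\<lambda>n. indicator {0..real n} y *\<^sub>R e y) \<longlonglongrightarrow> indicator {0..} y *\<^sub>R e y" by (rule tendsto_eventually)
    qed
    show "AE y in lborel. norm (indicator {0..real n} y *\<^sub>R e y) \<le> exp (- (Re a * \<bar>y\<bar>))" for n
      by (intro AE_I2 bound) auto
  qed auto
  moreover have "(\<lambda>n. (1 - e (real n)) / a) \<longlonglongrightarrow> (1 - 0) / a"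
  proof -
    have "(\<lambda>n. exp (- Re a) ^ n) \<longlonglongrightarrow> 0" using a by (intro LIMSEQ_power_zero) simp
    hence "(\<lambda>n. norm (e (real n))) \<longlonglongrightarrow> 0"
      by (simp add: e_def norm_exp_eq_Re mult.commute flip: exp_of_nat_mult)
    hence "(\<lambda>n. e (real n)) \<longlonglongrightarrow> 0" by (rule tendsto_norm_zero_cancel)
    thus ?thesis using a0 by (intro tendsto_intros)
  qed
  ultimately have closed: "(\<integral>y. indicator {0..} y *\<^sub>R e y \<partial>lborel) = 1 / a"
    unfolding val using LIMSEQ_unique by fastforce
  have "(\<integral>y. indicator S y *\<^sub>R e y \<partial>lborel) = (\<integral>y. indicator {0..} y *\<^sub>R e y \<partial>lborel)"
  proof (rule integral_cong_AE)
    show "AE y in lborel. indicator S y *\<^sub>R e y = indicator {0..} y *\<^sub>R e y"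
      using AE_lborel_singleton[of "0::real"] by eventually_elim (use S in \<open>auto simp: indicator_def\<close>)
  qed auto
  with closed show "(\<integral>y. indicator S y *\<^sub>R exp (- (a * of_real y)) \<partial>lborel) = 1 / a"
    unfolding e_def by simp
qed

lemma negative_half_line_exp_integral:
  assumes a: "Re a > 0"
  shows "integrable lborel (\<lambda>y. indicator {..0} y *\<^sub>R exp (a * of_real y))"
    and "(\<integral>y. indicator {..0} y *\<^sub>R exp (a * of_real y) \<partial>lborel) = 1 / a"
proof -
  define f where "f = (\<lambda>y::real. indicator {0..} y *\<^sub>R exp (- (a * of_real y)))"
  have f: "integrable lborel f" "(\<integral>y. f y \<partial>lborel) = 1 / a"
    unfolding f_def using half_line_exp_integral[OF a] by blast+
  have eq: "indicator {..0} y *\<^sub>R exp (a * of_real y) = f (0 + (-1) * y)" for y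
    by (simp add: f_def indicator_def)
  show "integrable lborel (\<lambda>y. indicator {..0} y *\<^sub>R exp (a * of_real y))"
    unfolding eq by (intro lborel_integrable_real_affine f) simp
  show "(\<integral>y. indicator {..0} y *\<^sub>R exp (a * of_real y) \<partial>lborel) = 1 / a"
    unfolding eq using lborel_integral_real_affine[of "-1" f 0] f(2) by simp
qed

lemma Gamma_mult_rGamma:
  assumes "Re w > 0"
  shows "Gamma w * rGamma w = 1"
proof -
  have "w \<notin> \<int>\<^sub>\<le>\<^sub>0" using assms by (auto elim!: nonpos_Ints_cases)
  thus ?thesis by (simp add: Gamma_def rGamma_eq_zero_iff)
qed

lemma exp_minus_exp_le: "exp (- exp y) \<le> fact N * exp (- (real N * y))" for y :: real
proof -
  have "exp y ^ N / fact N \<le> exp (exp y)"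
  proof -
    have "(\<lambda>n. exp y ^ n / fact n) sums exp (exp y)"
      using exp_converges[of "exp y"] by (simp add: divide_inverse mult.commute scaleR_conv_of_real)
    hence "summable (\<lambda>n. exp y ^ n / fact n)" "exp (exp y) = (\<Sum>n. exp y ^ n / fact n)"
      by (auto simp: sums_iff)
    thus ?thesis using sum_le_suminf[of "\<lambda>n. exp y ^ n / fact n" "{N}"] by simp
  qed
  hence "exp (real N * y) \<le> fact N * exp (exp y)" unfolding exp_of_nat_mult by (simp add: field_simps)
  thus ?thesis by (simp add: exp_minus field_simps)
qed

text \<open>
  In the variable \<open>y = ln x\<close>, \<open>G\<close> is the function whose transform is wanted in the critical strip. \<open>H\<close> differs from it by
  exponentials on half-lines, which account for the poles of the transform, and decays faster than every
  exponential in both directions, so its own transform is entire.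
\<close>

context
  fixes k :: nat and T H G :: "real \<Rightarrow> complex"
  assumes k: "k > 0"
  defines "T \<equiv> (\<lambda>y. of_real (theta (exp y) ^ k))"
  defines "G \<equiv> (\<lambda>y. T y - 1 - of_real (pi powr (k / 2)) * exp (- (of_real (k / 2) * of_real y)))"
  defines "H \<equiv> (\<lambda>y. if y > 0 then T y - 1
                      else T y - of_real (pi powr (k / 2)) * exp (- (of_real (k / 2) * of_real y)))"
begin

lemma continuous_T: "continuous_on UNIV T"
proof -
  have "continuous_on UNIV (\<lambda>y::real. lattice_theta k (of_real (exp y)))"
    by (rule continuous_on_compose2[OF holomorphic_on_imp_continuous_on[OF lattice_theta_holomorphic]])
       (auto intro!: continuous_intros)
  thus ?thesis by (simp add: T_def lattice_theta_of_real)
qed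

lemma measurable_H [measurable]: "H \<in> borel_measurable borel"
proof -
  have [measurable]: "T \<in> borel_measurable borel" by (rule borel_measurable_continuous_onI[OF continuous_T])
  show ?thesis unfolding H_def by measurable
qed

text \<open>For \<open>y > 0\<close> the decay is doubly exponential. For \<open>y <= 0\<close> the
  theta estimate at \<open>x = exp y\<close> applies, since
  \<open>x^N = exp (- N |y|)\<close>.\<close>

lemma norm_H_le:
  obtains C where "C > 0" "\<And>y. norm (H y) \<le> C * exp (- (real N * \<bar>y\<bar>))"
proof -
  obtain C where C: "C > 0" "\<And>x. 0 < x \<Longrightarrow> x \<le> 1 \<Longrightarrow> \<bar>theta x ^ k - (pi / x) powr (real k / 2)\<bar> \<le> C * x ^ N"
    by (rule theta_power_asymptotics) blast
  define D where "D = theta 1 ^ k * exp 1 * fact N"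
  have t1: "theta 1 \<ge> 1" by (rule theta_ge_1) simp
  hence "theta 1 ^ k > 0" by (intro zero_less_power) simp
  hence D: "D > 0" unfolding D_def by (rule mult_pos_pos[OF mult_pos_pos[OF _ exp_gt_zero] fact_gt_zero])
  have "norm (H y) \<le> (C + D) * exp (- (real N * \<bar>y\<bar>))" for y
  proof (cases "y > 0")
    case True
    have "H y = of_real (theta (exp y) ^ k - 1)" using True by (simp add: H_def T_def)
    hence "norm (H y) = \<bar>theta (exp y) ^ k - 1\<bar>" by (simp only: norm_of_real)
    also have "\<dots> \<le> theta 1 ^ k * exp (1 - exp y)"
      using True by (intro theta_power_minus_1_le) simp
    also have "\<dots> = theta 1 ^ k * exp 1 * exp (- exp y)" by (simp add: exp_diff exp_minus divide_inverse)
    also have "\<dots> \<le> theta 1 ^ k * exp 1 * (fact N * exp (- (real N * y)))"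
      using t1 by (intro mult_left_mono exp_minus_exp_le) auto
    also have "\<dots> = D * exp (- (real N * \<bar>y\<bar>))" using True by (simp add: D_def)
    also have "\<dots> \<le> (C + D) * exp (- (real N * \<bar>y\<bar>))" using C(1) by (intro mult_right_mono) auto
    finally show ?thesis .
  next
    case False
    have "(pi / exp y) powr (k / 2) = pi powr (k / 2) * exp (- (k / 2 * y))"
    proof -
      have "pi / exp y = pi * exp (- y)" by (simp add: exp_minus field_simps)
      thus ?thesis by (simp add: powr_mult exp_powr_real)
    qed
    hence "complex_of_real (pi powr (k / 2)) * exp (- (of_real (k / 2) * of_real y))
        = of_real ((pi / exp y) powr (k / 2))"
      by (simp only: of_real_mult of_real_minus exp_of_real [symmetric])
    hence "norm (H y) = norm (complex_of_real (theta (exp y) ^ k - (pi / exp y) powr (real k / 2)))"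
      using False unfolding H_def T_def by simp
    also have "\<dots> \<le> C * exp y ^ N"
      unfolding norm_of_real using False by (intro C(2)) auto
    also have "\<dots> = C * exp (- (real N * \<bar>y\<bar>))" using False by (simp add: exp_of_nat_mult)
    also have "\<dots> \<le> (C + D) * exp (- (real N * \<bar>y\<bar>))" using D by (intro mult_right_mono) auto
    finally show ?thesis .
  qed
  thus ?thesis using that[of "C + D"] C(1) D by simp
qed

lemma integrable_H: "integrable lborel (\<lambda>y. H y * exp (w * of_real y))"
proof -
  \<comment> \<open>One unit more than \<open>|Re w|\<close> leaves the majorant
    \<open>exp (- |y|)\<close>.\<close>
  define N where "N = nat \<lceil>\<bar>Re w\<bar>\<rceil> + 1"
  have N: "\<bar>Re w\<bar> + 1 \<le> real N" unfolding N_def by linarith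
  obtain C where C: "C > 0" "\<And>y. norm (H y) \<le> C * exp (- (real N * \<bar>y\<bar>))"
    by (rule norm_H_le) blast
  show ?thesis
  proof (rule Bochner_Integration.integrable_bound[OF integrable_mult_right[OF integrable_exp_minus_abs, of C]])
    have "norm (H y * exp (w * of_real y)) \<le> C * exp (- \<bar>y\<bar>)" for y
    proof -
      have "Re w * y \<le> \<bar>Re w\<bar> * \<bar>y\<bar>" using abs_ge_self[of "Re w * y"] by (simp add: abs_mult)
      moreover have "(\<bar>Re w\<bar> + 1) * \<bar>y\<bar> \<le> real N * \<bar>y\<bar>" using N by (intro mult_right_mono) auto
      ultimately have le: "- (real N * \<bar>y\<bar>) + Re w * y \<le> - \<bar>y\<bar>" by (simp add: algebra_simps)
      have "norm (H y * exp (w * of_real y)) \<le> (C * exp (- (real N * \<bar>y\<bar>))) * exp (Re w * y)"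
        using C(2)[of y] by (simp add: norm_mult norm_exp_eq_Re)
      also have "\<dots> = C * exp (- (real N * \<bar>y\<bar>) + Re w * y)" by (simp only: exp_add mult.assoc)
      also have "\<dots> \<le> C * exp (- \<bar>y\<bar>)" using le C(1) by (intro mult_left_mono) auto
      finally show ?thesis .
    qed
    thus "AE y in lborel. norm (H y * exp (w * of_real y)) \<le> norm (C * exp (- \<bar>y\<bar>))" using C(1) by auto
  qed auto
qed

text \<open>The entire transform of \<open>H\<close> together with the transforms of the split-off
  exponentials. The pole at \<open>w = k / 2\<close> is the one at \<open>s = 1\<close>; the pole at
  \<open>w = 0\<close> is compensated by the zero of \<open>rGamma\<close>.\<close>

definition completed_epstein :: "complex \<Rightarrow> complex" where
  "completed_epstein w = (\<integral>y. H y * exp (w * of_real y) \<partial>lborel)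
     + of_real (pi powr (k / 2)) / (w - of_real (k / 2)) - 1 / w"

text \<open>\<open>T - 1\<close> differs from \<open>H\<close> only for \<open>y <= 0\<close>, by
  \<open>p exp (- k y / 2) - 1\<close>, and both exponentials are integrable there against
  \<open>exp (w y)\<close> when \<open>Re w > k / 2\<close>.\<close>

lemma completed_epstein_right:
  assumes w: "Re w > k / 2"
  shows "(\<integral>y. (T y - 1) * exp (w * of_real y) \<partial>lborel) = completed_epstein w"
proof -
  define c where "c = complex_of_real (k / 2)"
  define p where "p = complex_of_real (pi powr (k / 2))"
  have "0 \<le> real k / 2" by simp
  hence pos: "Re w > 0" "Re (w - c) > 0" using w by (simp_all add: c_def)
  have eq: "(T y - 1) * exp (w * of_real y) = H y * exp (w * of_real y)
      + p * (indicator {..0} y *\<^sub>R exp ((w - c) * of_real y)) - indicator {..0} y *\<^sub>R exp (w * of_real y)" for y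
  proof -
    have "exp ((w - c) * of_real y) = exp (- (c * of_real y)) * exp (w * of_real y)"
      by (simp add: left_diff_distrib flip: exp_add)
    thus ?thesis
      unfolding H_def by (cases "y > 0") (simp_all add: indicator_def algebra_simps c_def flip: p_def)
  qed
  note i1 = integrable_H[of w]
  note i2 = integrable_mult_right[OF negative_half_line_exp_integral(1)[OF pos(2)], of p]
  note i3 = negative_half_line_exp_integral(1)[OF pos(1)]
  from eq have "(\<integral>y. (T y - 1) * exp (w * of_real y) \<partial>lborel)
      = (\<integral>y. H y * exp (w * of_real y) + p * (indicator {..0} y *\<^sub>R exp ((w - c) * of_real y))
           - indicator {..0} y *\<^sub>R exp (w * of_real y) \<partial>lborel)" by presburger
  also have "\<dots> = (\<integral>y. H y * exp (w * of_real y) \<partial>lborel) + p * (1 / (w - c)) - 1 / w"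
    unfolding Bochner_Integration.integral_diff[OF Bochner_Integration.integrable_add[OF i1 i2] i3]
      Bochner_Integration.integral_add[OF i1 i2] integral_mult_right_zero
      negative_half_line_exp_integral(2)[OF pos(1)] negative_half_line_exp_integral(2)[OF pos(2)] ..
  finally show ?thesis by (simp add: completed_epstein_def p_def c_def)
qed

text \<open>When \<open>Re w\<close> drops below \<open>k / 2\<close>, the exponential with
  coefficient \<open>p\<close> is integrated over the other half-line with the opposite sign. Its
  integral is the same rational function, so the formula is unchanged while \<open>T - 1\<close>
  becomes \<open>G\<close>.\<close>

lemma completed_epstein_strip:
  assumes w: "0 < Re w" "Re w < k / 2"
  shows "integrable lborel (\<lambda>y. G y * exp (w * of_real y))"
    and "(\<integral>y. G y * exp (w * of_real y) \<partial>lborel) = completed_epstein w"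
proof -
  define c where "c = complex_of_real (k / 2)"
  define p where "p = complex_of_real (pi powr (k / 2))"
  have pos: "Re w > 0" "Re (c - w) > 0" using w by (auto simp: c_def)
  have eq: "(\<lambda>y. G y * exp (w * of_real y)) = (\<lambda>y. H y * exp (w * of_real y)
      - p * (indicator {0<..} y *\<^sub>R exp (- ((c - w) * of_real y))) - indicator {..0} y *\<^sub>R exp (w * of_real y))"
  proof
    fix y
    have "exp (- ((c - w) * of_real y)) = exp (- (c * of_real y)) * exp (w * of_real y)"
      by (simp add: left_diff_distrib flip: exp_add)
    thus "G y * exp (w * of_real y) = H y * exp (w * of_real y)
      - p * (indicator {0<..} y *\<^sub>R exp (- ((c - w) * of_real y))) - indicator {..0} y *\<^sub>R exp (w * of_real y)"
      unfolding H_def G_def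
      by (cases "y > 0") (simp_all add: indicator_def algebra_simps c_def flip: p_def)
  qed
  note half = half_line_exp_integral[OF pos(2), of "{0<..}", OF disjI2[OF refl]]
  note i1 = integrable_H[of w]
  note i2 = integrable_mult_right[OF half(1), of p]
  note i3 = negative_half_line_exp_integral(1)[OF pos(1)]
  show "integrable lborel (\<lambda>y. G y * exp (w * of_real y))"
    unfolding eq by (intro Bochner_Integration.integrable_diff i1 i2 i3)
  have "(\<integral>y. G y * exp (w * of_real y) \<partial>lborel)
      = (\<integral>y. H y * exp (w * of_real y) \<partial>lborel) - p * (1 / (c - w)) - 1 / w"
    unfolding eq Bochner_Integration.integral_diff[OF Bochner_Integration.integrable_diff[OF i1 i2] i3]
      Bochner_Integration.integral_diff[OF i1 i2] integral_mult_right_zero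
      negative_half_line_exp_integral(2)[OF pos(1)] half(2) ..
  also have "p * (1 / (c - w)) = - (p / (w - c))"
    by (metis minus_diff_eq minus_divide_right times_divide_eq_right mult.right_neutral)
  finally show "(\<integral>y. G y * exp (w * of_real y) \<partial>lborel) = completed_epstein w"
    by (simp add: completed_epstein_def p_def c_def)
qed

lemma completed_epstein_analytic:
  assumes "w \<noteq> 0" "w \<noteq> of_real (k / 2)"
  shows "completed_epstein analytic_on {w}"
proof -
  have "(\<lambda>w. \<integral>y. H y * exp (w * of_real y) \<partial>lborel) holomorphic_on UNIV"
    by (intro laplace_integral_holomorphic integrable_H) auto
  hence "(\<lambda>w. \<integral>y. H y * exp (w * of_real y) \<partial>lborel) analytic_on UNIV"
    by (simp add: analytic_on_open)
  hence "(\<lambda>w. \<integral>y. H y * exp (w * of_real y) \<partial>lborel) analytic_on {w}"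
    by (rule analytic_on_subset) simp
  thus ?thesis
    unfolding completed_epstein_def using assms by (intro analytic_intros) auto
qed

lemma completed_epstein_meromorphic: "completed_epstein meromorphic_on UNIV"
proof -
  have "(\<lambda>w. \<integral>y. H y * exp (w * of_real y) \<partial>lborel) holomorphic_on UNIV"
    by (intro laplace_integral_holomorphic integrable_H) auto
  hence "(\<lambda>w. \<integral>y. H y * exp (w * of_real y) \<partial>lborel) meromorphic_on UNIV"
    by (intro analytic_on_imp_meromorphic_on) (simp add: analytic_on_open)
  thus ?thesis
    unfolding completed_epstein_def by (intro meromorphic_intros)
qed

lemma epstein_zeta_eq_completed:
  assumes s: "0 < Re s" "Re s < 1"
  defines "w \<equiv> of_nat k * s / 2"
  shows "Gamma w * epstein_zeta k s = completed_epstein w"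
proof -
  \<comment> \<open>Dividing by Gamma is multiplication by the entire function
    \<open>rGamma\<close>, which introduces no new singularities.\<close>
  define f where "f = (\<lambda>s. completed_epstein (of_nat k * s / 2) * rGamma (of_nat k * s / 2))"
  have "(\<lambda>s. completed_epstein (of_nat k * s / 2)) meromorphic_on UNIV"
    by (rule meromorphic_on_compose[OF completed_epstein_meromorphic]) (auto intro!: analytic_intros)
  moreover have "(\<lambda>s. rGamma (of_nat k * s / 2) :: complex) meromorphic_on UNIV"
    by (intro analytic_on_imp_meromorphic_on analytic_intros) auto
  ultimately have "f meromorphic_on UNIV" unfolding f_def by (intro meromorphic_intros)
  \<comment> \<open>The removal of singularities supplies the normalization demanded by
    \<open>epstein_zeta\<close>, in particular at \<open>s = 0\<close>, where pole and zero
    cancel.\<close>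
  hence nice: "remove_sings f nicely_meromorphic_on UNIV" by (rule remove_sings_nicely_meromorphic)
  have f_analytic: "f analytic_on {s}" if "s \<noteq> 0" "s \<noteq> 1" for s
  proof -
    have "completed_epstein \<circ> (\<lambda>s. of_nat k * s / 2) analytic_on {s}"
      using that k by (intro analytic_on_compose) (auto intro!: analytic_intros completed_epstein_analytic)
    thus ?thesis unfolding f_def o_def by (intro analytic_intros) auto
  qed
  have f_series: "remove_sings f s = epstein_series k s" if "Re s > 1" for s
  proof -
    define w where "w = of_nat k * s / 2"
    have "Re w > k / 2" using that k by (simp add: w_def)
    hence "completed_epstein w = Gamma w * epstein_series k s"
      using completed_epstein_right[of w] epstein_series_mellin(2)[OF k that]
      by (simp add: T_def w_def)
    moreover have "Gamma w * rGamma w = 1"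
      using that k by (intro Gamma_mult_rGamma) (simp add: w_def)
    moreover have "remove_sings f s = f s"
      using that by (intro remove_sings_at_analytic f_analytic) auto
    ultimately show ?thesis by (simp add: f_def flip: w_def)
  qed
  have zeta: "epstein_zeta k = remove_sings f"
    unfolding epstein_zeta_def
  proof (rule the_equality)
    show "remove_sings f nicely_meromorphic_on UNIV \<and> (\<forall>s. Re s > 1 \<longrightarrow> remove_sings f s = epstein_series k s)"
      using nice f_series by blast
    fix g assume g: "g nicely_meromorphic_on UNIV \<and> (\<forall>s. Re s > 1 \<longrightarrow> g s = epstein_series k s)"
    show "g = remove_sings f"
      by (rule nicely_meromorphic_unique[where U = "{s. Re s > 1}" and u = 2])
         (use g nice f_series in \<open>auto simp: open_halfspace_Re_gt\<close>)
  qed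
  have "remove_sings f s = f s"
    using s by (intro remove_sings_at_analytic f_analytic) auto
  hence "epstein_zeta k s = completed_epstein w * rGamma w"
    unfolding zeta by (simp add: f_def w_def)
  moreover have "Re w > 0" using s k by (simp add: w_def)
  hence "Gamma w * rGamma w = 1"
    by (rule Gamma_mult_rGamma)
  ultimately show ?thesis by simp
qed

lemma epstein_zeta_mellin_strip:
  assumes s: "0 < Re s" "Re s < 1"
  defines "w \<equiv> of_nat k * s / 2"
  shows "integrable lborel (\<lambda>y. G y * exp (w * of_real y))"
    and "(\<integral>y. G y * exp (w * of_real y) \<partial>lborel) = Gamma w * epstein_zeta k s"
proof -
  have w: "0 < Re w" "Re w < k / 2" using s k by (simp_all add: w_def)
  show "integrable lborel (\<lambda>y. G y * exp (w * of_real y))"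
    by (rule completed_epstein_strip(1)[OF w])
  show "(\<integral>y. G y * exp (w * of_real y) \<partial>lborel) = Gamma w * epstein_zeta k s"
    using completed_epstein_strip(2)[OF w] epstein_zeta_eq_completed[OF s] unfolding w_def by simp
qed

text \<open>The weight with \<open>0 < a < k / 2\<close> tames both parts of \<open>G\<close> that
  do not decay rapidly: the constant \<open>- 1\<close> on the left and
  \<open>p exp (- k y / 2)\<close> on the right. Boundedness is a hypothesis of Fourier
  inversion.\<close>

lemma norm_G_bound:
  assumes a: "0 < a" "a < k / 2"
  obtains B where "\<And>y. norm (G y) * exp (a * y) \<le> B"
proof -
  define N where "N = nat \<lceil>a\<rceil>"
  have N: "a \<le> real N" unfolding N_def by linarith
  obtain C where C: "C > 0" "\<And>y. norm (H y) \<le> C * exp (- (real N * \<bar>y\<bar>))"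
    by (rule norm_H_le) blast
  define p where "p = pi powr (k / 2)"
  have "norm (G y) * exp (a * y) \<le> C + p + 1" for y
  proof -
    define q where "q = (if y > 0 then p * exp (- (k / 2 * y)) else 1)"
    have "norm (G y) \<le> norm (H y) + q"
    proof (cases "y > 0")
      case True
      have "norm (G y) \<le> norm (H y) + norm (complex_of_real p * exp (- (of_real (k / 2) * of_real y)))"
        unfolding G_def H_def p_def using True by (simp add: norm_triangle_ineq4)
      also have "norm (complex_of_real p * exp (- (of_real (k / 2) * of_real y))) = q"
        using True by (simp add: q_def norm_mult norm_exp_eq_Re p_def)
      finally show ?thesis .
    next
      case False
      hence "G y = H y - 1" by (simp add: G_def H_def)
      thus ?thesis using False norm_triangle_ineq4[of "H y" 1] by (simp add: q_def)
    qed
    moreover have "norm (H y) * exp (a * y) \<le> C"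
    proof -
      have "a * y \<le> a * \<bar>y\<bar>" using a by (intro mult_left_mono) auto
      also have "\<dots> \<le> real N * \<bar>y\<bar>" using N by (intro mult_right_mono) auto
      finally have "exp (- (real N * \<bar>y\<bar>) + a * y) \<le> exp 0" by (subst exp_le_cancel_iff) simp
      moreover have "norm (H y) * exp (a * y) \<le> C * exp (- (real N * \<bar>y\<bar>)) * exp (a * y)"
        by (intro mult_right_mono C) auto
      moreover have "C * exp (- (real N * \<bar>y\<bar>)) * exp (a * y) = C * exp (- (real N * \<bar>y\<bar>) + a * y)"
        by (simp only: exp_add mult.assoc)
      moreover have "C * exp (- (real N * \<bar>y\<bar>) + a * y) \<le> C * 1"
        using calculation(1) C(1) by (intro mult_left_mono) auto
      ultimately show ?thesis by linarith
    qed
    moreover have "q * exp (a * y) \<le> p + 1"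
    proof (cases "y > 0")
      case True
      have "exp (- (k / 2 * y) + a * y) \<le> exp 0"
        using True a mult_right_mono[of a "k / 2" y] by (subst exp_le_cancel_iff) auto
      hence "p * (exp (- (k / 2 * y)) * exp (a * y)) \<le> p * 1"
        unfolding exp_add [symmetric] by (intro mult_left_mono) (auto simp: p_def)
      thus ?thesis using True by (simp add: q_def mult.assoc)
    next
      case False
      hence "a * y \<le> 0" using a by (simp add: mult_nonneg_nonpos)
      hence "exp (a * y) \<le> 1" by simp
      moreover have "p \<ge> 0" "q * exp (a * y) = exp (a * y)" using False by (simp_all add: p_def q_def)
      ultimately show ?thesis by linarith
    qed
    ultimately show ?thesis
      using mult_right_mono[of "norm (G y)" "norm (H y) + q" "exp (a * y)"] by (simp add: distrib_right)
  qed
  thus ?thesis using that by blast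
qed

end

section \<open>The lower bound\<close>

text \<open>\<open>R (exp \<zeta>)\<close> for the \<open>R\<close> of the overview. In this
  variable the power of \<open>z\<close> is an exponential, so no branch has to be chosen.\<close>

definition log_remainder :: "nat \<Rightarrow> complex \<Rightarrow> complex" where
  "log_remainder k \<zeta> = lattice_theta k (exp \<zeta>) - 1
     - of_real (pi powr (k / 2)) * exp (- (of_real (k / 2) * \<zeta>))"

lemma log_remainder_of_real:
  "log_remainder k (of_real y) = of_real (theta (exp y) ^ k) - 1
     - of_real (pi powr (k / 2)) * exp (- (of_real (k / 2) * of_real y))"
  by (simp add: log_remainder_def exp_of_real lattice_theta_of_real)

lemma log_remainder_holomorphic: "log_remainder k holomorphic_on {\<zeta>. \<bar>Im \<zeta>\<bar> < pi / 2}"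
proof -
  have "Re (exp \<zeta>) > 0" if "\<bar>Im \<zeta>\<bar> < pi / 2" for \<zeta>
    using that by (auto simp: Re_exp intro!: mult_pos_pos cos_gt_zero_pi)
  hence "(lattice_theta k \<circ> exp) holomorphic_on {\<zeta>. \<bar>Im \<zeta>\<bar> < pi / 2}"
    by (intro holomorphic_on_compose_gen[OF _ lattice_theta_holomorphic]) (auto intro!: holomorphic_intros)
  thus ?thesis unfolding log_remainder_def o_def by (intro holomorphic_intros)
qed

text \<open>Rescaling by \<beta> gives the power \<open>- (a + 1)\<close>. With
  \<open>a = k / 2 - 1\<close> and \<beta> the distance to the boundary of the strip, this is the
  critical growth of order \<open>k / 2\<close>.\<close>

lemma integrable_powr_mult_exp_abs:
  assumes a: "a \<ge> 0" and \<beta>: "\<beta> > 0"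
  shows "integrable lborel (\<lambda>u::real. \<bar>u\<bar> powr a * exp (- (\<beta> * \<bar>u\<bar>)))"
    and "(\<integral>u. \<bar>u\<bar> powr a * exp (- (\<beta> * \<bar>u\<bar>)) \<partial>lborel)
           = \<beta> powr - (a + 1) * (\<integral>u. \<bar>u\<bar> powr a * exp (- \<bar>u\<bar>) \<partial>lborel)"
proof -
  define f where "f = (\<lambda>u::real. \<bar>u\<bar> powr a * exp (- \<bar>u\<bar>))"
  define n where "n = nat \<lceil>a\<rceil>"
  have n: "a \<le> real n" unfolding n_def by linarith
  have f: "integrable lborel f"
  proof (rule Bochner_Integration.integrable_bound)
    show "integrable lborel (\<lambda>u::real. exp (- (1 * \<bar>u\<bar>)) + fact n * 2 ^ n * exp (- (1 / 2 * \<bar>u\<bar>)))"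
      by (intro Bochner_Integration.integrable_add integrable_mult_right integrable_exp_minus_mult_abs) auto
    have "f u \<le> exp (- (1 * \<bar>u\<bar>)) + fact n * 2 ^ n * exp (- (1 / 2 * \<bar>u\<bar>))" for u
    proof -
      \<comment> \<open>The real exponent is rounded up to an integer \<open>n\<close>, and
        \<open>|u|^n\<close> is absorbed by half of the exponential decay through one term of the
        exponential series.\<close>
      have "\<bar>u\<bar> powr a \<le> 1 + \<bar>u\<bar> ^ n"
      proof (cases "\<bar>u\<bar> \<le> 1")
        case True
        hence "\<bar>u\<bar> powr a \<le> 1" using a by (intro powr_le1) auto
        moreover have "\<bar>u\<bar> ^ n \<ge> 0" by simp
        ultimately show ?thesis by linarith
      next
        case False
        hence "\<bar>u\<bar> powr a \<le> \<bar>u\<bar> powr real n" using n by (intro powr_mono) auto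
        thus ?thesis using False by (simp add: powr_realpow)
      qed
      also have "\<bar>u\<bar> ^ n \<le> fact n * 2 ^ n * exp (\<bar>u\<bar> / 2)"
      proof -
        have S: "(\<lambda>n. (\<bar>u\<bar> / 2) ^ n / fact n) sums exp (\<bar>u\<bar> / 2)"
          using exp_converges[of "\<bar>u\<bar> / 2"] by (simp add: field_simps)
        have "(\<bar>u\<bar> / 2) ^ n / fact n \<le> exp (\<bar>u\<bar> / 2)"
          using sum_le_suminf[OF sums_summable[OF S], of "{n}"] sums_unique[OF S] by simp
        thus ?thesis by (simp add: power_divide field_simps)
      qed
      finally have "f u \<le> (1 + fact n * 2 ^ n * exp (\<bar>u\<bar> / 2)) * exp (- \<bar>u\<bar>)"
        unfolding f_def by (intro mult_right_mono) auto
      also have "\<dots> = exp (- \<bar>u\<bar>) + fact n * 2 ^ n * (exp (\<bar>u\<bar> / 2) * exp (- \<bar>u\<bar>))"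
        by (simp only: distrib_right mult_1_left mult.assoc)
      also have "exp (\<bar>u\<bar> / 2) * exp (- \<bar>u\<bar>) = exp (- (1 / 2 * \<bar>u\<bar>))"
        by (simp flip: exp_add)
      finally show ?thesis by simp
    qed
    thus "AE u in lborel. norm (f u) \<le> norm (exp (- (1 * \<bar>u\<bar>)) + fact n * 2 ^ n * exp (- (1 / 2 * \<bar>u\<bar>)))"
      by (intro AE_I2) (simp add: f_def)
  qed (simp add: f_def)
  have eq: "\<bar>u\<bar> powr a * exp (- (\<beta> * \<bar>u\<bar>)) = \<beta> powr - a * f (0 + \<beta> * u)" for u
    using \<beta> by (simp add: f_def abs_mult powr_mult powr_minus field_simps)
  show "integrable lborel (\<lambda>u::real. \<bar>u\<bar> powr a * exp (- (\<beta> * \<bar>u\<bar>)))"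
    unfolding eq using \<beta> by (intro integrable_mult_right lborel_integrable_real_affine f) simp
  have I: "(\<integral>u. f u \<partial>lborel) = \<beta> * (\<integral>u. f (0 + \<beta> * u) \<partial>lborel)"
    using lborel_integral_real_affine[of \<beta> f 0] \<beta> by simp
  show "(\<integral>u. \<bar>u\<bar> powr a * exp (- (\<beta> * \<bar>u\<bar>)) \<partial>lborel)
           = \<beta> powr - (a + 1) * (\<integral>u. \<bar>u\<bar> powr a * exp (- \<bar>u\<bar>) \<partial>lborel)"
  proof -
    have "\<beta> powr - (a + 1) * \<beta> = \<beta> powr - a"
      using \<beta> powr_mult_base[of \<beta> "- (a + 1)"] by (simp add: mult.commute)
    hence "\<beta> powr - (a + 1) * (\<integral>u. f u \<partial>lborel) = \<beta> powr - a * (\<integral>u. f (0 + \<beta> * u) \<partial>lborel)"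
      unfolding I mult.assoc [symmetric] by simp
    thus ?thesis unfolding eq integral_mult_right_zero f_def by simp
  qed
qed

text \<open>The exponential decay of the Fourier transform lets the inversion formula, valid on the real line, be
  continued analytically to a strip; near the boundary of the strip the decay gives a bound for the function.\<close>

lemma fourier_inversion_strip_bound:
  fixes \<Phi> :: "complex \<Rightarrow> complex"
  defines "h \<equiv> (\<lambda>u. \<integral>y. \<Phi> (of_real y) * exp (\<i> * of_real (u * y)) \<partial>lborel)"
  assumes holo: "\<Phi> holomorphic_on {\<zeta>. \<bar>Im \<zeta>\<bar> < b}" and b: "b > 0"
    and bdd: "\<And>y. norm (\<Phi> (of_real y)) \<le> B" and int: "integrable lborel (\<lambda>y. \<Phi> (of_real y))"
    and decay: "\<And>u. norm (h u) \<le> M * indicator {- U..U} u + D * (\<bar>u\<bar> powr a * exp (- (b * \<bar>u\<bar>)))"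
    and nonneg: "M \<ge> 0" "U \<ge> 0" "D \<ge> 0" "a \<ge> 0"
    and \<zeta>: "\<bar>Im \<zeta>\<bar> < b"
  shows "2 * pi * norm (\<Phi> \<zeta>) \<le> M * exp (U * b) * (2 * U)
           + D * ((b - \<bar>Im \<zeta>\<bar>) powr - (a + 1) * (\<integral>u. \<bar>u\<bar> powr a * exp (- \<bar>u\<bar>) \<partial>lborel))"
proof -
  define S where "S = {\<zeta>. \<bar>Im \<zeta>\<bar> < b}"
  have S_eq: "S = {\<zeta>. Im \<zeta> < b} \<inter> {\<zeta>. Im \<zeta> > - b}" by (auto simp: S_def)
  have S: "open S" "connected S"
    unfolding S_eq
    by (auto intro!: open_Int open_halfspace_Im_lt open_halfspace_Im_gt convex_connected convex_Int
                     convex_halfspace_Im_lt convex_halfspace_Im_gt)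
  have cont: "continuous_on UNIV (\<lambda>y. \<Phi> (of_real y))"
    by (rule continuous_on_compose2[OF holomorphic_on_imp_continuous_on[OF holo]])
       (use b in \<open>auto intro!: continuous_intros\<close>)
  have [measurable]: "(\<lambda>y. \<Phi> (of_real y)) \<in> borel_measurable borel"
    by (rule borel_measurable_continuous_onI[OF cont])
  have [measurable]: "h \<in> borel_measurable borel"
    unfolding h_def by (rule sigma_finite_measure.borel_measurable_lebesgue_integral[OF sigma_finite_lborel]) measurable
  \<comment> \<open>Moving off the real line multiplies the kernel by at most
    \<open>exp (|u| |Im \<zeta>|)\<close>: on \<open>[- U, U]\<close> this is at most
    \<open>exp (U b)\<close>, outside it shortens the decay rate from \<open>b\<close> to
    \<open>b - |Im \<zeta>|\<close>.\<close>
  define m where "m = (\<lambda>\<zeta> u. M * exp (U * b) * indicator {- U..U} u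
                             + D * (\<bar>u\<bar> powr a * exp (- ((b - \<bar>Im \<zeta>\<bar>) * \<bar>u\<bar>))))"
  have m_int: "integrable lborel (m \<zeta>)" and m_val: "(\<integral>u. m \<zeta> u \<partial>lborel) = M * exp (U * b) * (2 * U)
           + D * ((b - \<bar>Im \<zeta>\<bar>) powr - (a + 1) * (\<integral>u. \<bar>u\<bar> powr a * exp (- \<bar>u\<bar>) \<partial>lborel))"
    if "\<zeta> \<in> S" for \<zeta>
  proof -
    have pos: "b - \<bar>Im \<zeta>\<bar> > 0" using that by (simp add: S_def)
    have 1: "integrable lborel (\<lambda>u. M * exp (U * b) * indicator {- U..U} u)"
      by (intro integrable_mult_right integrable_real_indicator) (use nonneg in auto)
    have 2: "integrable lborel (\<lambda>u. D * (\<bar>u\<bar> powr a * exp (- ((b - \<bar>Im \<zeta>\<bar>) * \<bar>u\<bar>))))"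
      by (intro integrable_mult_right integrable_powr_mult_exp_abs nonneg pos)
    show "integrable lborel (m \<zeta>)"
      unfolding m_def by (intro Bochner_Integration.integrable_add 1 2)
    have "(\<integral>u. indicator {- U..U} u \<partial>lborel) = 2 * U" using nonneg by simp
    thus "(\<integral>u. m \<zeta> u \<partial>lborel) = M * exp (U * b) * (2 * U)
           + D * ((b - \<bar>Im \<zeta>\<bar>) powr - (a + 1) * (\<integral>u. \<bar>u\<bar> powr a * exp (- \<bar>u\<bar>) \<partial>lborel))"
      unfolding m_def Bochner_Integration.integral_add[OF 1 2] integral_mult_right_zero
        integrable_powr_mult_exp_abs(2)[OF nonneg(4) pos] by simp
  qed
  have m_bound: "norm (h u * exp (- (\<i> * of_real u * \<zeta>))) \<le> m \<zeta> u" if "\<zeta> \<in> S" for u \<zeta>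
  proof -
    have le: "u * Im \<zeta> \<le> \<bar>u\<bar> * \<bar>Im \<zeta>\<bar>" using abs_ge_self[of "u * Im \<zeta>"] by (simp add: abs_mult)
    have "norm (h u * exp (- (\<i> * of_real u * \<zeta>))) = norm (h u) * exp (u * Im \<zeta>)"
      by (simp add: norm_mult norm_exp_eq_Re)
    also have "\<dots> \<le> (M * indicator {- U..U} u + D * (\<bar>u\<bar> powr a * exp (- (b * \<bar>u\<bar>)))) * exp (\<bar>u\<bar> * \<bar>Im \<zeta>\<bar>)"
      using le nonneg by (intro mult_mono decay) (auto intro!: add_nonneg_nonneg)
    also have "\<dots> = M * (indicator {- U..U} u * exp (\<bar>u\<bar> * \<bar>Im \<zeta>\<bar>))
        + D * (\<bar>u\<bar> powr a * (exp (- (b * \<bar>u\<bar>)) * exp (\<bar>u\<bar> * \<bar>Im \<zeta>\<bar>)))"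
      by (simp only: distrib_right mult.assoc)
    also have "exp (- (b * \<bar>u\<bar>)) * exp (\<bar>u\<bar> * \<bar>Im \<zeta>\<bar>) = exp (- ((b - \<bar>Im \<zeta>\<bar>) * \<bar>u\<bar>))"
      by (simp add: algebra_simps flip: exp_add)
    also have "M * (indicator {- U..U} u * exp (\<bar>u\<bar> * \<bar>Im \<zeta>\<bar>)) \<le> M * (exp (U * b) * indicator {- U..U} u)"
    proof (rule mult_left_mono[OF _ nonneg(1)])
      show "indicator {- U..U} u * exp (\<bar>u\<bar> * \<bar>Im \<zeta>\<bar>) \<le> exp (U * b) * indicator {- U..U} u"
      proof (cases "u \<in> {- U..U}")
        case True
        hence "\<bar>u\<bar> * \<bar>Im \<zeta>\<bar> \<le> U * b" using that by (intro mult_mono) (auto simp: S_def)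
        thus ?thesis using True by simp
      qed simp
    qed
    finally show ?thesis by (simp add: m_def mult.assoc)
  qed
  have h_int: "integrable lborel (\<lambda>u. h u * exp (- (\<i> * of_real u * \<zeta>)))" if "\<zeta> \<in> S" for \<zeta>
  proof (rule Bochner_Integration.integrable_bound[OF m_int[OF that]])
    show "AE u in lborel. norm (h u * exp (- (\<i> * of_real u * \<zeta>))) \<le> norm (m \<zeta> u)"
      using m_bound[OF that] by (intro AE_I2) (auto intro: order.trans[OF _ abs_ge_self])
  qed auto
  define Q where "Q = (\<lambda>\<zeta>. \<integral>u. h u * exp (- (\<i> * of_real u * \<zeta>)) \<partial>lborel)"
  have Q_holo: "Q holomorphic_on S"
  proof -
    \<comment> \<open>The rotation \<open>w = - i \<zeta>\<close> takes the horizontal strip to this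
      vertical one, where the Laplace lemma applies.\<close>
    define V where "V = {w. \<bar>Re w\<bar> < b}"
    have "V = {w. Re w < b} \<inter> {w. Re w > - b}" by (auto simp: V_def)
    hence V: "open V" by (auto intro!: open_Int open_halfspace_Re_lt open_halfspace_Re_gt)
    have eq: "h u * exp (- (\<i> * of_real u * \<zeta>)) = h u * exp (- \<i> * \<zeta> * of_real u)" for u \<zeta>
      by (simp add: mult_ac)
    have "(\<lambda>w. \<integral>u. h u * exp (w * of_real u) \<partial>lborel) holomorphic_on V"
    proof (rule laplace_integral_holomorphic[OF _ V])
      fix w assume "w \<in> V"
      hence "\<i> * w \<in> S" by (simp add: V_def S_def)
      from h_int[OF this] show "integrable lborel (\<lambda>u. h u * exp (w * of_real u))"
        by (simp add: eq)
    qed auto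
    hence "(\<lambda>w. \<integral>u. h u * exp (w * of_real u) \<partial>lborel) \<circ> (\<lambda>\<zeta>. - \<i> * \<zeta>) holomorphic_on S"
      by (intro holomorphic_on_compose_gen[where t = V]) (auto intro!: holomorphic_intros simp: S_def V_def)
    thus ?thesis unfolding Q_def eq o_def .
  qed
  have Q_real: "Q (of_real x) = 2 * of_real pi * \<Phi> (of_real x)" for x
  proof -
    have "integrable lborel h" using h_int[of 0] b by (simp add: S_def)
    from fourier_inversion[OF cont bdd int this[unfolded h_def], of x] show ?thesis
      by (simp add: Q_def h_def mult.assoc)
  qed
  \<comment> \<open>Both sides are holomorphic on the strip and agree on the real line, which has
    the limit point 0.\<close>
  have "Q \<zeta> - 2 * of_real pi * \<Phi> \<zeta> = 0"
  proof (rule analytic_continuation[of "\<lambda>\<zeta>. Q \<zeta> - 2 * of_real pi * \<Phi> \<zeta>" S "range of_real" 0])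
    show "(\<lambda>\<zeta>. Q \<zeta> - 2 * of_real pi * \<Phi> \<zeta>) holomorphic_on S"
      using Q_holo holo unfolding S_def by (intro holomorphic_intros)
    show "(0::complex) islimpt range of_real"
      unfolding islimpt_approachable
    proof (intro allI impI)
      fix e :: real assume "e > 0"
      thus "\<exists>x'\<in>range of_real. x' \<noteq> (0::complex) \<and> dist x' 0 < e"
        by (intro bexI[of _ "of_real (e / 2)"] rangeI) auto
    qed
    show "Q z - 2 * of_real pi * \<Phi> z = 0" if "z \<in> range of_real" for z
      using that Q_real by auto
  qed (use S b \<zeta> in \<open>auto simp: S_def\<close>)
  hence "2 * pi * norm (\<Phi> \<zeta>) = norm (Q \<zeta>)" by (simp add: norm_mult)
  also have "\<dots> \<le> (\<integral>u. m \<zeta> u \<partial>lborel)"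
    unfolding Q_def using \<zeta> by (intro Bochner_Integration.integral_norm_bound_integral h_int m_int m_bound) (auto simp: S_def)
  also have "\<dots> = M * exp (U * b) * (2 * U)
           + D * ((b - \<bar>Im \<zeta>\<bar>) powr - (a + 1) * (\<integral>u. \<bar>u\<bar> powr a * exp (- \<bar>u\<bar>) \<partial>lborel))"
    using \<zeta> by (intro m_val) (simp add: S_def)
  finally show ?thesis .
qed

text \<open>The weight \<open>exp (k y / 4)\<close> places \<open>w\<close> on
  \<open>Re w = k / 4\<close>, that is \<open>Re s = 1 / 2\<close>, and \<open>Im w = u\<close>
  corresponds to \<open>t = 2 u / k\<close>.\<close>

lemma log_remainder_mellin:
  assumes k: "k > 0"
  shows "integrable lborel (\<lambda>y. log_remainder k (of_real y) * exp (of_real (k / 4) * of_real y))"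
    and "(\<integral>y. log_remainder k (of_real y) * exp (of_real (k / 4) * of_real y) * exp (\<i> * of_real (u * y)) \<partial>lborel)
           = Gamma (Complex (k / 4) u) * epstein_zeta k (1 / 2 + \<i> * of_real (2 * u / k))"
proof -
  define s where "s = (\<lambda>u. 1 / 2 + \<i> * complex_of_real (2 * u / k))"
  have w: "of_nat k * s u / 2 = Complex (k / 4) u" for u
    using k by (simp add: s_def complex_eq_iff)
  have s: "0 < Re (s u)" "Re (s u) < 1" for u by (simp_all add: s_def)
  have exp_eq: "exp (of_real (k / 4) * of_real y) * exp (\<i> * of_real (u * y)) = exp (Complex (k / 4) u * of_real y)" for y
    by (simp add: Complex_eq algebra_simps flip: exp_add)
  show "integrable lborel (\<lambda>y. log_remainder k (of_real y) * exp (of_real (k / 4) * of_real y))"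
    using epstein_zeta_mellin_strip(1)[OF k s[of 0]] unfolding w log_remainder_of_real
    by (simp add: complex_of_real_def)
  show "(\<integral>y. log_remainder k (of_real y) * exp (of_real (k / 4) * of_real y) * exp (\<i> * of_real (u * y)) \<partial>lborel)
           = Gamma (Complex (k / 4) u) * epstein_zeta k (1 / 2 + \<i> * of_real (2 * u / k))"
    using epstein_zeta_mellin_strip(2)[OF k s[of u]] unfolding w
    unfolding log_remainder_of_real mult.assoc exp_eq s_def .
qed

lemma norm_log_remainder_bounded:
  assumes k: "k > 0"
  obtains B where "\<And>y. norm (log_remainder k (of_real y) * exp (of_real (k / 4) * of_real y)) \<le> B"
proof -
  have "0 < real k / 4" "real k / 4 < real k / 2" using k by auto
  from norm_G_bound[OF k this] obtain B where
    "\<And>y. norm (complex_of_real (theta (exp y) ^ k) - 1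
       - of_real (pi powr (k / 2)) * exp (- (of_real (k / 2) * of_real y))) * exp (k / 4 * y) \<le> B" by blast
  hence "norm (log_remainder k (of_real y) * exp (of_real (k / 4) * of_real y)) \<le> B" for y
    unfolding log_remainder_of_real norm_mult norm_exp_eq_Re by simp
  thus ?thesis using that by blast
qed

lemma log_remainder_lower_bound:
  assumes k: "k > 0"
  obtains K where "K \<ge> 0" "\<And>\<delta>. 0 < \<delta> \<Longrightarrow> \<delta> \<le> 1 \<Longrightarrow> \<delta> powr - (k / 2) - K
      \<le> norm (log_remainder k (Ln (Complex \<delta> (2 * pi))) * exp (of_real (k / 4) * Ln (Complex \<delta> (2 * pi))))"
proof -
  \<comment> \<open>Exponent 0: a bounded error is enough against a main term that tends to
    infinity.\<close>
  obtain C where C: "C > 0" "\<And>x. 0 < x \<Longrightarrow> x \<le> 1 \<Longrightarrow> \<bar>theta x ^ k - (pi / x) powr (real k / 2)\<bar> \<le> C * x ^ 0"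
    by (rule theta_power_asymptotics) blast
  define p where "p = pi powr (k / 2)"
  have p: "p \<ge> 1" unfolding p_def using pi_gt3 by (intro ge_one_powr_ge_zero) auto
  have "\<delta> powr - (k / 2) - (C + 1 + p)
      \<le> norm (log_remainder k (Ln (Complex \<delta> (2 * pi))) * exp (of_real (k / 4) * Ln (Complex \<delta> (2 * pi))))"
    if \<delta>: "0 < \<delta>" "\<delta> \<le> 1" for \<delta>
  proof -
    define z where "z = Complex \<delta> (2 * pi)"
    define \<zeta> where "\<zeta> = Ln z"
    have z0: "z \<noteq> 0" using \<delta> by (simp add: z_def complex_eq_iff)
    \<comment> \<open>\<open>Re \<zeta> >= 0\<close> serves twice: the subtracted term stays below
      \<open>p\<close>, and the weight \<open>exp (k \<zeta> / 4)\<close> has modulus at least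
      1.\<close>
    have "norm z \<ge> 1" using abs_Im_le_cmod[of z] pi_gt3 by (simp add: z_def)
    hence Re_\<zeta>: "Re \<zeta> \<ge> 0" using z0 by (simp add: \<zeta>_def)
    have "exp \<zeta> = of_real \<delta> + 2 * of_real pi * \<i>" using z0 by (simp add: \<zeta>_def z_def complex_eq_iff)
    hence "lattice_theta k (exp \<zeta>) = of_real (theta \<delta> ^ k)"
      by (simp add: lattice_theta_periodic lattice_theta_of_real \<delta>)
    hence eq: "log_remainder k \<zeta> = of_real (theta \<delta> ^ k) - 1 - of_real p * exp (- (of_real (k / 2) * \<zeta>))"
      by (simp add: log_remainder_def p_def)
    have "norm (of_real p * exp (- (of_real (k / 2) * \<zeta>))) \<le> p * 1"
      unfolding norm_mult norm_exp_eq_Re using p Re_\<zeta> by (intro mult_mono) auto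
    moreover have "norm (complex_of_real (theta \<delta> ^ k)) \<le> norm (log_remainder k \<zeta>) + 1
        + norm (of_real p * exp (- (of_real (k / 2) * \<zeta>)))"
    proof -
      have "complex_of_real (theta \<delta> ^ k) = log_remainder k \<zeta> + 1 + of_real p * exp (- (of_real (k / 2) * \<zeta>))"
        by (simp add: eq)
      also have "norm \<dots> \<le> norm (log_remainder k \<zeta> + 1) + norm (of_real p * exp (- (of_real (k / 2) * \<zeta>)))"
        by (rule norm_triangle_ineq)
      also have "norm (log_remainder k \<zeta> + 1) \<le> norm (log_remainder k \<zeta>) + 1"
        using norm_triangle_ineq[of "log_remainder k \<zeta>" 1] by simp
      finally show ?thesis by simp
    qed
    moreover have "theta \<delta> ^ k \<le> norm (complex_of_real (theta \<delta> ^ k))" unfolding norm_of_real by (rule abs_ge_self)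
    moreover have "\<bar>theta \<delta> ^ k - (pi / \<delta>) powr (k / 2)\<bar> \<le> C" using C(2)[OF \<delta>] by simp
    moreover have "\<delta> powr - (k / 2) \<le> (pi / \<delta>) powr (k / 2)"
    proof -
      have "(pi / \<delta>) powr (k / 2) = p * \<delta> powr - (k / 2)"
        using \<delta> by (simp add: p_def powr_divide powr_minus field_simps)
      thus ?thesis using mult_right_mono[OF p, of "\<delta> powr - (k / 2)"] by simp
    qed
    ultimately have "\<delta> powr - (k / 2) - (C + 1 + p) \<le> norm (log_remainder k \<zeta>)" by linarith
    also have "\<dots> = norm (log_remainder k \<zeta>) * 1" by simp
    also have "\<dots> \<le> norm (log_remainder k \<zeta>) * norm (exp (of_real (k / 4) * \<zeta>))"
      unfolding norm_exp_eq_Re using Re_\<zeta> by (intro mult_left_mono) auto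
    finally show ?thesis by (simp add: norm_mult \<zeta>_def z_def)
  qed
  moreover have "C + 1 + p \<ge> 0" using C(1) p by linarith
  ultimately show ?thesis using that by blast
qed

text \<open>With \<phi> the argument of \<open>z\<close>, \<delta> is \<open>|z| cos \<phi>\<close>,
  hence at most \<open>|z|\<close> times the gap \<open>pi / 2 - |\<phi>|\<close>; and
  \<open>|z| <= 1 + 2 pi < 9\<close>.\<close>

lemma pi_half_minus_Arg_ge:
  assumes \<delta>: "0 < \<delta>" "\<delta> \<le> 1"
  shows "\<bar>Im (Ln (Complex \<delta> (2 * pi)))\<bar> < pi / 2"
    and "\<delta> / 9 \<le> pi / 2 - \<bar>Im (Ln (Complex \<delta> (2 * pi)))\<bar>"
proof -
  define z where "z = Complex \<delta> (2 * pi)"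
  define \<phi> where "\<phi> = Im (Ln z)"
  have z0: "z \<noteq> 0" using \<delta> by (simp add: z_def complex_eq_iff)
  have \<phi>: "\<bar>\<phi>\<bar> < pi / 2" using Re_Ln_pos_lt[OF z0] \<delta> by (simp add: \<phi>_def z_def)
  have "\<delta> = Re (exp (Ln z))" using z0 by (simp add: z_def)
  also have "\<dots> = exp (Re (Ln z)) * cos \<phi>" by (simp only: Re_exp \<phi>_def)
  also have "exp (Re (Ln z)) = norm z" using z0 by simp
  also have "cos \<phi> = sin (pi / 2 - \<bar>\<phi>\<bar>)" 
    using cos_sin_eq[of "\<bar>\<phi>\<bar>"] by simp
  also have "norm z * sin (pi / 2 - \<bar>\<phi>\<bar>) \<le> norm z * (pi / 2 - \<bar>\<phi>\<bar>)"
    using \<phi> by (intro mult_left_mono sin_x_le_x) auto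
  finally have "\<delta> \<le> norm z * (pi / 2 - \<bar>\<phi>\<bar>)" .
  also have "\<dots> \<le> 9 * (pi / 2 - \<bar>\<phi>\<bar>)"
  proof (rule mult_right_mono)
    have "norm z \<le> \<bar>\<delta>\<bar> + \<bar>2 * pi\<bar>" using cmod_le[of z] by (simp add: z_def)
    thus "norm z \<le> 9" using \<delta> pi_less_4 by simp
  qed (use \<phi> in auto)
  finally show "\<delta> / 9 \<le> pi / 2 - \<bar>Im (Ln (Complex \<delta> (2 * pi)))\<bar>" by (simp add: \<phi>_def z_def)
  show "\<bar>Im (Ln (Complex \<delta> (2 * pi)))\<bar> < pi / 2" using \<phi> by (simp add: \<phi>_def z_def)
qed

theorem theorem2:
  fixes k :: nat
  assumes "k \<ge> 4"
  shows "Limsup at_infinity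
           (\<lambda>t::real. ereal (cmod (epstein_zeta k (1/2 + \<i> * of_real t))
                             * (1 + \<bar>t\<bar>) powr (- (real k / 4 - 1 / 2)))) > 0"
proof (rule ccontr)
  assume "\<not> ?thesis"
  hence small: "Limsup at_infinity (\<lambda>t::real. ereal (cmod (epstein_zeta k (1/2 + \<i> * of_real t))
                 * (1 + \<bar>t\<bar>) powr (- (real k / 4 - 1 / 2)))) \<le> 0" by simp
  define x where "x = real k / 4"
  \<comment> \<open>The hypothesis \<open>k >= 4\<close> enters as \<open>x >= 1\<close>, the range
    of the Gamma bound.\<close>
  have k: "k > 0" and x: "x \<ge> 1" and kx: "real k / 2 = 2 * x" using assms by (auto simp: x_def)
  define \<Phi> where "\<Phi> = (\<lambda>\<zeta>. log_remainder k \<zeta> * exp (of_real (k / 4) * \<zeta>))"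
  define h where "h = (\<lambda>u. \<integral>y. \<Phi> (of_real y) * exp (\<i> * of_real (u * y)) \<partial>lborel)"
  have h: "h u = Gamma (Complex x u) * epstein_zeta k (1 / 2 + \<i> * of_real (2 * u / k))" for u
    unfolding h_def \<Phi>_def x_def by (rule log_remainder_mellin(2)[OF k])
  have \<Phi>_int: "integrable lborel (\<lambda>y. \<Phi> (of_real y))"
    unfolding \<Phi>_def by (rule log_remainder_mellin(1)[OF k])
  have \<Phi>_holo: "\<Phi> holomorphic_on {\<zeta>. \<bar>Im \<zeta>\<bar> < pi / 2}"
    unfolding \<Phi>_def by (intro holomorphic_intros log_remainder_holomorphic)
  obtain B where B: "\<And>y. norm (\<Phi> (of_real y)) \<le> B"
    unfolding \<Phi>_def by (rule norm_log_remainder_bounded[OF k]) blast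
  obtain K where K: "K \<ge> 0" "\<And>\<delta>. 0 < \<delta> \<Longrightarrow> \<delta> \<le> 1 \<Longrightarrow>
      \<delta> powr - (2 * x) - K \<le> norm (\<Phi> (Ln (Complex \<delta> (2 * pi))))"
    unfolding \<Phi>_def kx [symmetric] by (rule log_remainder_lower_bound[OF k]) blast
  obtain C where C: "C > 0" "\<And>u. \<bar>u\<bar> \<ge> 1 \<Longrightarrow>
      norm (Gamma (Complex x u)) \<le> C * \<bar>u\<bar> powr (x - 1/2) * exp (- (pi * \<bar>u\<bar> / 2))"
    by (rule norm_Gamma_vertical_bound[OF x]) blast
  define J where "J = (\<integral>u. \<bar>u\<bar> powr (2 * x - 1) * exp (- \<bar>u\<bar>) \<partial>lborel)"
  have J: "J \<ge> 0" unfolding J_def by (intro Bochner_Integration.integral_nonneg) auto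
  define L where "L = C * 2 powr (x - 1/2) * 9 powr (2 * x)"
  have L: "L > 0" using C(1) by (simp add: L_def)
  \<comment> \<open>Chosen so that the tail contributes at most half of
    \<open>\<delta> powr (- k / 2)\<close>. \<open>L\<close> collects the constant of the Gamma
    bound, \<open>2 powr (x - 1/2)\<close> from \<open>1 + |t| <= 2 |u|\<close>, and
    \<open>9 powr (2 * x)\<close> from the angular gap; \<open>J + 1\<close> avoids a division by
    0.\<close>
  define \<epsilon> where "\<epsilon> = 1 / (2 * L * (J + 1))"
  have \<epsilon>: "\<epsilon> > 0" using L J by (simp add: \<epsilon>_def)
  have "\<epsilon> * L = 1 / (2 * (J + 1))" using L by (simp add: \<epsilon>_def)
  hence "\<epsilon> * L * J = J / (2 * (J + 1))" by simp
  also have "\<dots> \<le> 1 / 2" using J by (simp add: field_simps)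
  finally have \<epsilon>L: "\<epsilon> * L * J \<le> 1 / 2" .
  define D where "D = \<epsilon> * C * 2 powr (x - 1/2)"
  have D: "D \<ge> 0" using \<epsilon> C(1) by (simp add: D_def)
  have "Limsup at_infinity (\<lambda>t::real. ereal (cmod (epstein_zeta k (1/2 + \<i> * of_real t))
                 * (1 + \<bar>t\<bar>) powr (- (real k / 4 - 1 / 2)))) < ereal \<epsilon>"
    using small \<epsilon> by (intro le_less_trans[OF small]) simp
  from Limsup_lessD[OF this] obtain b where b: "\<And>t::real. \<bar>t\<bar> \<ge> b \<Longrightarrow>
      cmod (epstein_zeta k (1/2 + \<i> * of_real t)) * (1 + \<bar>t\<bar>) powr (- (x - 1/2)) < \<epsilon>"
    unfolding eventually_at_infinity x_def by auto
  \<comment> \<open>Beyond \<open>U\<close> both bounds apply: \<open>|u| >= 1\<close> for Gamma,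
    and \<open>|t| = 2 |u| / k >= b\<close> for the assumed smallness of the zeta function.\<close>
  define U where "U = max 1 (\<bar>b\<bar> * k)"
  have U: "U \<ge> 1" "\<bar>b\<bar> * k \<le> U" by (auto simp: U_def)
  define M where "M = (\<integral>y. norm (\<Phi> (of_real y)) \<partial>lborel)"
  have M: "M \<ge> 0" unfolding M_def by (intro Bochner_Integration.integral_nonneg) auto
  \<comment> \<open>On the compact range the trivial bound by the integral of the norm suffices,
    since it contributes only a constant independent of \<delta>.\<close>
  have decay: "norm (h u) \<le> M * indicator {- U..U} u
                 + D * (\<bar>u\<bar> powr (2 * x - 1) * exp (- (pi / 2 * \<bar>u\<bar>)))" for u
  proof (cases "\<bar>u\<bar> \<le> U")
    case True
    have "norm (h u) \<le> (\<integral>y. norm (\<Phi> (of_real y) * exp (\<i> * of_real (u * y))) \<partial>lborel)"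
      unfolding h_def by (rule integral_norm_bound)
    also have "\<dots> = M" by (simp add: M_def norm_mult)
    also have "\<dots> = M * indicator {- U..U} u" using True by (auto simp: indicator_def)
    also have "\<dots> \<le> M * indicator {- U..U} u + D * (\<bar>u\<bar> powr (2 * x - 1) * exp (- (pi / 2 * \<bar>u\<bar>)))"
      using D by simp
    finally show ?thesis .
  next
    case False
    define t where "t = 2 * u / real k"
    have u: "\<bar>u\<bar> \<ge> 1" using False U(1) by linarith
    have "\<bar>b\<bar> * real k \<le> \<bar>t\<bar> * real k" using False U k by (simp add: t_def)
    hence "b \<le> \<bar>t\<bar>" using k by simp
    hence "cmod (epstein_zeta k (1/2 + \<i> * of_real t)) \<le> \<epsilon> * (1 + \<bar>t\<bar>) powr (x - 1/2)"
      using b[of t] by (simp add: powr_minus field_simps)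
    also have "(1 + \<bar>t\<bar>) powr (x - 1/2) \<le> (2 * \<bar>u\<bar>) powr (x - 1/2)"
    proof (rule powr_mono2)
      have "\<bar>t\<bar> \<le> \<bar>u\<bar>" using k assms mult_right_mono[of 2 "real k" "\<bar>u\<bar>"] by (simp add: t_def field_simps)
      thus "1 + \<bar>t\<bar> \<le> 2 * \<bar>u\<bar>" using u by linarith
    qed (use x in auto)
    finally have E: "cmod (epstein_zeta k (1/2 + \<i> * of_real t)) \<le> \<epsilon> * (2 * \<bar>u\<bar>) powr (x - 1/2)"
      using \<epsilon> by simp
    have "norm (h u) = norm (Gamma (Complex x u)) * cmod (epstein_zeta k (1/2 + \<i> * of_real t))"
      by (simp add: h norm_mult t_def)
    also have "\<dots> \<le> (C * \<bar>u\<bar> powr (x - 1/2) * exp (- (pi * \<bar>u\<bar> / 2))) * (\<epsilon> * (2 * \<bar>u\<bar>) powr (x - 1/2))"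
      using C by (intro mult_mono E C(2) u) auto
    also have "\<dots> = D * (\<bar>u\<bar> powr (x - 1/2) * \<bar>u\<bar> powr (x - 1/2) * exp (- (pi / 2 * \<bar>u\<bar>)))"
      by (simp add: D_def powr_mult mult_ac)
    also have "\<bar>u\<bar> powr (x - 1/2) * \<bar>u\<bar> powr (x - 1/2) = \<bar>u\<bar> powr (2 * x - 1)"
      by (simp flip: powr_add)
    also have "D * (\<bar>u\<bar> powr (2 * x - 1) * exp (- (pi / 2 * \<bar>u\<bar>)))
        \<le> M * indicator {- U..U} u + D * (\<bar>u\<bar> powr (2 * x - 1) * exp (- (pi / 2 * \<bar>u\<bar>)))"
      using M by simp
    finally show ?thesis .
  qed
  define A where "A = M * exp (U * (pi / 2)) * (2 * U)"
  have A: "A \<ge> 0" using M U by (simp add: A_def)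
  \<comment> \<open>The upper bound \<open>A + \<delta> powr (- 2 x) / 2\<close> meets the lower
    bound \<open>\<delta> powr (- 2 x) - K\<close> at the same point; the leading coefficient
    \<open>1 / 2 < 1\<close> decides.\<close>
  have bound: "\<delta> powr - (2 * x) \<le> 2 * (K + A)" if \<delta>: "0 < \<delta>" "\<delta> \<le> 1" for \<delta>
  proof -
    define \<zeta> where "\<zeta> = Ln (Complex \<delta> (2 * pi))"
    define \<beta> where "\<beta> = pi / 2 - \<bar>Im \<zeta>\<bar>"
    note \<zeta> = pi_half_minus_Arg_ge[OF \<delta>, folded \<zeta>_def]
    have "2 * pi * norm (\<Phi> \<zeta>) \<le> A + D * (\<beta> powr - (2 * x - 1 + 1) * J)"
      unfolding A_def J_def \<beta>_def
      by (rule fourier_inversion_strip_bound[OF \<Phi>_holo _ B \<Phi>_int decay[unfolded h_def] M _ D _ \<zeta>(1)])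
         (use U x in auto)
    also have "\<beta> powr - (2 * x - 1 + 1) \<le> (\<delta> / 9) powr - (2 * x - 1 + 1)"
      using \<zeta>(2) \<delta> x by (intro powr_mono2') (auto simp: \<beta>_def)
    also have "(\<delta> / 9) powr - (2 * x - 1 + 1) = 9 powr (2 * x) * \<delta> powr - (2 * x)"
      using \<delta> by (simp add: powr_divide powr_minus field_simps)
    finally have "2 * pi * norm (\<Phi> \<zeta>) \<le> A + D * (9 powr (2 * x) * \<delta> powr - (2 * x) * J)"
      using D J by (simp add: mult_left_mono mult_right_mono)
    also have "D * (9 powr (2 * x) * \<delta> powr - (2 * x) * J) = (\<epsilon> * L * J) * \<delta> powr - (2 * x)"
      by (simp add: D_def L_def mult_ac)
    also have "\<dots> \<le> 1 / 2 * \<delta> powr - (2 * x)" using \<epsilon>L by (intro mult_right_mono) auto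
    finally have "2 * pi * norm (\<Phi> \<zeta>) \<le> A + 1 / 2 * \<delta> powr - (2 * x)" by simp
    moreover have "1 * norm (\<Phi> \<zeta>) \<le> 2 * pi * norm (\<Phi> \<zeta>)"
      using pi_gt3 by (intro mult_right_mono) auto
    ultimately show ?thesis using K(2)[OF \<delta>] by (simp add: \<zeta>_def)
  qed
  \<comment> \<open>Evaluating the bound at \<open>\<delta> = 1 / y\<close> with
    \<open>2 x >= 1\<close> gives \<open>y <= y - 1\<close>.\<close>
  define y where "y = 2 * (K + A) + 1"
  have y: "y \<ge> 1" using K(1) A by (simp add: y_def)
  have "y powr 1 \<le> y powr (2 * x)" using y x by (intro powr_mono) auto
  also have "\<dots> = (1 / y) powr - (2 * x)" using y by (simp add: powr_divide powr_minus)
  also have "\<dots> \<le> 2 * (K + A)" using y by (intro bound) auto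
  finally show False using y by (simp add: y_def)
qed

end
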